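(* Let $n\ge 2$, $S=1_n$ and $T=\mathrm{diag}(1_{n-2},p^a,p^b)$ for integers $0\le a<b$ with $a+b$ odd. Then $\alpha_p(S,T)=0$ and $$\frac{\alpha_p'(S,T)}{\alpha_p(S,S)}=\frac12\sum_{\ell=0}^{a}p^\ell(a+b-2\ell+1),$$ where $$\alpha_p(S,S)=\prod_{\ell=1}^{n}\bigl(1-(-1)^\ell p^{-\ell}\bigr).$$
   Context: $p$ is an odd prime, $O_{\mathbf k}=\mathbb Z_{p^2}$ is the ring of integers of the unramified quadratic extension $\mathbf k$ of $\mathbb Q_p$, with Galois automorphism $\sigma$; $\mathrm{Herm}_m(O_{\mathbf k})$ is the set of hermitian $m\times m$ matrices. For nonsingular $S\in\mathrm{Herm}_m(O_{\mathbf k})$, $T\in\mathrm{Herm}_n(O_{\mathbf k})$ with $m\ge n$, the representation density is $$\alpha_p(S,T)=\lim_{k\to\infty}(p^{-k})^{n(2m-n)}\,|A_{p^k}(S,T)|,\qquad A_{p^k}(S,T)=\{x\in M_{m,n}(O_{\mathbf k}/p^kO_{\mathbf k})\mid S[x]\equiv T \bmod p^k\},$$ with $S[x]={}^tx\,S\,\sigma(x)$. For $r\ge0$ let $S_r=\mathrm{diag}(S,1_r)$. There is a (unique) polynomial $F_p(S,T;X)\in\mathbb Q[X]$ with $\alpha_p(S_r,T)=F_p(S,T;(-p)^{-r})$ for all $r\ge0$. If $m=n$ and $\mathrm{ord}(\det S)+\mathrm{ord}(\det T)$ is odd, then one defines $\alpha_p'(S,T)=-\frac{\partial}{\partial X}F_p(S,T;X)\big|_{X=1}$.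 *)

theory Defs
  imports Complex_Main "HOL-Computational_Algebra.Polynomial" "Jordan_Normal_Form.Matrix"
begin

text \<open>
  A non-archimedean absolute value \<open>v\<close> on a field, normalised by \<open>v p = 1/p\<close>.
\<close>

locale nonarch_abs_value =
  fixes p :: nat and v :: "'a::field_char_0 \<Rightarrow> real"
  assumes prime_p: "prime p"
    and nonneg: "v x \<ge> 0"
    and eq_0_iff: "v x = 0 \<longleftrightarrow> x = 0"
    and mult: "v (x * y) = v x * v y"
    and ultrametric: "v (x + y) \<le> max (v x) (v y)"
    and normalised: "v (of_nat p) = 1 / real p"

text \<open>
  The field of \<open>p\<close>-adic numbers as the completion of the rationals: the normalisation forces
  \<open>v\<close> to restrict to the \<open>p\<close>-adic absolute value on the rationals.
  Since \<open>p\<close> is a variable, the field is an arbitrary type carrying this structure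
  (it is unique up to isomorphism).
\<close>

locale padic_field = nonarch_abs_value p v
  for p :: nat and v :: "'q::field_char_0 \<Rightarrow> real" +
  assumes rat_dense: "e > 0 \<Longrightarrow> \<exists>q::rat. v (x - of_rat q) < e"
    and complete: "(\<And>e. e > 0 \<Longrightarrow> \<exists>N. \<forall>i\<ge>N. \<forall>j\<ge>N. v (X i - X j) < e) \<Longrightarrow>
      \<exists>L. (\<lambda>i. v (X i - L)) \<longlonglongrightarrow> 0"

text \<open>
  \<open>\<iota>\<close> embeds the \<open>p\<close>-adic field \<open>'q\<close> into \<open>'k\<close>, \<open>w\<close> is the (unique) extension of
  the absolute value \<open>v\<close>, and \<open>\<sigma>\<close> is the nontrivial element of the Galois group.
  Unramified means ramification index 1, i.e. the value groups coincide.
\<close>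

locale unramified_quadratic_extension =
  Qp: padic_field p v + K: nonarch_abs_value p w + emb: field_hom \<iota> + gal: field_hom \<sigma>
  for p :: nat and v :: "'q::field_char_0 \<Rightarrow> real" and w :: "'k::field_char_0 \<Rightarrow> real"
    and \<iota> :: "'q \<Rightarrow> 'k" and \<sigma> :: "'k \<Rightarrow> 'k" +
  assumes extends: "w (\<iota> a) = v a"
    and degree_2: "vector_space.dim (\<lambda>(c::'q) (x::'k). \<iota> c * x) UNIV = 2"
    and unramified: "range w = range v"
    and gal_bij: "bij \<sigma>"
    and gal_fixes: "\<sigma> (\<iota> a) = \<iota> a"
    and gal_nontrivial: "\<sigma> \<noteq> id"

definition integer_ring :: "('k \<Rightarrow> real) \<Rightarrow> 'k set" where
  "integer_ring w = {x. w x \<le> 1}"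

text \<open>The ideal generated by \<open>p^k\<close> in the ring of integers, and the residue class of \<open>x\<close> modulo it.\<close>

definition ppow_ideal :: "nat \<Rightarrow> ('k::field_char_0 \<Rightarrow> real) \<Rightarrow> nat \<Rightarrow> 'k set" where
  "ppow_ideal p w k = {of_nat p ^ k * y | y. y \<in> integer_ring w}"

definition residue_class :: "nat \<Rightarrow> ('k::field_char_0 \<Rightarrow> real) \<Rightarrow> nat \<Rightarrow> 'k \<Rightarrow> 'k set" where
  "residue_class p w k x = {y \<in> integer_ring w. y - x \<in> ppow_ideal p w k}"

definition herm_form :: "('k::field \<Rightarrow> 'k) \<Rightarrow> 'k mat \<Rightarrow> 'k mat \<Rightarrow> 'k mat" where
  "herm_form \<sigma> S x = transpose_mat x * S * map_mat \<sigma> x"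

text \<open>
  The solution set of \<open>S[x] \<equiv> T\<close> modulo \<open>p^k\<close>, as a set of matrices whose entries are residue
  classes modulo \<open>p^k\<close>; the congruence depends only on these classes when \<open>S\<close> is integral.
  This and the following notions are meant for integral hermitian nonsingular \<open>S\<close> and \<open>T\<close> of sizes
  \<open>m \<ge> n\<close>.
\<close>

definition rep_set ::
  "nat \<Rightarrow> ('k::field_char_0 \<Rightarrow> real) \<Rightarrow> ('k \<Rightarrow> 'k) \<Rightarrow> nat \<Rightarrow> 'k mat \<Rightarrow> 'k mat \<Rightarrow> 'k set mat set" where
  "rep_set p w \<sigma> k S T = map_mat (residue_class p w k) `
     {x \<in> carrier_mat (dim_row S) (dim_row T).
        elements_mat x \<subseteq> integer_ring w \<and>
        elements_mat (herm_form \<sigma> S x - T) \<subseteq> ppow_ideal p w k}"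

definition rep_density ::
  "nat \<Rightarrow> ('k::field_char_0 \<Rightarrow> real) \<Rightarrow> ('k \<Rightarrow> 'k) \<Rightarrow> 'k mat \<Rightarrow> 'k mat \<Rightarrow> real" where
  "rep_density p w \<sigma> S T =
     (let m = dim_row S; n = dim_row T in
      lim (\<lambda>k. (1 / real p ^ k) ^ (n * (2 * m - n)) * real (card (rep_set p w \<sigma> k S T))))"

definition extend_by_one :: "'k::{zero,one} mat \<Rightarrow> nat \<Rightarrow> 'k mat" where
  "extend_by_one S r = diag_block_mat [S, 1\<^sub>m r]"

definition rep_poly ::
  "nat \<Rightarrow> ('k::field_char_0 \<Rightarrow> real) \<Rightarrow> ('k \<Rightarrow> 'k) \<Rightarrow> 'k mat \<Rightarrow> 'k mat \<Rightarrow> rat poly" where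
  "rep_poly p w \<sigma> S T = (THE F. \<forall>r::nat.
     rep_density p w \<sigma> (extend_by_one S r) T
       = poly (map_poly of_rat F) ((- real p) powi (- int r)))"

text \<open>Considered only for \<open>S\<close>, \<open>T\<close> of equal size with \<open>ord (det S) + ord (det T)\<close> odd.\<close>

definition rep_density_deriv ::
  "nat \<Rightarrow> ('k::field_char_0 \<Rightarrow> real) \<Rightarrow> ('k \<Rightarrow> 'k) \<Rightarrow> 'k mat \<Rightarrow> 'k mat \<Rightarrow> real" where
  "rep_density_deriv p w \<sigma> S T = - of_rat (poly (pderiv (rep_poly p w \<sigma> S T)) 1)"

end

theory Submission
  imports Defs
begin

text \<open>
  Put \<open>X = (- p)^(-r)\<close>. For a large modulus \<open>p^k\<close> the solutions of \<open>S\<^sub>r[x] \<equiv> T\<close> are counted as an average over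
  all matrices modulo \<open>p^k\<close>, one column at a time.

  A single column: up to the factor \<open>p^k\<close>, the indicator of \<open>p^k | u\<close> is the sum of the functions
  \<open>\<chi> l u\<close> for \<open>l \<le> k\<close>, which collect the additive characters of conductor \<open>p^l\<close>. Averaging
  \<open>\<chi> l (u - N c)\<close> over the integers \<open>c\<close> of the quadratic extension multiplies \<open>\<chi> l u\<close> by \<open>(- p)^(-l)\<close> (\<open>mean_\<chi>_norm\<close>). Hence a vector of length \<open>m\<close> contributes the factor
  \<open>(- p)^(-lm)\<close> (\<open>mean_\<chi>_herm\<close>), and this is why densities are polynomials in \<open>X\<close>.

  Columns of norm \<open>1\<close>: a quasi-reflection moves such a column to a multiple of a basis vector, so that the
  other columns live in rank \<open>m - 1\<close>. The column itself contributes \<open>1 - (- p)^(-m)\<close> (\<open>dens_unit\<close>). This gives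
  the value of the density at \<open>(S, S)\<close> and reduces \<open>T\<close> to \<open>diag(p^a, p^b)\<close>.

  The last two columns: write the first one as \<open>p^i x\<close> with \<open>x\<close> primitive. An isometry moves \<open>x\<close> into a plane;
  the second column is then constrained to a lattice of rank \<open>r + 1\<close>, the sum of a unit lattice of rank \<open>r\<close> and
  a line of norm \<open>p^(a - 2i)\<close>. As \<open>a + b\<close> is odd, the line never represents \<open>p^b\<close> and only finitely many \<open>\<chi> l\<close>
  contribute, independently of \<open>k\<close> (\<open>mean_orthogonal_primitive\<close>). Summation over \<open>i\<close> yields the density
  polynomial in the form \<open>(1 - X) G(X)\<close> (\<open>dens_pair\<close>, \<open>rep_poly_pair\<close>). So the density at \<open>X = 1\<close> is zero, the
  derivative in question is \<open>G(1)\<close>, and \<open>G(1)\<close> is a finite sum evaluated by induction (\<open>derivative_sum\<close>).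
\<close>

section \<open>Absolute values of rational numbers\<close>

context nonarch_abs_value
begin

lemma p_gt_1: "real p > 1"
  using prime_p prime_gt_1_nat by simp

lemma abs_0 [simp]: "v 0 = 0"
  using eq_0_iff by blast

lemma abs_1 [simp]: "v 1 = 1"
  using mult[of 1 1] eq_0_iff[of 1] by simp

lemma abs_minus [simp]: "v (- x) = v x"
proof -
  have "v (- 1) * v (- 1) = 1"
    using mult[of "- 1" "- 1"] by simp
  then have "v (- 1) = 1"
    using nonneg[of "- 1"] by (metis abs_of_nonneg abs_mult_self_eq one_power2 power2_eq_iff power2_eq_square
        real_sqrt_abs2 real_sqrt_one)
  then show ?thesis
    using mult[of "- 1" x] by simp
qed

lemma abs_diff_le: "v (x - y) \<le> max (v x) (v y)"
  using ultrametric[of x "- y"] by simp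

lemma abs_diff_commute: "v (x - y) = v (y - x)"
  using abs_minus[of "x - y"] by simp

lemma abs_power: "v (x ^ n) = v x ^ n"
  by (induction n) (auto simp: mult)

lemma abs_inverse: "v (inverse x) = inverse (v x)"
proof (cases "x = 0")
  case False
  then show ?thesis
    using mult[of x "inverse x"] eq_0_iff[of x] by (simp add: field_simps)
qed auto

lemma abs_divide: "v (x / y) = v x / v y"
  by (simp add: divide_inverse mult abs_inverse)

lemma abs_p_power: "v (of_nat p ^ k) = (1 / real p) ^ k"
  by (simp add: abs_power normalised)

lemma abs_add_eq: "v x < v y \<Longrightarrow> v (x + y) = v y"
  using ultrametric[of x y] abs_diff_le[of "x + y" x] by (auto simp: max_def split: if_splits)

lemma abs_of_nat_le: "v (of_nat n) \<le> 1"
proof (induction n)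
  case (Suc n)
  then show ?case
    using ultrametric[of 1 "of_nat n"] by simp
qed auto

lemma abs_of_int_le: "v (of_int z) \<le> 1"
  by (cases z rule: int_cases2) (auto simp: abs_of_nat_le)

lemma abs_of_int_unit:
  assumes "\<not> int p dvd z"
  shows "v (of_int z) = 1"
proof (rule antisym[OF abs_of_int_le])
  have "coprime (int p) z"
    using assms prime_p by (simp add: prime_imp_coprime)
  then obtain s t where st: "s * int p + t * z = 1"
    by (metis bezout_int coprime_imp_gcd_eq_1)
  have "v (of_int (s * int p)) < 1"
  proof -
    have "v (of_int (s * int p)) \<le> 1 * (1 / real p)"
      using abs_of_int_le[of s] p_gt_1 by (simp add: mult normalised divide_right_mono)
    also have "\<dots> < 1" using p_gt_1 by simp
    finally show ?thesis .
  qed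
  moreover have "1 = v (of_int (s * int p) + of_int (t * z))"
    by (metis abs_1 of_int_1 of_int_add st)
  ultimately have "1 \<le> v (of_int (t * z))"
    using ultrametric[of "of_int (s * int p)" "of_int (t * z)"] by (auto simp: max_def split: if_splits)
  then show "1 \<le> v (of_int z)"
    using abs_of_int_le[of t] nonneg[of "of_int z"] by (simp add: mult)
      (metis mult_left_le_one_le mult_right_mono nonneg order_trans mult_1)
qed

lemma abs_of_int_le_iff: "v (of_int z) \<le> (1 / real p) ^ k \<longleftrightarrow> int p ^ k dvd z"
proof (cases "z = 0")
  case False
  obtain j y where zy: "z = int p ^ j * y" "\<not> int p dvd y"
    using multiplicity_decompose'[of z "int p"] False prime_p
    by (metis not_prime_unit prime_nat_int_transfer)
  have "v (of_int z) = (1 / real p) ^ j"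
    using zy abs_of_int_unit by (simp add: mult abs_power normalised)
  moreover have "(1 / real p) ^ j \<le> (1 / real p) ^ k \<longleftrightarrow> k \<le> j"
    using p_gt_1 by (intro power_decreasing_iff) auto
  moreover have "int p ^ k dvd z \<longleftrightarrow> k \<le> j"
  proof
    show "k \<le> j" if d: "int p ^ k dvd z"
    proof (rule ccontr)
      assume "\<not> k \<le> j"
      then have "int p ^ Suc j dvd z"
        using d by (meson dvd_trans le_imp_power_dvd not_less_eq_eq)
      then show False
        using zy prime_p by auto
    qed
  qed (simp add: zy le_imp_power_dvd dvd_mult2)
  ultimately show ?thesis
    by simp
qed auto

end

context padic_field
begin

text \<open>By density of the rationals, the value group is generated by \<open>p\<close>.\<close>

lemma abs_eq_powi:
  assumes "x \<noteq> 0"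
  shows "\<exists>z. v x = real p powi z"
proof -
  obtain q :: rat where q: "v (x - of_rat q) < v x"
    using rat_dense[of "v x" x] assms nonneg[of x] eq_0_iff[of x] by force
  have vq: "v x = v (of_rat q)"
    using abs_add_eq[of "of_rat q - x" x] q by (simp add: abs_diff_commute)
  obtain i j where ij: "q = of_int i / of_int j" "j \<noteq> 0"
    by (metis less_irrefl quotient_of_denom_pos quotient_of_div surj_pair)
  have i0: "i \<noteq> 0"
    using assms vq eq_0_iff[of x] ij by auto
  have *: "\<exists>n. v (of_int k) = (1 / real p) ^ n" if k: "k \<noteq> 0" for k
  proof -
    have "\<not> is_unit (int p)"
      using prime_p by (metis not_prime_unit prime_nat_int_transfer)
    then obtain n y where "k = int p ^ n * y" "\<not> int p dvd y"
      using multiplicity_decompose'[of k "int p"] k by metis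
    then have "v (of_int k) = (1 / real p) ^ n"
      using abs_of_int_unit by (simp add: mult abs_power normalised)
    then show ?thesis ..
  qed
  obtain m n where mn: "v (of_int i) = (1 / real p) ^ m" "v (of_int j) = (1 / real p) ^ n"
    using * i0 ij(2) by metis
  have "v (of_rat q) = (1 / real p) ^ m / (1 / real p) ^ n"
    using ij mn by (simp add: of_rat_divide abs_divide)
  also have "\<dots> = real p powi (int n - int m)"
    using p_gt_1 by (simp add: power_int_diff power_divide)
  finally show ?thesis
    using vq by auto
qed

text \<open>
  A rational number close to \<open>x\<close> has denominator prime to \<open>p\<close>, which can be inverted modulo \<open>p^k\<close>.
\<close>

lemma exists_nat_approx:
  assumes "v x \<le> 1"
  shows "\<exists>n < p ^ k. v (x - of_nat n) \<le> (1 / real p) ^ k"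
proof -
  obtain q :: rat where q: "v (x - of_rat q) < (1 / real p) ^ k"
    using rat_dense[of "(1 / real p) ^ k" x] p_gt_1 by auto
  have "(1 / real p) ^ k \<le> 1"
    using p_gt_1 by (simp add: power_le_one)
  then have q1: "v (of_rat q) \<le> 1"
    using abs_diff_le[of x "x - of_rat q"] assms q by (auto simp: max_def split: if_splits)
  obtain i j where ij: "q = of_int i / of_int j" "j > 0" "coprime i j"
    by (metis quotient_of_div quotient_of_coprime quotient_of_denom_pos surj_pair)
  have "\<not> int p dvd j"
  proof
    assume pj: "int p dvd j"
    then have "\<not> int p dvd i"
      using ij(3) prime_p by (metis coprime_common_divisor not_prime_unit prime_nat_int_transfer)
    then have vi: "v (of_int i) = 1"
      by (rule abs_of_int_unit)
    have "v (of_int j) \<le> 1 / real p"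
      using abs_of_int_le_iff[of j 1] pj by simp
    then have vj: "v (of_int j) < 1"
      using p_gt_1 by (simp add: order_le_less_trans)
    have "v (of_int j) \<noteq> 0"
      using eq_0_iff[of "of_int j"] ij(2) by simp
    then have "v (of_int j) > 0"
      using nonneg[of "of_int j"] by linarith
    then have "v (of_rat q) > 1"
      using ij vi vj by (simp add: of_rat_divide abs_divide)
    then show False using q1 by simp
  qed
  then have vj: "v (of_int j) = 1"
    by (rule abs_of_int_unit)
  have "coprime j (int p ^ k)"
    using \<open>\<not> int p dvd j\<close> prime_p
    by (metis coprime_commute coprime_power_right_iff prime_imp_coprime prime_nat_int_transfer)
  then obtain s t where st: "s * j + t * int p ^ k = 1"
    by (metis bezout_int coprime_imp_gcd_eq_1)
  define n where "n = nat (s * i mod int p ^ k)"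
  have pk: "int p ^ k > 0"
    using prime_p by (simp add: prime_gt_0_nat)
  have n: "int n = s * i mod int p ^ k" "n < p ^ k"
    unfolding n_def using pk by (simp_all add: nat_less_iff)
  have "int p ^ k dvd s * i - int n"
    by (simp add: n minus_mod_eq_mult_div)
  then have "int p ^ k dvd j * (s * i - int n) + t * int p ^ k * i"
    by simp
  also have "j * (s * i - int n) + t * int p ^ k * i = (s * j + t * int p ^ k) * i - j * int n"
    by (simp add: algebra_simps)
  finally have "v (of_int (i - j * int n)) \<le> (1 / real p) ^ k"
    using abs_of_int_le_iff[of "i - j * int n" k] by (simp add: st)
  also have "of_int (i - j * int n) = of_int j * (of_rat q - of_nat n :: 'q)"
    using ij(2) by (simp add: ij(1) of_rat_divide right_diff_distrib)
  finally have "v (of_rat q - of_nat n) \<le> (1 / real p) ^ k"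
    by (simp add: mult vj)
  then have "v (x - of_nat n) \<le> (1 / real p) ^ k"
    using ultrametric[of "x - of_rat q" "of_rat q - of_nat n"] q by (auto simp: max_def split: if_splits)
  then show ?thesis using n(2) by blast
qed

end

section \<open>The unramified quadratic extension\<close>

locale odd_unramified_quadratic = unramified_quadratic_extension p v w \<iota> \<sigma>
  for p :: nat and v :: "'q::field_char_0 \<Rightarrow> real" and w :: "'k::field_char_0 \<Rightarrow> real"
    and \<iota> :: "'q \<Rightarrow> 'k" and \<sigma> :: "'k \<Rightarrow> 'k" +
  assumes odd_p: "odd p"
begin

lemma p_gt_1: "real p > 1" and p_gt_0: "p > 0"
  using K.p_gt_1 by auto

lemma \<iota>_divide: "\<iota> (x / y) = \<iota> x / \<iota> y"
  by (simp add: divide_inverse emb.hom_mult emb.hom_inverse)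

lemma \<sigma>_divide: "\<sigma> (x / y) = \<sigma> x / \<sigma> y"
  by (simp add: divide_inverse gal.hom_mult gal.hom_inverse)

lemma abs_2: "w 2 = 1"
proof -
  have "\<not> int p dvd 2"
    using odd_p Qp.prime_p by (metis even_of_nat prime_nat_int_transfer primes_dvd_imp_eq two_is_prime)
  then show ?thesis
    using K.abs_of_int_unit[of 2] by simp
qed

lemma quadratic_basis:
  assumes "x \<notin> range \<iota>"
  shows "\<exists>a b. y = \<iota> a + \<iota> b * x"
proof -
  interpret vs: vector_space "\<lambda>(c::'q) (x::'k). \<iota> c * x"
    by unfold_locales (auto simp: algebra_simps emb.hom_add emb.hom_mult)
  obtain B where B: "UNIV \<subseteq> vs.span B" "card B = 2"
    using vs.basis_exists[of UNIV] degree_2 by metis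
  then have "finite B"
    by (metis card.infinite zero_neq_numeral)
  have "x \<notin> vs.span {1}"
    using assms by (auto simp: vs.span_singleton)
  then have ind: "vs.independent {x, 1}"
    by (intro vs.independent_insertI vs.independent_empty) auto
  have x1: "x \<noteq> 1"
    using assms emb.hom_one by (metis rangeI)
  have "y \<in> vs.span {x, 1}"
  proof (rule ccontr)
    assume y: "y \<notin> vs.span {x, 1}"
    then have "vs.independent {y, x, 1}"
      using ind by (rule vs.independent_insertI)
    then have "card {y, x, 1} \<le> card B"
      using vs.independent_span_bound[OF \<open>finite B\<close>] B(1) by blast
    moreover have "y \<notin> {x, 1}"
      using y vs.span_base by blast
    ultimately show False
      using x1 B(2) by simp
  qed
  then obtain b where "y - \<iota> b * x \<in> vs.span {1}"
    using vs.span_breakdown_eq[of y x "{1}"] by auto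
  then obtain a where "y - \<iota> b * x = \<iota> a"
    by (auto simp: vs.span_singleton)
  then show ?thesis
    by (metis add.commute diff_add_cancel)
qed

text \<open>
  Complete the square in the quadratic equation of an element that \<open>\<sigma>\<close> moves. Since the value groups
  agree, the result can be rescaled to a unit.
\<close>

lemma exists_anti_invariant:
  "\<exists>d. \<sigma> d = - d \<and> d \<notin> range \<iota> \<and> (\<exists>e. d * d = \<iota> e) \<and> w d = 1"
proof -
  obtain x where x: "\<sigma> x \<noteq> x"
    using gal_nontrivial by (metis eq_id_iff)
  then have "x \<notin> range \<iota>"
    using gal_fixes by auto
  then obtain s t where st: "x * x = \<iota> t + \<iota> s * x"
    using quadratic_basis by blast
  define d0 where "d0 = x - \<iota> (s / 2)"
  have x_d0: "x = d0 + \<iota> (s / 2)"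
    by (simp add: d0_def)
  have s2: "\<iota> s = 2 * \<iota> (s / 2)"
  proof -
    have "s = s / 2 + s / 2"
      by (simp flip: add_divide_distrib mult_2)
    then have "\<iota> s = \<iota> (s / 2 + s / 2)"
      by (rule arg_cong)
    then show ?thesis
      by (simp only: emb.hom_add mult_2)
  qed
  have d0_sq: "d0 * d0 = \<iota> (t + (s / 2) * (s / 2))"
  proof -
    define h where "h = \<iota> (s / 2)"
    have "d0 * d0 = x * x - 2 * h * x + h * h"
      unfolding d0_def h_def[symmetric] by (simp add: algebra_simps)
    also have "\<dots> = \<iota> t + h * h"
      unfolding st s2 h_def[symmetric] by simp
    finally show ?thesis
      by (simp only: emb.hom_add emb.hom_mult h_def)
  qed
  have "\<sigma> d0 * \<sigma> d0 = d0 * d0"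
    by (simp only: d0_sq gal_fixes flip: gal.hom_mult)
  moreover have "\<sigma> d0 \<noteq> d0"
    using x unfolding x_d0 by (simp add: gal.hom_add gal_fixes)
  ultimately have \<sigma>d0: "\<sigma> d0 = - d0"
    by (metis square_eq_iff)
  have d0_nz: "d0 \<noteq> 0"
    using \<open>\<sigma> d0 \<noteq> d0\<close> by auto
  obtain c where c: "w d0 = v c"
    using unramified by (metis imageE rangeI)
  have c0: "c \<noteq> 0"
    using c d0_nz K.eq_0_iff by force
  define d where "d = d0 / \<iota> c"
  have ic: "\<iota> c \<noteq> 0"
    using c0 by simp
  have "\<sigma> d = - d"
    by (simp add: d_def \<sigma>_divide \<sigma>d0 gal_fixes)
  moreover have "d \<noteq> 0"
    using d0_nz ic by (simp add: d_def)
  moreover have "w d = 1"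
    using d0_nz ic c extends[of c] K.eq_0_iff[of "\<iota> c"] by (simp add: d_def K.abs_divide)
  moreover have "d * d = \<iota> ((t + (s / 2) * (s / 2)) / (c * c))"
    using d0_sq by (simp add: d_def \<iota>_divide emb.hom_mult)
  moreover have "d \<notin> range \<iota>"
  proof
    assume "d \<in> range \<iota>"
    then have "\<sigma> d = d"
      using gal_fixes by auto
    then have "d + d = 0"
      unfolding \<open>\<sigma> d = - d\<close> by (simp only: neg_eq_iff_add_eq_0)
    then show False
      using \<open>d \<noteq> 0\<close> by (simp flip: mult_2)
  qed
  ultimately show ?thesis by blast
qed

definition \<delta> :: 'k where
  "\<delta> = (SOME d. \<sigma> d = - d \<and> d \<notin> range \<iota> \<and> (\<exists>e. d * d = \<iota> e) \<and> w d = 1)"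

lemma \<delta>: "\<sigma> \<delta> = - \<delta>" "\<delta> \<notin> range \<iota>" "\<exists>e. \<delta> * \<delta> = \<iota> e" "w \<delta> = 1"
  using someI_ex[OF exists_anti_invariant, folded \<delta>_def] by blast+

lemma \<delta>_coords: "\<exists>a b. x = \<iota> a + \<iota> b * \<delta>"
  using quadratic_basis \<delta>(2) by blast

lemma \<sigma>_coords: "\<sigma> (\<iota> a + \<iota> b * \<delta>) = \<iota> a - \<iota> b * \<delta>"
  by (simp add: gal.hom_add gal.hom_mult gal_fixes \<delta>)

lemma \<sigma>_\<sigma> [simp]: "\<sigma> (\<sigma> x) = x"
proof -
  obtain a b where x: "x = \<iota> a + \<iota> b * \<delta>"
    using \<delta>_coords by blast
  show ?thesis
    unfolding x by (simp add: \<sigma>_coords gal.hom_minus gal.hom_mult gal_fixes \<delta>)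
qed

text \<open>
  If \<open>- \<delta>\<close> were congruent to an element of the ground field, Newton's iteration for the square
  root of \<open>\<delta>^2\<close> would converge there, by completeness, to \<open>- \<delta>\<close>.
\<close>

lemma abs_add_\<delta>_ge_1: "w (\<iota> a + \<delta>) \<ge> 1"
proof (rule ccontr)
  assume "\<not> w (\<iota> a + \<delta>) \<ge> 1"
  then have t1: "w (\<iota> a + \<delta>) < 1" by simp
  define t where "t = w (\<iota> a + \<delta>)"
  have t: "0 \<le> t" "t < 1"
    using t1 K.nonneg by (auto simp: t_def)
  obtain e where e: "\<delta> * \<delta> = \<iota> e"
    using \<delta>(3) by blast
  have unit: "v c = 1" if "w (\<iota> c + \<delta>) < 1" for c
    using K.abs_add_eq[of "\<iota> c + \<delta>" "- \<delta>"] that by (simp add: \<delta> extends)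
  have "\<exists>c. w (\<iota> c + \<delta>) \<le> t ^ Suc n" for n
  proof (induction n)
    case 0
    show ?case unfolding t_def by auto
  next
    case (Suc n)
    then obtain c where c: "w (\<iota> c + \<delta>) \<le> t ^ Suc n" by blast
    have "t ^ Suc n \<le> t"
      using t by (simp add: mult_left_le power_le_one)
    then have "w (\<iota> c + \<delta>) < 1"
      using c t by linarith
    then have vc: "v c = 1" by (rule unit)
    have c0: "\<iota> c \<noteq> 0"
      using vc extends K.abs_0 by (metis zero_neq_one)
    \<comment> \<open>a Newton step: it squares the distance to \<open>- \<delta>\<close>\<close>
    have "\<iota> ((c + e / c) / 2) + \<delta> = (\<iota> c + \<delta>) * (\<iota> c + \<delta>) / (2 * \<iota> c)"
    proof -
      define g where "g = \<iota> c"
      have "\<iota> ((c + e / c) / 2) = (g + \<delta> * \<delta> / g) / 2"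
        by (simp only: \<iota>_divide emb.hom_add e emb.hom_numeral g_def)
      then show ?thesis
        using c0 unfolding g_def[symmetric] by (simp add: field_simps)
    qed
    then have "w (\<iota> ((c + e / c) / 2) + \<delta>) = w (\<iota> c + \<delta>) * w (\<iota> c + \<delta>)"
      by (simp add: K.abs_divide K.mult abs_2 extends vc)
    also have "\<dots> \<le> t ^ Suc n * t"
      using c \<open>t ^ Suc n \<le> t\<close> K.nonneg t by (intro mult_mono) auto
    finally show ?case by (intro exI) (simp add: mult.commute)
  qed
  then obtain X where X: "\<And>n. w (\<iota> (X n) + \<delta>) \<le> t ^ Suc n" by metis
  have small: "\<exists>N. \<forall>i\<ge>N. w (\<iota> (X i) + \<delta>) < \<epsilon>" if \<epsilon>: "\<epsilon> > 0" for \<epsilon>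
  proof -
    obtain N where N: "t ^ N < \<epsilon>"
      using real_arch_pow_inv[OF \<epsilon> t(2)] by blast
    have "w (\<iota> (X i) + \<delta>) < \<epsilon>" if "i \<ge> N" for i
    proof -
      have "t ^ Suc i \<le> t ^ N"
        using t that by (intro power_decreasing) auto
      then show ?thesis using X[of i] N by linarith
    qed
    then show ?thesis by blast
  qed
  have "\<exists>N. \<forall>i\<ge>N. \<forall>j\<ge>N. v (X i - X j) < \<epsilon>" if \<epsilon>: "\<epsilon> > 0" for \<epsilon>
  proof -
    obtain N where N: "\<And>i. i \<ge> N \<Longrightarrow> w (\<iota> (X i) + \<delta>) < \<epsilon>"
      using small[OF \<epsilon>] by blast
    have "v (X i - X j) < \<epsilon>" if "i \<ge> N" "j \<ge> N" for i j
    proof -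
      have "v (X i - X j) = w ((\<iota> (X i) + \<delta>) - (\<iota> (X j) + \<delta>))"
        by (simp add: emb.hom_minus flip: extends)
      also have "\<dots> < \<epsilon>"
        using K.abs_diff_le[of "\<iota> (X i) + \<delta>" "\<iota> (X j) + \<delta>"] N[of i] N[of j] that
        by (auto simp: max_def split: if_splits)
      finally show ?thesis .
    qed
    then show ?thesis by blast
  qed
  then obtain L where L: "(\<lambda>i. v (X i - L)) \<longlonglongrightarrow> 0"
    using Qp.complete by blast
  have "w (\<iota> L + \<delta>) < \<epsilon>" if \<epsilon>: "\<epsilon> > 0" for \<epsilon>
  proof -
    obtain N where N: "\<And>i. i \<ge> N \<Longrightarrow> w (\<iota> (X i) + \<delta>) < \<epsilon>"
      using small[OF \<epsilon>] by blast
    obtain M where M: "\<And>i. i \<ge> M \<Longrightarrow> v (X i - L) < \<epsilon>"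
      using LIMSEQ_D[OF L \<epsilon>] Qp.nonneg by auto
    define i where "i = max M N"
    have "\<iota> L + \<delta> = (\<iota> (X i) + \<delta>) - \<iota> (X i - L)"
      by (simp add: emb.hom_minus)
    then have "w (\<iota> L + \<delta>) \<le> max (w (\<iota> (X i) + \<delta>)) (v (X i - L))"
      using K.abs_diff_le[of "\<iota> (X i) + \<delta>" "\<iota> (X i - L)"] by (simp only: extends)
    then show ?thesis
      using N[of i] M[of i] by (simp add: i_def)
  qed
  then have "w (\<iota> L + \<delta>) = 0"
    using K.nonneg by (metis less_irrefl order_le_less)
  then have "\<delta> = \<iota> (- L)"
    by (simp add: K.eq_0_iff emb.hom_uminus eq_neg_iff_add_eq_0 add.commute)
  then show False
    using \<delta>(2) by blast
qed

text \<open>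
  The coordinates with respect to \<open>1\<close> and \<open>\<delta>\<close> make the ring of integers a free module over the
  \<open>p\<close>-adic integers; they serve to count residues and to see that \<open>\<sigma>\<close> preserves \<open>w\<close>.
\<close>

lemma abs_coords: "w (\<iota> a + \<iota> b * \<delta>) = max (v a) (v b)"
proof (rule antisym)
  show "w (\<iota> a + \<iota> b * \<delta>) \<le> max (v a) (v b)"
    using K.ultrametric[of "\<iota> a" "\<iota> b * \<delta>"] by (simp add: K.mult \<delta> extends)
  have b: "v b \<le> w (\<iota> a + \<iota> b * \<delta>)"
  proof (cases "b = 0")
    case False
    then have "\<iota> a + \<iota> b * \<delta> = \<iota> b * (\<iota> (a / b) + \<delta>)"
      by (simp add: \<iota>_divide field_simps)
    then show ?thesis
      using abs_add_\<delta>_ge_1[of "a / b"] Qp.nonneg[of b] by (simp add: K.mult extends mult_left_le mult_le_cancel_left1)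
  qed (simp add: K.nonneg)
  have "\<iota> a = (\<iota> a + \<iota> b * \<delta>) - \<iota> b * \<delta>"
    by simp
  then have "v a \<le> max (w (\<iota> a + \<iota> b * \<delta>)) (v b)"
    using K.abs_diff_le[of "\<iota> a + \<iota> b * \<delta>" "\<iota> b * \<delta>"] by (simp add: K.mult \<delta> extends)
  then show "max (v a) (v b) \<le> w (\<iota> a + \<iota> b * \<delta>)"
    using b by auto
qed

lemma abs_\<sigma> [simp]: "w (\<sigma> x) = w x"
proof -
  obtain a b where x: "x = \<iota> a + \<iota> b * \<delta>"
    using \<delta>_coords by blast
  have "\<sigma> x = \<iota> a + \<iota> (- b) * \<delta>"
    by (simp add: x \<sigma>_coords emb.hom_uminus)
  then show ?thesis
    by (simp only: x abs_coords) simp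
qed

lemma fixed_imp_ground:
  assumes "\<sigma> x = x"
  shows "\<exists>a. x = \<iota> a"
proof -
  obtain a b where x: "x = \<iota> a + \<iota> b * \<delta>"
    using \<delta>_coords by blast
  then have "2 * (\<iota> b * \<delta>) = 0"
    using assms by (simp add: \<sigma>_coords)
  then have "\<iota> b * \<delta> = 0" by simp
  then show ?thesis using x by auto
qed

end

section \<open>Residues modulo powers of \<open>p\<close>\<close>

context odd_unramified_quadratic
begin

text \<open>
  The power \<open>p^k O\<close> of the maximal ideal; \<open>\<pp> 0\<close> is the ring of integers.
\<close>

definition \<pp> :: "nat \<Rightarrow> 'k set" where
  "\<pp> k = {x. w x \<le> (1 / real p) ^ k}"

lemma in_\<pp>_iff: "x \<in> \<pp> k \<longleftrightarrow> w x \<le> (1 / real p) ^ k"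
  by (simp add: \<pp>_def)

lemma \<pp>_0 [simp]: "0 \<in> \<pp> k"
  by (simp add: in_\<pp>_iff)

lemma \<pp>_minus_iff [simp]: "- x \<in> \<pp> k \<longleftrightarrow> x \<in> \<pp> k"
  by (simp add: in_\<pp>_iff)

lemma \<pp>_add: "x \<in> \<pp> k \<Longrightarrow> y \<in> \<pp> k \<Longrightarrow> x + y \<in> \<pp> k"
  using K.ultrametric[of x y] by (auto simp: in_\<pp>_iff max_def split: if_splits)

lemma \<pp>_diff: "x \<in> \<pp> k \<Longrightarrow> y \<in> \<pp> k \<Longrightarrow> x - y \<in> \<pp> k"
  using \<pp>_add[of x k "- y"] by simp

lemma \<pp>_diff_commute: "x - y \<in> \<pp> k \<longleftrightarrow> y - x \<in> \<pp> k"
  by (metis \<pp>_minus_iff minus_diff_eq)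

lemma \<pp>_trans: "x - y \<in> \<pp> k \<Longrightarrow> y - z \<in> \<pp> k \<Longrightarrow> x - z \<in> \<pp> k"
  using \<pp>_add[of "x - y" k "y - z"] by simp

lemma \<pp>_add_left_iff: "y \<in> \<pp> k \<Longrightarrow> y + x \<in> \<pp> k \<longleftrightarrow> x \<in> \<pp> k"
  using \<pp>_add[of y k x] \<pp>_diff[of "y + x" k y] by auto

lemma \<pp>_cong: "x - y \<in> \<pp> k \<Longrightarrow> x \<in> \<pp> k \<longleftrightarrow> y \<in> \<pp> k"
  using \<pp>_add_left_iff[of "x - y" k y] by simp

lemma \<pp>_sum: "(\<And>i. i \<in> A \<Longrightarrow> f i \<in> \<pp> k) \<Longrightarrow> sum f A \<in> \<pp> k"
  by (induction A rule: infinite_finite_induct) (auto intro: \<pp>_add)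

lemma \<pp>_\<sigma>_iff [simp]: "\<sigma> x \<in> \<pp> k \<longleftrightarrow> x \<in> \<pp> k"
  by (simp add: in_\<pp>_iff)

lemma \<pp>_mult: "x \<in> \<pp> i \<Longrightarrow> y \<in> \<pp> j \<Longrightarrow> x * y \<in> \<pp> (i + j)"
  unfolding in_\<pp>_iff K.mult power_add using K.nonneg by (intro mult_mono) auto

lemma \<pp>_mult_left: "x \<in> \<pp> 0 \<Longrightarrow> y \<in> \<pp> k \<Longrightarrow> x * y \<in> \<pp> k"
  using \<pp>_mult[of x 0 y k] by simp

lemma \<pp>_mult_right: "x \<in> \<pp> k \<Longrightarrow> y \<in> \<pp> 0 \<Longrightarrow> x * y \<in> \<pp> k"
  using \<pp>_mult[of x k y 0] by simp

lemma \<pp>_mono: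
  assumes "i \<le> j" "x \<in> \<pp> j"
  shows "x \<in> \<pp> i"
proof -
  have "(1 / real p) ^ j \<le> (1 / real p) ^ i"
    using assms(1) p_gt_1 by (intro power_decreasing) auto
  then show ?thesis
    using assms(2) unfolding in_\<pp>_iff by linarith
qed

lemma \<pp>_integral: "x \<in> \<pp> k \<Longrightarrow> x \<in> \<pp> 0"
  by (rule \<pp>_mono) auto

lemma \<pp>_of_int_iff: "of_int z \<in> \<pp> k \<longleftrightarrow> int p ^ k dvd z"
  by (simp add: in_\<pp>_iff K.abs_of_int_le_iff)

lemma \<pp>_of_nat_iff: "of_nat n \<in> \<pp> k \<longleftrightarrow> p ^ k dvd n"
  using \<pp>_of_int_iff[of "int n" k] by (simp flip: of_nat_power)

lemma of_nat_integral [simp]: "of_nat n \<in> \<pp> 0"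
  by (simp add: \<pp>_of_nat_iff)

lemma one_integral [simp]: "1 \<in> \<pp> 0"
  using of_nat_integral[of 1] by simp

lemma p_power_\<pp>: "of_nat p ^ k \<in> \<pp> k"
  by (simp add: \<pp>_of_nat_iff flip: of_nat_power)

lemma p_power_integral [simp]: "of_nat p ^ k \<in> \<pp> 0"
  by (simp flip: of_nat_power)

lemma \<pp>_unit_mult_iff: "w u = 1 \<Longrightarrow> u * x \<in> \<pp> k \<longleftrightarrow> x \<in> \<pp> k"
  by (simp add: in_\<pp>_iff K.mult)

lemma unit_integral: "w u = 1 \<Longrightarrow> u \<in> \<pp> 0"
  by (simp add: in_\<pp>_iff)

lemma \<pp>_scale_iff: "of_nat p ^ i * x \<in> \<pp> (i + k) \<longleftrightarrow> x \<in> \<pp> k"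
  using p_gt_1 by (simp add: in_\<pp>_iff K.mult K.abs_p_power power_add)

lemma \<pp>_scale_iff': "i \<le> k \<Longrightarrow> of_nat p ^ i * x \<in> \<pp> k \<longleftrightarrow> x \<in> \<pp> (k - i)"
  using \<pp>_scale_iff[of i x "k - i"] by simp

lemma \<pp>_scaleE:
  assumes "x \<in> \<pp> (i + k)"
  obtains y where "y \<in> \<pp> k" "x = of_nat p ^ i * y"
proof
  have "of_nat p ^ i \<noteq> (0 :: 'k)"
    using p_gt_0 by simp
  then show "x = of_nat p ^ i * (x / of_nat p ^ i)" by simp
  then show "x / of_nat p ^ i \<in> \<pp> k"
    using assms \<pp>_scale_iff by metis
qed

lemma abs_eq_1_iff: "w x = 1 \<longleftrightarrow> x \<in> \<pp> 0 \<and> x \<notin> \<pp> 1"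
proof
  assume "w x = 1"
  then show "x \<in> \<pp> 0 \<and> x \<notin> \<pp> 1"
    using p_gt_1 by (simp add: in_\<pp>_iff)
next
  assume x: "x \<in> \<pp> 0 \<and> x \<notin> \<pp> 1"
  then have wx: "w x \<le> 1" "w x > 1 / real p"
    by (auto simp: in_\<pp>_iff)
  obtain c where c: "w x = v c"
    using unramified by (metis imageE rangeI)
  have "c \<noteq> 0"
    using wx c p_gt_1 by auto
  then obtain z where z: "w x = real p powi z"
    using Qp.abs_eq_powi c by metis
  have "z \<le> 0"
    using wx(1) z p_gt_1 by (metis linorder_not_le one_less_power_int zero_less_iff_neq_zero not_less)
  moreover have "z > - 1"
  proof -
    have "real p powi (- 1) < real p powi z"
      using wx(2) z by (simp add: power_int_minus inverse_eq_divide)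
    then show ?thesis
      using p_gt_1 by (metis power_int_increasing linorder_not_le less_eq_real_def)
  qed
  ultimately have "z = 0" by simp
  then show "w x = 1" using z by simp
qed

lemma unit_cong: "x - y \<in> \<pp> 1 \<Longrightarrow> w y = 1 \<Longrightarrow> w x = 1"
  using \<pp>_cong[of x y 1] \<pp>_cong[of x y 0] \<pp>_integral[of "x - y" 1] by (simp add: abs_eq_1_iff)

lemma exists_\<pp>_bound:
  assumes "x \<noteq> 0"
  shows "\<exists>k. x \<notin> \<pp> k"
proof -
  have "w x > 0"
    using assms K.nonneg[of x] K.eq_0_iff[of x] by linarith
  then show ?thesis
    using real_arch_pow_inv[of "w x" "1 / real p"] p_gt_1 by (auto simp: in_\<pp>_iff not_le)
qed

lemma unit_decomposition:
  assumes "x \<in> \<pp> 0" "x \<noteq> 0"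
  obtains j u where "x = of_nat p ^ j * u" "w u = 1"
proof -
  define j where "j = (LEAST k. x \<notin> \<pp> k) - 1"
  have j0: "x \<notin> \<pp> (LEAST k. x \<notin> \<pp> k)"
    using exists_\<pp>_bound[OF assms(2)] by (rule LeastI_ex)
  then have "(LEAST k. x \<notin> \<pp> k) \<noteq> 0"
    using assms(1) by metis
  then have j: "(LEAST k. x \<notin> \<pp> k) = Suc j"
    by (simp add: j_def)
  then have "x \<in> \<pp> j"
    using not_less_Least[of j "\<lambda>k. x \<notin> \<pp> k"] by auto
  then obtain u where u: "u \<in> \<pp> 0" "x = of_nat p ^ j * u"
    using \<pp>_scaleE[of x j 0] by auto
  have "u \<notin> \<pp> 1"
    using j0 j u \<pp>_scale_iff[of j u 1] by simp
  then show thesis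
    using that u abs_eq_1_iff by blast
qed

definition fixed_integer :: "'k \<Rightarrow> bool" where
  "fixed_integer x \<longleftrightarrow> x \<in> \<pp> 0 \<and> \<sigma> x = x"

lemma fixed_integer_of_nat [simp]: "fixed_integer (of_nat n)"
  by (simp add: fixed_integer_def gal.hom_of_nat)

lemma fixed_integer_p_power [simp]: "fixed_integer (of_nat p ^ n)"
  by (simp flip: of_nat_power)

lemma fixed_integer_1 [simp]: "fixed_integer 1"
  using fixed_integer_of_nat[of 1] by simp

lemma fixed_integer_minus: "fixed_integer x \<Longrightarrow> fixed_integer (- x)"
  by (simp add: fixed_integer_def gal.hom_uminus)

lemma fixed_integer_diff: "fixed_integer x \<Longrightarrow> fixed_integer y \<Longrightarrow> fixed_integer (x - y)"
  by (simp add: fixed_integer_def gal.hom_minus \<pp>_diff)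

lemma fixed_integer_norm: "x \<in> \<pp> 0 \<Longrightarrow> fixed_integer (x * \<sigma> x)"
  by (simp add: fixed_integer_def gal.hom_mult \<pp>_mult_left mult.commute)

lemma fixed_integer_approx:
  assumes "fixed_integer x"
  shows "\<exists>n < p ^ k. x - of_nat n \<in> \<pp> k"
proof -
  obtain a where a: "x = \<iota> a"
    using assms fixed_imp_ground by (auto simp: fixed_integer_def)
  then have "v a \<le> 1"
    using assms by (simp add: fixed_integer_def in_\<pp>_iff extends)
  then obtain n where n: "n < p ^ k" "v (a - of_nat n) \<le> (1 / real p) ^ k"
    using Qp.exists_nat_approx by blast
  have "x - of_nat n = \<iota> (a - of_nat n)"
    by (simp add: a emb.hom_minus emb.hom_of_nat)
  then show ?thesis
    using n by (auto simp: in_\<pp>_iff extends)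
qed

lemma coords_\<pp>_iff:
  "of_int m + of_int n * \<delta> \<in> \<pp> k \<longleftrightarrow> int p ^ k dvd m \<and> int p ^ k dvd n"
  using abs_coords[of "of_int m" "of_int n"]
  by (simp add: in_\<pp>_iff emb.hom_of_int Qp.abs_of_int_le_iff)

lemma integral_approx:
  assumes "x \<in> \<pp> 0"
  shows "\<exists>m < p ^ k. \<exists>n < p ^ k. x - (of_nat m + of_nat n * \<delta>) \<in> \<pp> k"
proof -
  obtain a b where ab: "x = \<iota> a + \<iota> b * \<delta>"
    using \<delta>_coords by blast
  have "v a \<le> 1" "v b \<le> 1"
    using assms abs_coords[of a b] by (simp_all add: ab in_\<pp>_iff)
  then obtain m n where mn: "m < p ^ k" "v (a - of_nat m) \<le> (1 / real p) ^ k"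
    "n < p ^ k" "v (b - of_nat n) \<le> (1 / real p) ^ k"
    using Qp.exists_nat_approx by metis
  have "x - (of_nat m + of_nat n * \<delta>) = \<iota> (a - of_nat m) + \<iota> (b - of_nat n) * \<delta>"
    by (simp add: ab emb.hom_minus emb.hom_of_nat algebra_simps)
  then have "x - (of_nat m + of_nat n * \<delta>) \<in> \<pp> k"
    using mn abs_coords[of "a - of_nat m" "b - of_nat n"] by (simp add: in_\<pp>_iff)
  then show ?thesis using mn by blast
qed

text \<open>
  A choice of representatives modulo \<open>p^k\<close>. The class of \<open>0\<close> is represented by \<open>0\<close>, so that reducing
  a vector entry by entry preserves its vanishing coordinates.
\<close>

definition red :: "nat \<Rightarrow> 'k \<Rightarrow> 'k" where
  "red k x = (if x \<in> \<pp> k then 0 else (SOME y. y - x \<in> \<pp> k))"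

definition reps :: "nat \<Rightarrow> 'k set" where
  "reps k = red k ` \<pp> 0"

lemma red_cong: "red k x - x \<in> \<pp> k"
proof -
  have "\<exists>y. y - x \<in> \<pp> k" by (rule exI[of _ x]) simp
  then show ?thesis
    unfolding red_def using someI_ex[of "\<lambda>y. y - x \<in> \<pp> k"] by auto
qed

lemma red_eq_iff: "red k x = red k y \<longleftrightarrow> x - y \<in> \<pp> k"
proof
  assume "red k x = red k y"
  then show "x - y \<in> \<pp> k"
    using red_cong[of k x] red_cong[of k y] \<pp>_trans \<pp>_diff_commute by metis
next
  assume xy: "x - y \<in> \<pp> k"
  have "z - x \<in> \<pp> k \<longleftrightarrow> z - y \<in> \<pp> k" for z
    using xy \<pp>_trans \<pp>_diff_commute by metis
  then show "red k x = red k y"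
    unfolding red_def using \<pp>_cong[OF xy] by simp
qed

lemma red_0 [simp]: "red k 0 = 0"
  by (simp add: red_def)

lemma red_in_reps [simp]: "x \<in> \<pp> 0 \<Longrightarrow> red k x \<in> reps k"
  by (simp add: reps_def)

lemma reps_integral: "x \<in> reps k \<Longrightarrow> x \<in> \<pp> 0"
  unfolding reps_def using red_cong \<pp>_integral \<pp>_cong by (metis imageE)

lemma red_reps: "x \<in> reps k \<Longrightarrow> red k x = x"
  unfolding reps_def using red_cong red_eq_iff by (metis imageE)

lemma reps_eqI: "x \<in> reps k \<Longrightarrow> y \<in> reps k \<Longrightarrow> x - y \<in> \<pp> k \<Longrightarrow> x = y"
  using red_reps red_eq_iff by metis

lemma reps_0 [simp]: "0 \<in> reps k"
  using red_in_reps[of 0 k] by simp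

lemma bij_betw_reps:
  "bij_betw (\<lambda>(m, n). red k (of_nat m + of_nat n * \<delta>)) ({..<p ^ k} \<times> {..<p ^ k}) (reps k)"
proof (rule bij_betw_imageI)
  have dvd0: "m = m'" if "m < p ^ k" "m' < p ^ k" "int p ^ k dvd int m - int m'" for m m'
  proof -
    have "\<bar>int m - int m'\<bar> < int p ^ k"
      using that(1,2) by (auto simp: abs_if simp flip: of_nat_power)
    then show ?thesis
      using that(3) zdvd_not_zless[of "\<bar>int m - int m'\<bar>" "int p ^ k"] by force
  qed
  show "inj_on (\<lambda>(m, n). red k (of_nat m + of_nat n * \<delta>)) ({..<p ^ k} \<times> {..<p ^ k})"
  proof (rule inj_onI, clarsimp simp: red_eq_iff)
    fix m n m' n'
    assume *: "m < p ^ k" "n < p ^ k" "m' < p ^ k" "n' < p ^ k"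
      and d: "of_nat m + of_nat n * \<delta> - (of_nat m' + of_nat n' * \<delta>) \<in> \<pp> k"
    have "of_nat m + of_nat n * \<delta> - (of_nat m' + of_nat n' * \<delta>) =
      of_int (int m - int m') + of_int (int n - int n') * \<delta>"
      by (simp add: algebra_simps)
    then have "int p ^ k dvd int m - int m' \<and> int p ^ k dvd int n - int n'"
      using d coords_\<pp>_iff by metis
    then show "m = m' \<and> n = n'"
      using * dvd0 by blast
  qed
  have *: "of_nat m + of_nat n * \<delta> \<in> \<pp> 0" for m n
    using coords_\<pp>_iff[of "int m" "int n" 0] by simp
  show "(\<lambda>(m, n). red k (of_nat m + of_nat n * \<delta>)) ` ({..<p ^ k} \<times> {..<p ^ k}) = reps k"
  proof (intro equalityI subsetI)
    fix y assume "y \<in> reps k"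
    then obtain x where x: "x \<in> \<pp> 0" "y = red k x"
      by (auto simp: reps_def)
    obtain m n where "m < p ^ k" "n < p ^ k" "x - (of_nat m + of_nat n * \<delta>) \<in> \<pp> k"
      using integral_approx[OF x(1)] by blast
    then show "y \<in> (\<lambda>(m, n). red k (of_nat m + of_nat n * \<delta>)) ` ({..<p ^ k} \<times> {..<p ^ k})"
      using x by (intro image_eqI[of _ _ "(m, n)"]) (auto simp: red_eq_iff)
  qed (use * in auto)
qed

lemma finite_reps [simp]: "finite (reps k)"
  using bij_betw_finite[OF bij_betw_reps] by simp

lemma card_reps: "card (reps k) = (p ^ 2) ^ k"
  using bij_betw_same_card[OF bij_betw_reps[of k]]
  by (simp add: card_cartesian_product power2_eq_square power_mult_distrib)

end

section \<open>Averages over residues\<close>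

definition mean :: "'b set \<Rightarrow> ('b \<Rightarrow> real) \<Rightarrow> real" where
  "mean A f = sum f A / real (card A)"

lemma mean_cong: "(\<And>x. x \<in> A \<Longrightarrow> f x = g x) \<Longrightarrow> mean A f = mean A g"
  by (simp add: mean_def cong: sum.cong)

lemma mean_const: "finite A \<Longrightarrow> A \<noteq> {} \<Longrightarrow> mean A (\<lambda>_. c) = c"
  by (simp add: mean_def)

lemma mean_0 [simp]: "mean A (\<lambda>_. 0) = 0"
  by (simp add: mean_def)

lemma mean_cmult: "mean A (\<lambda>x. c * f x) = c * mean A f"
  by (simp add: mean_def sum_distrib_left)

lemma mean_diff: "mean A (\<lambda>x. f x - g x) = mean A f - mean A g"
  by (simp add: mean_def sum_subtractf diff_divide_distrib)

lemma mean_sum: "mean A (\<lambda>x. \<Sum>i\<in>I. f i x) = (\<Sum>i\<in>I. mean A (f i))"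
  unfolding mean_def by (subst sum.swap) (simp add: sum_divide_distrib)

lemma mean_bij:
  assumes "bij_betw \<phi> A B"
  shows "mean A (\<lambda>x. f (\<phi> x)) = mean B f"
  using sum.reindex_bij_betw[OF assms, of f] bij_betw_same_card[OF assms] by (simp add: mean_def)

lemma mean_Times: "mean (A \<times> B) (\<lambda>(a, b). f a b) = mean A (\<lambda>a. mean B (f a))"
  by (simp add: mean_def sum.cartesian_product[symmetric] card_cartesian_product sum_divide_distrib
      mult.commute)

context odd_unramified_quadratic
begin

text \<open>
  Vectors of length \<open>m\<close> are functions vanishing from \<open>m\<close> on, so that vectors of different lengths
  share one type: \<open>ivecs m\<close> holds the integral ones and \<open>vecs k m\<close> their representatives modulo \<open>p^k\<close>.
\<close>

definition vecs :: "nat \<Rightarrow> nat \<Rightarrow> (nat \<Rightarrow> 'k) set" where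
  "vecs k m = {x. (\<forall>i<m. x i \<in> reps k) \<and> (\<forall>i\<ge>m. x i = 0)}"

definition ivecs :: "nat \<Rightarrow> (nat \<Rightarrow> 'k) set" where
  "ivecs m = {x. (\<forall>i<m. x i \<in> \<pp> 0) \<and> (\<forall>i\<ge>m. x i = 0)}"

definition vcong :: "nat \<Rightarrow> (nat \<Rightarrow> 'k) \<Rightarrow> (nat \<Rightarrow> 'k) \<Rightarrow> bool" where
  "vcong k x y \<longleftrightarrow> (\<forall>i. x i - y i \<in> \<pp> k)"

definition periodic :: "nat \<Rightarrow> nat \<Rightarrow> ((nat \<Rightarrow> 'k) \<Rightarrow> real) \<Rightarrow> bool" where
  "periodic k m f \<longleftrightarrow> (\<forall>x \<in> ivecs m. \<forall>y \<in> ivecs m. vcong k x y \<longrightarrow> f x = f y)"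

lemma periodicI:
  "(\<And>x y. x \<in> ivecs m \<Longrightarrow> y \<in> ivecs m \<Longrightarrow> vcong k x y \<Longrightarrow> f x = f y) \<Longrightarrow> periodic k m f"
  by (simp add: periodic_def)

lemma periodicD:
  "periodic k m f \<Longrightarrow> x \<in> ivecs m \<Longrightarrow> y \<in> ivecs m \<Longrightarrow> vcong k x y \<Longrightarrow> f x = f y"
  by (simp add: periodic_def)

lemma vcong_refl [simp]: "vcong k x x"
  by (simp add: vcong_def)

lemma ivecs_integral: "x \<in> ivecs m \<Longrightarrow> x i \<in> \<pp> 0"
  unfolding ivecs_def by (cases "i < m") auto

lemma ivecs_zero: "x \<in> ivecs m \<Longrightarrow> m \<le> i \<Longrightarrow> x i = 0"
  by (simp add: ivecs_def)

lemma vecs_ivecs: "x \<in> vecs k m \<Longrightarrow> x \<in> ivecs m"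
  by (auto simp: vecs_def ivecs_def reps_integral)

lemma ivecs_upd: "x \<in> ivecs m \<Longrightarrow> c \<in> \<pp> 0 \<Longrightarrow> x(m := c) \<in> ivecs (Suc m)"
  by (auto simp: ivecs_def less_Suc_eq)

lemma vcong_upd: "vcong k x y \<Longrightarrow> c - d \<in> \<pp> k \<Longrightarrow> vcong k (x(m := c)) (y(m := d))"
  by (auto simp: vcong_def)

lemma vecs_0: "vecs k 0 = {\<lambda>_. 0}"
  by (auto simp: vecs_def)

lemma bij_betw_vecs_Suc:
  "bij_betw (\<lambda>(c, x). x(m := c)) (reps k \<times> vecs k m) (vecs k (Suc m))"
proof (rule bij_betwI[where g = "\<lambda>x. (x m, x(m := 0))"])
  show "(\<lambda>(c, x). x(m := c)) \<in> reps k \<times> vecs k m \<rightarrow> vecs k (Suc m)"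
    by (auto simp: vecs_def less_Suc_eq)
  show "(\<lambda>x. (x m, x(m := 0))) \<in> vecs k (Suc m) \<rightarrow> reps k \<times> vecs k m"
    by (auto simp: vecs_def)
qed (auto simp: vecs_def fun_eq_iff)

lemma finite_vecs [simp]: "finite (vecs k m)"
proof (induction m)
  case (Suc m)
  then show ?case
    using bij_betw_finite[OF bij_betw_vecs_Suc[where k = k and m = m]] by simp
qed (simp add: vecs_0)

lemma card_vecs: "card (vecs k m) = (p ^ 2) ^ (k * m)"
proof (induction m)
  case (Suc m)
  then show ?case
    using bij_betw_same_card[OF bij_betw_vecs_Suc[where k = k and m = m]]
    by (simp add: card_cartesian_product card_reps power_add)
qed (simp add: vecs_0)

lemma vecs_nonempty [simp]: "vecs k m \<noteq> {}"
  using card_vecs[of k m] p_gt_0 by (metis card.empty power_not_zero less_irrefl)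

lemma reps_nonempty [simp]: "reps k \<noteq> {}"
  using reps_0 by blast

lemma mean_vecs_Suc: "mean (vecs k (Suc m)) f = mean (reps k) (\<lambda>c. mean (vecs k m) (\<lambda>x. f (x(m := c))))"
proof -
  have "mean (vecs k (Suc m)) f = mean (reps k \<times> vecs k m) (\<lambda>y. f (case y of (c, x) \<Rightarrow> x(m := c)))"
    by (rule mean_bij[OF bij_betw_vecs_Suc, symmetric])
  also have "\<dots> = mean (reps k \<times> vecs k m) (\<lambda>(c, x). f (x(m := c)))"
    by (intro mean_cong) auto
  also have "\<dots> = mean (reps k) (\<lambda>c. mean (vecs k m) (\<lambda>x. f (x(m := c))))"
    by (rule mean_Times)
  finally show ?thesis .
qed

text \<open>
  A map that is injective modulo \<open>p^k\<close> permutes the finitely many residues, even if it is not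
  invertible on the integers themselves.
\<close>

lemma mean_reps_change:
  assumes \<phi>: "\<And>x. x \<in> \<pp> 0 \<Longrightarrow> \<phi> x \<in> \<pp> 0"
    and inj: "\<And>x y. x \<in> \<pp> 0 \<Longrightarrow> y \<in> \<pp> 0 \<Longrightarrow> \<phi> x - \<phi> y \<in> \<pp> k \<Longrightarrow> x - y \<in> \<pp> k"
    and g: "\<And>x y. x \<in> \<pp> 0 \<Longrightarrow> y \<in> \<pp> 0 \<Longrightarrow> x - y \<in> \<pp> k \<Longrightarrow> g x = g y"
  shows "mean (reps k) (\<lambda>x. g (\<phi> x)) = mean (reps k) g"
proof -
  have "bij_betw (\<lambda>x. red k (\<phi> x)) (reps k) (reps k)"
  proof -
    have *: "inj_on (\<lambda>x. red k (\<phi> x)) (reps k)"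
      using inj by (intro inj_onI reps_eqI) (auto simp: red_eq_iff reps_integral)
    moreover have "(\<lambda>x. red k (\<phi> x)) ` reps k \<subseteq> reps k"
      by (auto simp: \<phi> reps_integral)
    ultimately show ?thesis
      by (simp add: bij_betw_def endo_inj_surj)
  qed
  then have *: "mean (reps k) (\<lambda>x. g (red k (\<phi> x))) = mean (reps k) g"
    by (rule mean_bij)
  have "g (red k (\<phi> x)) = g (\<phi> x)" if "x \<in> reps k" for x
    using \<phi>[OF reps_integral[OF that]] red_cong by (intro g reps_integral[OF red_in_reps])
  then show ?thesis
    unfolding *[symmetric] by (intro mean_cong) simp
qed

lemma mean_vecs_change:
  assumes \<phi>: "\<And>x. x \<in> ivecs m \<Longrightarrow> \<phi> x \<in> ivecs m"
    and inj: "\<And>x y. x \<in> ivecs m \<Longrightarrow> y \<in> ivecs m \<Longrightarrow> vcong k (\<phi> x) (\<phi> y) \<Longrightarrow> vcong k x y"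
    and f: "periodic k m f"
  shows "mean (vecs k m) (\<lambda>x. f (\<phi> x)) = mean (vecs k m) f"
proof -
  let ?red = "\<lambda>x i. red k (x i)"
  have red: "?red x \<in> vecs k m" if "x \<in> ivecs m" for x
    using that by (simp add: vecs_def ivecs_def)
  have "bij_betw (\<lambda>x. ?red (\<phi> x)) (vecs k m) (vecs k m)"
  proof -
    have *: "inj_on (\<lambda>x. ?red (\<phi> x)) (vecs k m)"
    proof (intro inj_onI ext)
      fix x y i assume xy: "x \<in> vecs k m" "y \<in> vecs k m" "?red (\<phi> x) = ?red (\<phi> y)"
      have "vcong k (\<phi> x) (\<phi> y)"
        using xy(3) by (auto simp: vcong_def fun_eq_iff red_eq_iff)
      then have "vcong k x y"
        using inj vecs_ivecs xy by blast
      then show "x i = y i"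
        using xy reps_eqI[of "x i" k "y i"] by (cases "i < m") (auto simp: vcong_def vecs_def)
    qed
    moreover have "(\<lambda>x. ?red (\<phi> x)) ` vecs k m \<subseteq> vecs k m"
      using red \<phi> vecs_ivecs by blast
    ultimately show ?thesis
      by (simp add: bij_betw_def endo_inj_surj)
  qed
  then have *: "mean (vecs k m) (\<lambda>x. f (?red (\<phi> x))) = mean (vecs k m) f"
    by (rule mean_bij)
  have "f (?red (\<phi> x)) = f (\<phi> x)" if "x \<in> vecs k m" for x
    using \<phi>[OF vecs_ivecs[OF that]]
    by (intro periodicD[OF f] vecs_ivecs[OF red]) (auto simp: vcong_def red_cong)
  then show ?thesis
    unfolding *[symmetric] by (intro mean_cong) simp
qed

text \<open>
  The map \<open>c \<mapsto> p^j c\<close> sends the residues modulo \<open>p^k\<close> onto those divisible by \<open>p^j\<close>, with fibres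
  of equal size: the fibre of \<open>p^j y\<close> consists of the \<open>y + p^(k - j) t\<close> for \<open>t\<close> modulo \<open>p^j\<close>.
\<close>

lemma mean_reps_scale:
  assumes "j \<le> k"
    and g: "\<And>x y. x \<in> \<pp> 0 \<Longrightarrow> y \<in> \<pp> 0 \<Longrightarrow> x - y \<in> \<pp> k \<Longrightarrow> g x = g y"
  shows "mean (reps k) (\<lambda>c. of_bool (c \<in> \<pp> j) * g c)
    = mean (reps k) (\<lambda>c. g (of_nat p ^ j * c)) / (real p ^ 2) ^ j"
proof -
  define B where "B = {y \<in> reps k. y \<in> \<pp> j}"
  let ?h = "\<lambda>c. red k (of_nat p ^ j * c)"
  have int: "of_nat p ^ j * c \<in> \<pp> 0" if "c \<in> \<pp> 0" for c
    using that by (simp add: \<pp>_mult_left)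
  have hB: "?h c \<in> B" if "c \<in> reps k" for c
  proof -
    have "of_nat p ^ j * c \<in> \<pp> j"
      using that reps_integral \<pp>_mult[of "of_nat p ^ j" j c 0] p_power_\<pp> by simp
    moreover have "?h c - of_nat p ^ j * c \<in> \<pp> j"
      using red_cong \<pp>_mono assms(1) by blast
    ultimately have "?h c \<in> \<pp> j"
      using \<pp>_cong by blast
    then show ?thesis
      using that by (simp add: B_def int reps_integral)
  qed
  have card: "card {c \<in> reps k. ?h c = y} = (p ^ 2) ^ j" if "y \<in> B" for y
  proof -
    obtain y0 where y0: "y0 \<in> \<pp> 0" "y = of_nat p ^ j * y0"
      using \<pp>_scaleE[of y j 0] \<open>y \<in> B\<close> by (metis (no_types, lifting) B_def add_0_right mem_Collect_eq)
    have fib: "?h c = y \<longleftrightarrow> c - y0 \<in> \<pp> (k - j)" for c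
    proof -
      have "?h c = y \<longleftrightarrow> ?h c = red k y"
        using that by (simp add: B_def red_reps)
      also have "\<dots> \<longleftrightarrow> of_nat p ^ j * (c - y0) \<in> \<pp> k"
        by (simp add: red_eq_iff y0 algebra_simps)
      finally show ?thesis
        using \<pp>_scale_iff'[OF assms(1)] by blast
    qed
    let ?\<psi> = "\<lambda>t. red k (y0 + of_nat p ^ (k - j) * t)"
    have int': "y0 + of_nat p ^ (k - j) * t \<in> \<pp> 0" if "t \<in> \<pp> 0" for t
      using that y0(1) by (simp add: \<pp>_mult_left \<pp>_add)
    have "bij_betw ?\<psi> (reps j) {c \<in> reps k. ?h c = y}"
    proof (rule bij_betw_imageI)
      show "inj_on ?\<psi> (reps j)"
      proof (rule inj_onI)
        fix s t assume st: "s \<in> reps j" "t \<in> reps j" "?\<psi> s = ?\<psi> t"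
        then have "of_nat p ^ (k - j) * (s - t) \<in> \<pp> k"
          by (simp add: red_eq_iff algebra_simps)
        then have "s - t \<in> \<pp> j"
          using \<pp>_scale_iff'[of "k - j" k] assms(1) by simp
        then show "s = t"
          using st reps_eqI by blast
      qed
      show "?\<psi> ` reps j = {c \<in> reps k. ?h c = y}"
      proof (intro equalityI subsetI)
        fix c assume "c \<in> ?\<psi> ` reps j"
        then obtain t where t: "t \<in> reps j" "c = ?\<psi> t" by blast
        have "?\<psi> t - (y0 + of_nat p ^ (k - j) * t) \<in> \<pp> (k - j)"
          using red_cong[of k "y0 + of_nat p ^ (k - j) * t"] by (rule \<pp>_mono[rotated]) simp
        moreover have "(y0 + of_nat p ^ (k - j) * t) - y0 \<in> \<pp> (k - j)"
          using \<pp>_mult_right[OF p_power_\<pp>, of t "k - j"] t(1) by (simp add: reps_integral)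
        ultimately have "c - y0 \<in> \<pp> (k - j)"
          unfolding t by (rule \<pp>_trans)
        then show "c \<in> {c \<in> reps k. ?h c = y}"
          using t int' by (simp add: fib reps_integral)
      next
        fix c assume "c \<in> {c \<in> reps k. ?h c = y}"
        then have c: "c \<in> reps k" "c - y0 \<in> \<pp> (k - j)"
          using fib by auto
        then obtain t where t: "t \<in> \<pp> 0" "c - y0 = of_nat p ^ (k - j) * t"
          using \<pp>_scaleE[of "c - y0" "k - j" 0] by auto
        have "of_nat p ^ (k - j) * (t - red j t) \<in> \<pp> k"
          using \<pp>_scale_iff'[of "k - j" k] assms(1) red_cong[of j t] \<pp>_diff_commute by simp
        then have "c - (y0 + of_nat p ^ (k - j) * red j t) \<in> \<pp> k"
          using t(2) by (simp add: algebra_simps)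
        then have "c = ?\<psi> (red j t)"
          using red_reps[OF c(1)] red_eq_iff by metis
        then show "c \<in> ?\<psi> ` reps j"
          using t(1) by (intro image_eqI[of _ _ "red j t"]) auto
      qed
    qed
    then have "card (reps j) = card {c \<in> reps k. ?h c = y}"
      by (rule bij_betw_same_card)
    then show ?thesis
      by (simp add: card_reps)
  qed
  have "(\<Sum>c\<in>reps k. g (of_nat p ^ j * c)) = (\<Sum>c\<in>reps k. g (?h c))"
  proof (rule sum.cong[OF refl])
    fix c assume "c \<in> reps k"
    then have c: "of_nat p ^ j * c \<in> \<pp> 0"
      by (intro int reps_integral)
    have "?h c - of_nat p ^ j * c \<in> \<pp> k"
      by (rule red_cong)
    then show "g (of_nat p ^ j * c) = g (?h c)"
      using g[OF reps_integral[OF red_in_reps[OF c]] c] by simp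
  qed
  also have "\<dots> = (\<Sum>y\<in>B. \<Sum>c\<in>{c \<in> reps k. ?h c = y}. g (?h c))"
    using hB by (intro sum.group[symmetric]) (simp_all add: B_def image_subset_iff)
  also have "\<dots> = (\<Sum>y\<in>B. (real p ^ 2) ^ j * g y)"
    by (intro sum.cong refl) (simp add: card)
  also have "\<dots> = (real p ^ 2) ^ j * (\<Sum>c\<in>reps k. of_bool (c \<in> \<pp> j) * g c)"
    unfolding B_def by (simp add: sum_distrib_left[symmetric] sum.If_cases of_bool_def if_distrib
      if_distribR Collect_conj_eq cong: if_cong)
  finally show ?thesis
    using p_gt_0 by (simp add: mean_def)
qed

lemma mean_vecs_scale:
  assumes "j \<le> k" "periodic k m f"
  shows "mean (vecs k m) (\<lambda>x. of_bool (\<forall>i. x i \<in> \<pp> j) * f x)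
    = mean (vecs k m) (\<lambda>x. f (\<lambda>i. of_nat p ^ j * x i)) / (real p ^ 2) ^ (j * m)"
  using assms(2)
proof (induction m arbitrary: f)
  case 0
  then show ?case
    by (simp add: vecs_0 mean_def)
next
  case (Suc m)
  let ?s = "\<lambda>x i. of_nat p ^ j * x i :: 'k"
  have int: "?s x \<in> ivecs m" if "x \<in> ivecs m" for x m
    using that by (auto simp: ivecs_def \<pp>_mult_left)
  have upd: "(\<forall>i. (x(m := c)) i \<in> \<pp> j) \<longleftrightarrow> c \<in> \<pp> j \<and> (\<forall>i. x i \<in> \<pp> j)" if "x \<in> vecs k m" for x c
    using that by (auto simp: vecs_def)
  have per: "periodic k m (\<lambda>x. f (x(m := c)))" if "c \<in> \<pp> 0" for c
    using that by (intro periodicI periodicD[OF Suc.prems] ivecs_upd vcong_upd) auto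
  have "mean (vecs k (Suc m)) (\<lambda>x. of_bool (\<forall>i. x i \<in> \<pp> j) * f x) =
      mean (reps k) (\<lambda>c. of_bool (c \<in> \<pp> j) * mean (vecs k m) (\<lambda>x. of_bool (\<forall>i. x i \<in> \<pp> j) * f (x(m := c))))"
    unfolding mean_vecs_Suc
    by (rule mean_cong, subst mean_cmult[symmetric], rule mean_cong)
      (simp only: upd of_bool_conj mult.assoc)
  also have "\<dots> = mean (reps k) (\<lambda>c. of_bool (c \<in> \<pp> j) *
      (mean (vecs k m) (\<lambda>x. f ((?s x)(m := c))) / (real p ^ 2) ^ (j * m)))"
    by (intro mean_cong arg_cong2[of _ _ _ _ "(*)"] refl Suc.IH per) (auto intro: reps_integral)
  also have "\<dots> = mean (reps k) (\<lambda>c. mean (vecs k m) (\<lambda>x. f ((?s x)(m := of_nat p ^ j * c)))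
      / (real p ^ 2) ^ (j * m)) / (real p ^ 2) ^ j"
  proof (rule mean_reps_scale[OF assms(1)])
    fix c d assume cd: "c \<in> \<pp> 0" "d \<in> \<pp> 0" "c - d \<in> \<pp> k"
    have "f ((?s x)(m := c)) = f ((?s x)(m := d))" if "x \<in> vecs k m" for x
      using cd that by (intro periodicD[OF Suc.prems] ivecs_upd vcong_upd int vecs_ivecs[of _ k]) auto
    then show "mean (vecs k m) (\<lambda>x. f ((?s x)(m := c))) / (real p ^ 2) ^ (j * m) =
      mean (vecs k m) (\<lambda>x. f ((?s x)(m := d))) / (real p ^ 2) ^ (j * m)"
      by (simp cong: mean_cong)
  qed
  also have "\<dots> = mean (reps k) (\<lambda>c. mean (vecs k m) (\<lambda>x. f (?s (x(m := c))))) / (real p ^ 2) ^ (j * Suc m)"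
  proof -
    have "(?s x)(m := of_nat p ^ j * c) = ?s (x(m := c))" for x c
      by auto
    then show ?thesis
      using mean_cmult[of "reps k" "1 / (real p ^ 2) ^ (j * m)"]
      by (simp add: power_add mult_ac)
  qed
  finally show ?case
    unfolding mean_vecs_Suc .
qed

end

section \<open>Norms and Ramanujan sums\<close>

context odd_unramified_quadratic
begin

lemma norm_scale: "(of_nat p ^ i * x) * \<sigma> (of_nat p ^ i * x) = of_nat p ^ (2 * i) * (x * \<sigma> x)"
  by (simp add: gal.hom_mult gal.hom_power gal.hom_of_nat mult_2 power_add)

lemma norm_in_\<pp>_1_iff:
  assumes "x \<in> \<pp> 0"
  shows "x * \<sigma> x \<in> \<pp> 1 \<longleftrightarrow> x \<in> \<pp> 1"
proof
  assume n: "x * \<sigma> x \<in> \<pp> 1"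
  show "x \<in> \<pp> 1"
  proof (rule ccontr)
    assume "x \<notin> \<pp> 1"
    then have "w x = 1"
      using assms abs_eq_1_iff by blast
    then have "w (x * \<sigma> x) = 1"
      by (simp add: K.mult)
    then show False
      using n abs_eq_1_iff by blast
  qed
qed (use assms in \<open>simp add: \<pp>_mult_right\<close>)

lemma inj_on_quadratic_residues:
  assumes p: "int p = 2 * h + 1" and c: "\<not> int p dvd c"
  shows "inj_on (\<lambda>x. (a + c * x\<^sup>2) mod int p) {0..h}"
proof (rule inj_onI)
  fix x y assume xy: "x \<in> {0..h}" "y \<in> {0..h}" "(a + c * x\<^sup>2) mod int p = (a + c * y\<^sup>2) mod int p"
  have pr: "prime (int p)"
    using Qp.prime_p by simp
  have "int p dvd (a + c * x\<^sup>2) - (a + c * y\<^sup>2)"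
    using xy(3) by (simp add: mod_eq_dvd_iff)
  also have "(a + c * x\<^sup>2) - (a + c * y\<^sup>2) = c * ((x - y) * (x + y))"
    by (simp add: power2_eq_square algebra_simps)
  finally have "int p dvd x - y \<or> int p dvd x + y"
    using pr c by (metis prime_dvd_mult_iff)
  then show "x = y"
  proof
    assume "int p dvd x - y"
    then show ?thesis
      using xy(1,2) p zdvd_not_zless[of "\<bar>x - y\<bar>" "int p"] by force
  next
    assume "int p dvd x + y"
    then have "x + y = 0"
      using xy(1,2) p zdvd_not_zless[of "x + y" "int p"] by force
    then show ?thesis
      using xy(1,2) by simp
  qed
qed

text \<open>
  The squares and the values of \<open>a + c y^2\<close> each fill more than half of the residues modulo \<open>p\<close>,
  so they meet.
\<close>

lemma exists_sum_of_squares_mod: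
  assumes "\<not> int p dvd c"
  shows "\<exists>x y. int p dvd x\<^sup>2 + c * y\<^sup>2 - a"
proof -
  obtain h where h: "int p = 2 * h + 1"
    using odd_p by (metis even_of_nat oddE)
  have "h \<ge> 0"
    using h by simp
  let ?f = "\<lambda>x. (0 + 1 * x\<^sup>2) mod int p" and ?g = "\<lambda>y. (a + (- c) * y\<^sup>2) mod int p"
  have "\<not> int p dvd 1"
    using Qp.prime_p by (metis not_prime_unit prime_nat_int_transfer)
  then have f: "inj_on ?f {0..h}"
    using inj_on_quadratic_residues[OF h] by blast
  have g: "inj_on ?g {0..h}"
    using inj_on_quadratic_residues[OF h, of "- c"] assms by simp
  have "?f ` {0..h} \<inter> ?g ` {0..h} \<noteq> {}"
  proof
    assume "?f ` {0..h} \<inter> ?g ` {0..h} = {}"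
    then have "card (?f ` {0..h} \<union> ?g ` {0..h}) = card (?f ` {0..h}) + card (?g ` {0..h})"
      by (intro card_Un_disjoint) auto
    also have "\<dots> = 2 * nat (h + 1)"
      using card_image[OF f] card_image[OF g] by simp
    finally have "card (?f ` {0..h} \<union> ?g ` {0..h}) > p"
      using h \<open>h \<ge> 0\<close> by linarith
    moreover have "?f ` {0..h} \<union> ?g ` {0..h} \<subseteq> {0..<int p}"
      using p_gt_0 by auto
    then have "card (?f ` {0..h} \<union> ?g ` {0..h}) \<le> card {0..<int p}"
      by (intro card_mono) auto
    ultimately show False by simp
  qed
  then obtain x y where "?f x = ?g y" by blast
  then have "int p dvd x\<^sup>2 - (a - c * y\<^sup>2)"
    by (simp add: mod_eq_dvd_iff)
  also have "x\<^sup>2 - (a - c * y\<^sup>2) = x\<^sup>2 + c * y\<^sup>2 - a"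
    by simp
  finally show ?thesis by blast
qed

lemma norm_surjective_mod_p:
  assumes "fixed_integer u"
  shows "\<exists>x \<in> \<pp> 0. x * \<sigma> x - u \<in> \<pp> 1"
proof -
  have fd: "fixed_integer (\<delta> * \<sigma> \<delta>)"
    by (rule fixed_integer_norm) (simp add: unit_integral \<delta>)
  obtain c where c: "\<delta> * \<sigma> \<delta> - of_nat c \<in> \<pp> 1"
    using fixed_integer_approx[OF fd] by blast
  obtain a where a: "u - of_nat a \<in> \<pp> 1"
    using fixed_integer_approx[OF assms] by blast
  have "\<not> int p dvd int c"
  proof
    assume "int p dvd int c"
    then have "of_nat c \<in> \<pp> 1"
      using \<pp>_of_nat_iff[of c 1] by simp
    then have "\<delta> * \<sigma> \<delta> \<in> \<pp> 1"
      using c \<pp>_cong by blast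
    moreover have "w (\<delta> * \<sigma> \<delta>) = 1"
      by (simp add: K.mult \<delta>(4))
    ultimately show False
      using abs_eq_1_iff by blast
  qed
  then obtain x y where xy: "int p dvd x\<^sup>2 + int c * y\<^sup>2 - int a"
    using exists_sum_of_squares_mod by blast
  define z where "z = of_int x + of_int y * \<delta>"
  have z: "z \<in> \<pp> 0"
    unfolding z_def using coords_\<pp>_iff[of x y 0] by simp
  have "z * \<sigma> z = of_int x * of_int x + of_int y * of_int y * (\<delta> * \<sigma> \<delta>)"
    by (simp add: z_def gal.hom_add gal.hom_mult gal.hom_of_int \<delta> algebra_simps)
  then have "z * \<sigma> z - u = (of_int y * of_int y) * (\<delta> * \<sigma> \<delta> - of_nat c) +
      (of_int (x\<^sup>2 + int c * y\<^sup>2 - int a) - (u - of_nat a))"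
    by (simp add: power2_eq_square algebra_simps)
  moreover have "(of_int y * of_int y) * (\<delta> * \<sigma> \<delta> - of_nat c) \<in> \<pp> 1"
    using c by (intro \<pp>_mult_left) (simp_all add: \<pp>_of_int_iff flip: of_int_mult)
  moreover have "of_int (x\<^sup>2 + int c * y\<^sup>2 - int a) \<in> \<pp> 1"
    using xy \<pp>_of_int_iff[of "x\<^sup>2 + int c * y\<^sup>2 - int a" 1] by (simp only: power_one_right)
  ultimately have "z * \<sigma> z - u \<in> \<pp> 1"
    using a by (simp only: \<pp>_add \<pp>_diff)
  then show ?thesis
    using z by blast
qed

text \<open>
  Hensel's lemma for the norm: multiplying \<open>x\<close> by \<open>1 + (u - N x) / (2 N x)\<close> squares the error.
\<close>

lemma norm_surjective:
  assumes u: "fixed_integer u" "w u = 1"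
  shows "\<exists>x. w x = 1 \<and> x * \<sigma> x - u \<in> \<pp> k"
proof -
  have "\<exists>x. w x = 1 \<and> x * \<sigma> x - u \<in> \<pp> (Suc k)"
  proof (induction k)
    case 0
    obtain x where x: "x \<in> \<pp> 0" "x * \<sigma> x - u \<in> \<pp> 1"
      using norm_surjective_mod_p[OF u(1)] by blast
    have "w (x * \<sigma> x) = 1"
      using unit_cong[OF x(2) u(2)] .
    then have "w x = 1"
      using K.nonneg[of x] by (simp add: K.mult) (metis abs_of_nonneg real_sqrt_abs2 real_sqrt_one)
    then show ?case
      using x by auto
  next
    case (Suc k)
    then obtain x where x: "w x = 1" "x * \<sigma> x - u \<in> \<pp> (Suc k)" by blast
    define N where "N = x * \<sigma> x"
    define t where "t = (u - N) / (2 * N)"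
    have wN: "w N = 1" and N0: "N \<noteq> 0" and \<sigma>N: "\<sigma> N = N"
      using x(1) by (auto simp: N_def K.mult gal.hom_mult mult.commute)
    have \<sigma>t: "\<sigma> t = t"
      using u(1) \<sigma>N gal.hom_of_nat[of 2]
      by (simp add: t_def \<sigma>_divide gal.hom_minus gal.hom_mult fixed_integer_def)
    have "w (u - N) \<le> (1 / real p) ^ Suc k"
      using x(2) by (metis N_def K.abs_diff_commute in_\<pp>_iff)
    then have "t \<in> \<pp> (Suc k)"
      by (simp add: in_\<pp>_iff t_def K.abs_divide K.mult abs_2 wN)
    have "x * (1 + t) * \<sigma> (x * (1 + t)) = N * ((1 + t) * (1 + t))"
      by (simp add: N_def gal.hom_mult gal.hom_add \<sigma>t mult_ac)
    also have "\<dots> = N + 2 * N * t + N * (t * t)"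
      by (simp add: algebra_simps)
    also have "2 * N * t = u - N"
      using N0 by (simp add: t_def)
    finally have "x * (1 + t) * \<sigma> (x * (1 + t)) - u = N * (t * t)"
      by simp
    moreover have "N * (t * t) \<in> \<pp> (Suc k + Suc k)"
      using \<open>t \<in> \<pp> (Suc k)\<close> wN by (simp add: \<pp>_unit_mult_iff \<pp>_mult del: add_Suc add_Suc_right)
    then have "N * (t * t) \<in> \<pp> (Suc (Suc k))"
      by (rule \<pp>_mono[rotated]) simp
    moreover have "w (x * (1 + t)) = 1"
    proof -
      have "t \<in> \<pp> 1"
        using \<open>t \<in> \<pp> (Suc k)\<close> by (rule \<pp>_mono[rotated]) simp
      then have "w (1 + t) = 1"
        by (intro unit_cong[of "1 + t" 1]) auto
      then show ?thesis
        using x(1) by (simp add: K.mult)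
    qed
    ultimately show ?case by auto
  qed
  then show ?thesis
    using \<pp>_mono[of k "Suc k"] by (metis le_SucI order_refl)
qed

definition herm :: "nat \<Rightarrow> (nat \<Rightarrow> 'k) \<Rightarrow> (nat \<Rightarrow> 'k) \<Rightarrow> 'k" where
  "herm m x y = (\<Sum>i<m. x i * \<sigma> (y i))"

text \<open>
  The value \<open>\<chi> l u\<close> is the Ramanujan sum of \<open>u\<close>: the sum of all additive characters of conductor
  exactly \<open>p^l\<close>, evaluated at \<open>u\<close>.
\<close>

definition \<chi> :: "nat \<Rightarrow> 'k \<Rightarrow> real" where
  "\<chi> l u = (if l = 0 then 1
    else real p ^ l * of_bool (u \<in> \<pp> l) - real p ^ (l - 1) * of_bool (u \<in> \<pp> (l - 1)))"

text \<open>
  The variable \<open>X\<close> of the density polynomial takes the value \<open>\<xi>^r\<close> when \<open>r\<close> units are added to \<open>S\<close>.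
\<close>

definition \<xi> :: real where
  "\<xi> = - (1 / real p)"

lemma \<chi>_cong: "u - u' \<in> \<pp> l \<Longrightarrow> \<chi> l u = \<chi> l u'"
  using \<pp>_cong[of u u' l] \<pp>_cong[of u u' "l - 1"] \<pp>_mono[of "l - 1" l "u - u'"]
  by (simp add: \<chi>_def)

lemma sum_\<chi>:
  assumes "u \<in> \<pp> 0"
  shows "(\<Sum>l\<le>k. \<chi> l u) = real p ^ k * of_bool (u \<in> \<pp> k)"
  using assms by (induction k) (auto simp: \<chi>_def)

lemma \<chi>_p_mult: "\<chi> (Suc l) (of_nat p * x) = real p * \<chi> l x - (if l = 0 then 1 else 0)" if "x \<in> \<pp> 0"
  using \<pp>_scale_iff[of 1 x] \<pp>_mult_left[OF of_nat_integral that, of p] that p_gt_0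
  by (cases l) (auto simp: \<chi>_def algebra_simps)

lemma \<chi>_unit:
  assumes "w u = 1" "l > 0"
  shows "\<chi> l u = - of_bool (l = 1)"
proof -
  have "u \<notin> \<pp> j" if "j > 0" for j
    using assms(1) abs_eq_1_iff \<pp>_mono[of 1 j u] that by auto
  moreover have "u \<in> \<pp> 0"
    using assms(1) by (rule unit_integral)
  ultimately show ?thesis
    using assms(2) by (cases "l = 1") (auto simp: \<chi>_def)
qed

lemma mean_reps_\<pp>_1: "0 < k \<Longrightarrow> mean (reps k) (\<lambda>c. of_bool (c \<in> \<pp> 1)) = 1 / (real p)\<^sup>2"
  using mean_reps_scale[of 1 k "\<lambda>_. 1"] by (simp add: mean_const)

lemma norm_diff_in_\<pp>:
  assumes "x \<in> \<pp> 0" "y \<in> \<pp> 0" "x - y \<in> \<pp> k"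
  shows "x * \<sigma> x - y * \<sigma> y \<in> \<pp> k"
proof -
  have "x * \<sigma> x - y * \<sigma> y = x * \<sigma> (x - y) + (x - y) * \<sigma> y"
    by (simp add: gal.hom_minus algebra_simps)
  then show ?thesis
    using assms by (simp add: \<pp>_add \<pp>_mult_left \<pp>_mult_right)
qed

text \<open>
  Multiplication by an element of norm \<open>u\<close> shows that all unit classes modulo \<open>p^l\<close> are norms
  equally often.
\<close>

lemma mean_norm_unit_class:
  assumes u: "fixed_integer u" "w u = 1" and l: "l \<le> k"
  shows "mean (reps k) (\<lambda>c. of_bool (u - c * \<sigma> c \<in> \<pp> l)) =
    mean (reps k) (\<lambda>c. of_bool (1 - c * \<sigma> c \<in> \<pp> l))"
proof -
  obtain \<nu> where \<nu>: "w \<nu> = 1" "\<nu> * \<sigma> \<nu> - u \<in> \<pp> k"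
    using norm_surjective[OF u] by blast
  have "mean (reps k) (\<lambda>c. of_bool (u - (\<nu> * c) * \<sigma> (\<nu> * c) \<in> \<pp> l)) =
      mean (reps k) (\<lambda>c. of_bool (u - c * \<sigma> c \<in> \<pp> l))"
  proof (rule mean_reps_change[where \<phi> = "(*) \<nu>" and g = "\<lambda>c. of_bool (u - c * \<sigma> c \<in> \<pp> l)"])
    show "x - y \<in> \<pp> k" if "\<nu> * x - \<nu> * y \<in> \<pp> k" for x y
      using that \<nu>(1) by (simp add: \<pp>_unit_mult_iff flip: right_diff_distrib)
    show "of_bool (u - x * \<sigma> x \<in> \<pp> l) = (of_bool (u - y * \<sigma> y \<in> \<pp> l) :: real)"
      if "x \<in> \<pp> 0" "y \<in> \<pp> 0" "x - y \<in> \<pp> k" for x y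
    proof -
      have "(u - y * \<sigma> y) - (u - x * \<sigma> x) \<in> \<pp> l"
        using norm_diff_in_\<pp>[OF that] l \<pp>_mono by simp
      then show ?thesis
        using \<pp>_cong[of "u - y * \<sigma> y" "u - x * \<sigma> x" l] by simp
    qed
  qed (simp add: \<nu>(1) \<pp>_unit_mult_iff)
  moreover have "u - (\<nu> * c) * \<sigma> (\<nu> * c) \<in> \<pp> l \<longleftrightarrow> 1 - c * \<sigma> c \<in> \<pp> l" if "c \<in> reps k" for c
  proof -
    have "u - (\<nu> * c) * \<sigma> (\<nu> * c) - u * (1 - c * \<sigma> c) = - ((\<nu> * \<sigma> \<nu> - u) * (c * \<sigma> c))"
      by (simp add: gal.hom_mult algebra_simps)
    also have "\<dots> \<in> \<pp> l"
      using \<pp>_mono[OF l \<nu>(2)] that by (simp add: \<pp>_mult_right \<pp>_mult_left reps_integral)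
    finally show ?thesis
      using \<pp>_cong \<pp>_unit_mult_iff[OF u(2)] by blast
  qed
  ultimately show ?thesis
    by (simp cong: mean_cong)
qed

lemma card_units_mod: "card {n. n < p ^ Suc l \<and> \<not> p dvd n} = p ^ Suc l - p ^ l"
proof -
  have "{n. n < p ^ Suc l \<and> p dvd n} = (*) p ` {..<p ^ l}"
    using p_gt_0 by (auto elim!: dvdE)
  moreover have "inj_on ((*) p) {..<p ^ l}"
    using p_gt_0 by (auto intro!: inj_onI)
  ultimately have "card {n. n < p ^ Suc l \<and> p dvd n} = p ^ l"
    by (simp add: card_image)
  moreover have "{n. n < p ^ Suc l \<and> \<not> p dvd n} = {..<p ^ Suc l} - {n. n < p ^ Suc l \<and> p dvd n}"
    by auto
  ultimately show ?thesis
    by (subst \<open>{n. n < p ^ Suc l \<and> \<not> p dvd n} = _\<close>, subst card_Diff_subset) auto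
qed

text \<open>
  The \<open>p^(l + 1) - p^l\<close> unit classes modulo \<open>p^(l + 1)\<close> share equally the norms of the units, which have
  proportion \<open>1 - 1/p^2\<close> among all \<open>c\<close>.
\<close>

lemma mean_norm_unit:
  assumes u: "fixed_integer u" "w u = 1" and l: "Suc l \<le> k"
  shows "mean (reps k) (\<lambda>c. of_bool (u - c * \<sigma> c \<in> \<pp> (Suc l))) = (1 + 1 / real p) / real p ^ Suc l"
proof -
  define U where "U = {n. n < p ^ Suc l \<and> \<not> p dvd n}"
  define A where "A = mean (reps k) (\<lambda>c. of_bool (1 - c * \<sigma> c \<in> \<pp> (Suc l)))"
  have unit: "w (of_nat n :: 'k) = 1" if "\<not> p dvd n" for n
    using K.abs_of_int_unit[of "int n"] that by simp
  have "(\<Sum>n\<in>U. of_bool (of_nat n - c * \<sigma> c \<in> \<pp> (Suc l))) = (1 :: real) - of_bool (c \<in> \<pp> 1)"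
    if c: "c \<in> reps k" for c
  proof (cases "c \<in> \<pp> 1")
    case True
    have "of_nat n - c * \<sigma> c \<notin> \<pp> (Suc l)" if "n \<in> U" for n
    proof
      assume "of_nat n - c * \<sigma> c \<in> \<pp> (Suc l)"
      then have "of_nat n - c * \<sigma> c \<in> \<pp> 1"
        by (rule \<pp>_mono[rotated]) simp
      moreover have "c * \<sigma> c \<in> \<pp> 1"
        using True c by (simp add: \<pp>_mult_right reps_integral)
      ultimately have "of_nat n \<in> \<pp> 1"
        using \<pp>_cong by blast
      then show False
        using unit that abs_eq_1_iff unfolding U_def by blast
    qed
    then show ?thesis
      using True by (simp cong: sum.cong)
  next
    case False
    have c0: "c \<in> \<pp> 0"
      using c by (rule reps_integral)
    obtain n0 where n0: "n0 < p ^ Suc l" "c * \<sigma> c - of_nat n0 \<in> \<pp> (Suc l)"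
      using fixed_integer_approx[OF fixed_integer_norm[OF c0]] by blast
    have "c * \<sigma> c - of_nat n0 \<in> \<pp> 1"
      using n0(2) by (rule \<pp>_mono[rotated]) simp
    then have "of_nat n0 \<notin> \<pp> 1"
      using False norm_in_\<pp>_1_iff[OF c0] \<pp>_cong by blast
    then have n0U: "n0 \<in> U"
      using n0(1) \<pp>_of_nat_iff[of n0 1] by (simp add: U_def)
    have "of_nat n - c * \<sigma> c \<in> \<pp> (Suc l) \<longleftrightarrow> n = n0" if "n \<in> U" for n
    proof
      assume "of_nat n - c * \<sigma> c \<in> \<pp> (Suc l)"
      then have "of_nat n - of_nat n0 \<in> \<pp> (Suc l)"
        using n0(2) \<pp>_trans by blast
      then have "of_int (int n - int n0) \<in> \<pp> (Suc l)"
        by simp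
      then have dv: "int (p ^ Suc l) dvd int n - int n0"
        using \<pp>_of_int_iff[of "int n - int n0" "Suc l"] by simp
      have "\<bar>int n - int n0\<bar> < int (p ^ Suc l)"
        using that n0(1) unfolding U_def mem_Collect_eq by linarith
      then show "n = n0"
        using dv zdvd_not_zless[of "\<bar>int n - int n0\<bar>" "int (p ^ Suc l)"] by force
    qed (use n0(2) \<pp>_diff_commute in blast)
    then have "(\<Sum>n\<in>U. of_bool (of_nat n - c * \<sigma> c \<in> \<pp> (Suc l))) = (\<Sum>n\<in>U. of_bool (n = n0) :: real)"
      by (intro sum.cong) auto
    also have "\<dots> = 1"
      using n0U by (simp add: of_bool_def U_def)
    finally show ?thesis
      using False by simp
  qed
  then have "(\<Sum>n\<in>U. mean (reps k) (\<lambda>c. of_bool (of_nat n - c * \<sigma> c \<in> \<pp> (Suc l)))) =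
      mean (reps k) (\<lambda>c. 1 - of_bool (c \<in> \<pp> 1))"
    unfolding mean_sum[symmetric] by (rule mean_cong)
  also have "\<dots> = 1 - 1 / (real p)\<^sup>2"
    using l mean_reps_\<pp>_1[of k] by (simp add: mean_diff mean_const)
  also have "(\<Sum>n\<in>U. mean (reps k) (\<lambda>c. of_bool (of_nat n - c * \<sigma> c \<in> \<pp> (Suc l)))) = (\<Sum>n\<in>U. A)"
    unfolding A_def using l unit by (intro sum.cong refl mean_norm_unit_class) (auto simp: U_def)
  finally have "real (p ^ Suc l - p ^ l) * A = 1 - 1 / (real p)\<^sup>2"
    using card_units_mod by (simp add: U_def)
  moreover have "real (p ^ Suc l - p ^ l) = real p ^ l * (real p - 1)"
    using p_gt_0 by (simp add: of_nat_diff algebra_simps)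
  ultimately have "A * (real p ^ l * (real p - 1)) = 1 - 1 / (real p)\<^sup>2"
    by (simp add: mult.commute)
  then have "A = (1 - 1 / (real p)\<^sup>2) / (real p ^ l * (real p - 1))"
    using p_gt_1 by (simp add: eq_divide_eq)
  also have "\<dots> = (1 + 1 / real p) / real p ^ Suc l"
    using p_gt_1 by (simp add: field_simps power2_eq_square)
  finally show ?thesis
    unfolding A_def using mean_norm_unit_class[OF u l] by simp
qed

text \<open>
  Averaging over norms acts on the characters of conductor \<open>p^l\<close> by a scalar, a normalised Gauss sum
  of the norm form. By counting: if \<open>u\<close> is a unit, the values are distributed as in
  \<open>mean_norm_unit\<close>. If \<open>p\<close> divides \<open>u\<close> and \<open>l \<ge> 2\<close>, only \<open>c\<close> divisible by \<open>p\<close> contribute, and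
  substituting \<open>p c\<close> for \<open>c\<close> divides \<open>u\<close> by \<open>p^2\<close> and lowers \<open>l\<close> by \<open>2\<close>.
\<close>

lemma mean_\<chi>_norm:
  assumes "fixed_integer u" "l \<le> k"
  shows "mean (reps k) (\<lambda>c. \<chi> l (u - c * \<sigma> c)) = \<xi> ^ l * \<chi> l u"
  using assms
proof (induction l arbitrary: u rule: less_induct)
  case (less l)
  have u0: "u \<in> \<pp> 0"
    using less.prems(1) by (simp add: fixed_integer_def)
  have split: "mean (reps k) (\<lambda>c. \<chi> (Suc j) (u - c * \<sigma> c)) =
      real p ^ Suc j * mean (reps k) (\<lambda>c. of_bool (u - c * \<sigma> c \<in> \<pp> (Suc j))) -
      real p ^ j * mean (reps k) (\<lambda>c. of_bool (u - c * \<sigma> c \<in> \<pp> j))" for j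
    by (simp add: \<chi>_def mean_diff mean_cmult)
  have int: "u - c * \<sigma> c \<in> \<pp> 0" if "c \<in> reps k" for c
    using that u0 by (simp add: \<pp>_diff \<pp>_mult_left reps_integral)
  have mean0: "mean (reps k) (\<lambda>c. of_bool (u - c * \<sigma> c \<in> \<pp> 0)) = 1"
    using int by (simp add: mean_const cong: mean_cong)
  show ?case
  proof (cases l)
    case 0
    then show ?thesis
      by (simp add: \<chi>_def mean_const)
  next
    case (Suc j)
    show ?thesis
    proof (cases "w u = 1")
      case True
      show ?thesis
      proof (cases j)
        case 0
        then show ?thesis
          using True less.prems Suc p_gt_0 unfolding Suc split
          by (simp add: mean_norm_unit mean0 \<chi>_unit \<xi>_def field_simps)
      next
        case (Suc i)
        then show ?thesis
          using True less.prems \<open>l = Suc j\<close> p_gt_0 unfolding \<open>l = Suc j\<close> split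
          by (simp add: mean_norm_unit \<chi>_unit)
      qed
    next
      case False
      then have "u \<in> \<pp> 1"
        using u0 abs_eq_1_iff by blast
      then obtain u' where u': "u' \<in> \<pp> 0" "u = of_nat p * u'"
        using \<pp>_scaleE[of u 1 0] by auto
      have nz: "(of_nat p :: 'k) \<noteq> 0"
        using p_gt_0 by simp
      have fu': "fixed_integer u'"
        using less.prems(1) u' nz by (simp add: fixed_integer_def gal.hom_mult gal.hom_of_nat)
      have Npc: "(of_nat p * c) * \<sigma> (of_nat p * c) = of_nat p * (of_nat p * (c * \<sigma> c))" for c
        by (simp add: gal.hom_mult gal.hom_of_nat)
      have u_sub: "u - c * \<sigma> c \<in> \<pp> 1 \<longleftrightarrow> c \<in> \<pp> 1" if "c \<in> reps k" for c
        using \<open>u \<in> \<pp> 1\<close> norm_in_\<pp>_1_iff[OF reps_integral[OF that]] \<pp>_add_left_iff[of u 1 "- (c * \<sigma> c)"]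
        by simp
      show ?thesis
      proof (cases j)
        case 0
        have "mean (reps k) (\<lambda>c. of_bool (u - c * \<sigma> c \<in> \<pp> (Suc 0))) = 1 / (real p)\<^sup>2"
          using less.prems(2) Suc 0 u_sub by (simp add: mean_reps_\<pp>_1[simplified] cong: mean_cong)
        then show ?thesis
          using u_sub \<open>u \<in> \<pp> 1\<close> u0 p_gt_0 unfolding Suc 0 split
          by (simp add: mean0 \<chi>_def \<xi>_def field_simps power2_eq_square)
      next
        case (Suc i)
        have l: "l = Suc (Suc i)"
          using \<open>l = Suc j\<close> Suc by simp
        have zero: "\<chi> l (u - c * \<sigma> c) = of_bool (c \<in> \<pp> 1) * \<chi> l (u - c * \<sigma> c)" if "c \<in> reps k" for c
        proof (cases "c \<in> \<pp> 1")
          case False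
          then have "w (u - c * \<sigma> c) = 1"
            using int u_sub that abs_eq_1_iff by blast
          then show ?thesis
            using False l \<chi>_unit[of _ l] by simp
        qed simp
        have int': "u' - of_nat p * (c * \<sigma> c) \<in> \<pp> 0" if "c \<in> reps k" for c
          using that u'(1) by (simp add: \<pp>_diff \<pp>_mult_left reps_integral)
        have "mean (reps k) (\<lambda>c. \<chi> l (u - c * \<sigma> c)) =
            mean (reps k) (\<lambda>c. of_bool (c \<in> \<pp> 1) * \<chi> l (u - c * \<sigma> c))"
          using zero by (rule mean_cong)
        also have "\<dots> = mean (reps k) (\<lambda>c. \<chi> l (u - (of_nat p ^ 1 * c) * \<sigma> (of_nat p ^ 1 * c))) / (real p ^ 2) ^ 1"
        proof (rule mean_reps_scale)
          show "1 \<le> k"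
            using less.prems(2) l by simp
          show "\<chi> l (u - x * \<sigma> x) = \<chi> l (u - y * \<sigma> y)"
            if "x \<in> \<pp> 0" "y \<in> \<pp> 0" "x - y \<in> \<pp> k" for x y
          proof -
            have "y * \<sigma> y - x * \<sigma> x \<in> \<pp> l"
              using norm_diff_in_\<pp>[OF that] \<pp>_mono[OF less.prems(2)] \<pp>_diff_commute by blast
            then show ?thesis
              by (intro \<chi>_cong) simp
          qed
        qed
        also have "mean (reps k) (\<lambda>c. \<chi> l (u - (of_nat p ^ 1 * c) * \<sigma> (of_nat p ^ 1 * c))) =
            mean (reps k) (\<lambda>c. real p * \<chi> (Suc i) (u' - of_nat p * (c * \<sigma> c)))"
        proof (rule mean_cong)
          fix c assume c: "c \<in> reps k"
          have "u - (of_nat p ^ 1 * c) * \<sigma> (of_nat p ^ 1 * c) = of_nat p * (u' - of_nat p * (c * \<sigma> c))"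
            using Npc[of c] by (simp add: u'(2) right_diff_distrib)
          then show "\<chi> l (u - (of_nat p ^ 1 * c) * \<sigma> (of_nat p ^ 1 * c)) =
              real p * \<chi> (Suc i) (u' - of_nat p * (c * \<sigma> c))"
            using \<chi>_p_mult[OF int'[OF c], of "Suc i"] by (simp only: l) simp
        qed
        finally have red: "mean (reps k) (\<lambda>c. \<chi> l (u - c * \<sigma> c)) =
            mean (reps k) (\<lambda>c. \<chi> (Suc i) (u' - of_nat p * (c * \<sigma> c))) / real p"
          using p_gt_0 by (simp add: mean_cmult power2_eq_square)
        have \<chi>lu: "\<chi> l u = real p * \<chi> (Suc i) u'"
          using \<chi>_p_mult[OF u'(1), of "Suc i"] by (simp add: l u'(2))
        show ?thesis
        proof (cases "w u' = 1")
          case True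
          have "\<chi> (Suc i) (u' - of_nat p * (c * \<sigma> c)) = \<chi> (Suc i) u'" if "c \<in> reps k" for c
          proof -
            have "of_nat p * (c * \<sigma> c) \<in> \<pp> 1"
              using that \<pp>_mult[of "of_nat p" 1 "c * \<sigma> c" 0] p_power_\<pp>[of 1]
              by (simp add: \<pp>_mult_left reps_integral)
            then have "w (u' - of_nat p * (c * \<sigma> c)) = 1"
              using True by (intro unit_cong[of "u' - of_nat p * (c * \<sigma> c)" u']) simp
            then show ?thesis
              using True by (simp add: \<chi>_unit)
          qed
          then have "mean (reps k) (\<lambda>c. \<chi> l (u - c * \<sigma> c)) = \<chi> (Suc i) u' / real p"
            unfolding red by (simp add: mean_const cong: mean_cong)
          then show ?thesis
            using True p_gt_0 unfolding \<chi>lu by (cases i) (simp_all add: l \<chi>_unit \<xi>_def)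
        next
          case False
          then have "u' \<in> \<pp> 1"
            using u'(1) abs_eq_1_iff by blast
          then obtain u'' where u'': "u'' \<in> \<pp> 0" "u' = of_nat p * u''"
            using \<pp>_scaleE[of u' 1 0] by auto
          have fu'': "fixed_integer u''"
            using fu' u'' nz by (simp add: fixed_integer_def gal.hom_mult gal.hom_of_nat)
          have int'': "u'' - c * \<sigma> c \<in> \<pp> 0" if "c \<in> reps k" for c
            using that u''(1) by (simp add: \<pp>_diff \<pp>_mult_left reps_integral)
          have "mean (reps k) (\<lambda>c. \<chi> (Suc i) (u' - of_nat p * (c * \<sigma> c))) =
              mean (reps k) (\<lambda>c. real p * \<chi> i (u'' - c * \<sigma> c) - (if i = 0 then 1 else 0))"
          proof (rule mean_cong)
            fix c assume c: "c \<in> reps k"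
            have "u' - of_nat p * (c * \<sigma> c) = of_nat p * (u'' - c * \<sigma> c)"
              by (simp add: u''(2) right_diff_distrib)
            then show "\<chi> (Suc i) (u' - of_nat p * (c * \<sigma> c)) =
                real p * \<chi> i (u'' - c * \<sigma> c) - (if i = 0 then 1 else 0)"
              using \<chi>_p_mult[OF int''[OF c], of i] by simp
          qed
          also have "\<dots> = real p * (\<xi> ^ i * \<chi> i u'') - (if i = 0 then 1 else 0)"
            using less.IH[of i u''] less.prems(2) fu'' l by (simp add: mean_diff mean_cmult mean_const)
          finally have M: "mean (reps k) (\<lambda>c. \<chi> l (u - c * \<sigma> c)) =
              (real p * (\<xi> ^ i * \<chi> i u'') - (if i = 0 then 1 else 0)) / real p"
            unfolding red by simp
          have E: "\<chi> l u = real p * (real p * \<chi> i u'' - (if i = 0 then 1 else 0))"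
            using \<chi>_p_mult[OF u''(1), of i] \<chi>lu u''(2) by simp
          have "i = 0 \<Longrightarrow> \<chi> i u'' = 1"
            by (simp add: \<chi>_def)
          then show ?thesis
            unfolding M E unfolding l using p_gt_0 by (cases "i = 0") (auto simp: \<xi>_def field_simps)
        qed
      qed
    qed
  qed
qed

lemma herm_Suc_upd: "herm (Suc m) (x(m := c)) (y(m := d)) = herm m x y + c * \<sigma> d"
  by (simp add: herm_def)

lemma \<sigma>_herm: "\<sigma> (herm m x y) = herm m y x"
  by (simp add: herm_def gal.hom_sum gal.hom_mult mult.commute)

lemma herm_integral: "x \<in> ivecs m \<Longrightarrow> y \<in> ivecs m \<Longrightarrow> herm m x y \<in> \<pp> 0"
  unfolding herm_def by (intro \<pp>_sum \<pp>_mult_left) (auto simp: ivecs_integral)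

lemma fixed_integer_herm: "x \<in> ivecs m \<Longrightarrow> fixed_integer (herm m x x)"
  by (simp add: fixed_integer_def \<sigma>_herm herm_integral)

lemma mean_\<chi>_herm:
  assumes "fixed_integer u" "l \<le> k"
  shows "mean (vecs k m) (\<lambda>x. \<chi> l (u - herm m x x)) = (\<xi> ^ m) ^ l * \<chi> l u"
  using assms(1)
proof (induction m arbitrary: u)
  case 0
  then show ?case
    by (simp add: vecs_0 mean_def herm_def)
next
  case (Suc m)
  have "mean (vecs k (Suc m)) (\<lambda>x. \<chi> l (u - herm (Suc m) x x)) =
      mean (reps k) (\<lambda>c. mean (vecs k m) (\<lambda>x. \<chi> l ((u - c * \<sigma> c) - herm m x x)))"
    by (simp add: mean_vecs_Suc herm_Suc_upd algebra_simps)
  also have "\<dots> = mean (reps k) (\<lambda>c. (\<xi> ^ m) ^ l * \<chi> l (u - c * \<sigma> c))"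
    by (intro mean_cong Suc.IH fixed_integer_diff Suc.prems fixed_integer_norm) (rule reps_integral)
  also have "\<dots> = (\<xi> ^ Suc m) ^ l * \<chi> l u"
    by (simp add: mean_cmult mean_\<chi>_norm Suc.prems assms(2) power_mult_distrib mult_ac)
  finally show ?case .
qed

lemma mean_herm_eq:
  assumes "fixed_integer u" "j \<le> k"
  shows "mean (vecs k m) (\<lambda>x. of_bool (u - herm m x x \<in> \<pp> j)) =
    (\<Sum>l\<le>j. (\<xi> ^ m) ^ l * \<chi> l u) / real p ^ j"
proof -
  have "mean (vecs k m) (\<lambda>x. of_bool (u - herm m x x \<in> \<pp> j)) =
      mean (vecs k m) (\<lambda>x. 1 / real p ^ j * (\<Sum>l\<le>j. \<chi> l (u - herm m x x)))"
  proof (rule mean_cong)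
    fix x assume "x \<in> vecs k m"
    then have "u - herm m x x \<in> \<pp> 0"
      using assms(1) vecs_ivecs by (intro \<pp>_diff herm_integral) (auto simp: fixed_integer_def)
    then show "of_bool (u - herm m x x \<in> \<pp> j) = 1 / real p ^ j * (\<Sum>l\<le>j. \<chi> l (u - herm m x x))"
      using p_gt_0 by (simp add: sum_\<chi>)
  qed
  also have "\<dots> = (\<Sum>l\<le>j. (\<xi> ^ m) ^ l * \<chi> l u) / real p ^ j"
    unfolding mean_cmult mean_sum using assms by (simp add: mean_\<chi>_herm)
  finally show ?thesis .
qed

end

section \<open>Isometries and columns of norm one\<close>

context odd_unramified_quadratic
begin

text \<open>
  Isometries are only required modulo \<open>p^k\<close>, in the form in which they are used for substitutions in
  averages.
\<close>

definition isometry :: "nat \<Rightarrow> nat \<Rightarrow> ((nat \<Rightarrow> 'k) \<Rightarrow> nat \<Rightarrow> 'k) \<Rightarrow> bool" where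
  "isometry k m \<phi> \<longleftrightarrow>
    (\<forall>u \<in> ivecs m. \<phi> u \<in> ivecs m) \<and>
    (\<forall>u \<in> ivecs m. \<forall>v \<in> ivecs m. herm m (\<phi> u) (\<phi> v) - herm m u v \<in> \<pp> k) \<and>
    (\<forall>u \<in> ivecs m. \<forall>v \<in> ivecs m. vcong k (\<phi> u) (\<phi> v) \<longrightarrow> vcong k u v)"

lemma isometryD:
  assumes "isometry k m \<phi>" "x \<in> ivecs m" "y \<in> ivecs m"
  shows "\<phi> x \<in> ivecs m" "herm m (\<phi> x) (\<phi> y) - herm m x y \<in> \<pp> k"
    "vcong k (\<phi> x) (\<phi> y) \<Longrightarrow> vcong k x y"
  using assms by (auto simp: isometry_def)

lemma isometry_ivecs: "isometry k m \<phi> \<Longrightarrow> x \<in> ivecs m \<Longrightarrow> \<phi> x \<in> ivecs m"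
  by (simp add: isometry_def)

lemma isometry_comp: "isometry k m \<phi> \<Longrightarrow> isometry k m \<psi> \<Longrightarrow> isometry k m (\<phi> \<circ> \<psi>)"
  unfolding isometry_def comp_def using \<pp>_trans by (metis (no_types, lifting))

lemma herm_diff_left: "herm m (\<lambda>i. x i - y i) z = herm m x z - herm m y z"
  by (simp add: herm_def left_diff_distrib sum_subtractf)

lemma herm_diff_right: "herm m z (\<lambda>i. x i - y i) = herm m z x - herm m z y"
  by (simp add: herm_def right_diff_distrib sum_subtractf gal.hom_minus)

lemma herm_scale_left: "herm m (\<lambda>i. y i * a) z = a * herm m y z"
  by (simp add: herm_def sum_distrib_left mult_ac)

lemma herm_scale_right: "herm m z (\<lambda>i. y i * a) = \<sigma> a * herm m z y"
  by (simp add: herm_def sum_distrib_left gal.hom_mult mult_ac)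

lemma herm_cong:
  assumes "x \<in> ivecs m" "x' \<in> ivecs m" "y \<in> ivecs m" "y' \<in> ivecs m" "vcong k x x'" "vcong k y y'"
  shows "herm m x y - herm m x' y' \<in> \<pp> k"
proof -
  have "x i * \<sigma> (y i) - x' i * \<sigma> (y' i) \<in> \<pp> k" for i
  proof -
    have "x i * \<sigma> (y i) - x' i * \<sigma> (y' i) = x i * \<sigma> (y i - y' i) + (x i - x' i) * \<sigma> (y' i)"
      by (simp add: gal.hom_minus algebra_simps)
    then show ?thesis
      using assms by (simp add: \<pp>_add \<pp>_mult_left \<pp>_mult_right ivecs_integral vcong_def)
  qed
  then show ?thesis
    unfolding herm_def sum_subtractf[symmetric] by (intro \<pp>_sum)
qed

lemma herm_in_\<pp>_cong:
  assumes "x \<in> ivecs m" "x' \<in> ivecs m" "y \<in> ivecs m" "y' \<in> ivecs m" "vcong k x x'" "vcong k y y'"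
  shows "herm m x y - t \<in> \<pp> k \<longleftrightarrow> herm m x' y' - t \<in> \<pp> k"
  using \<pp>_cong[of "herm m x y - t" "herm m x' y' - t" k] herm_cong[OF assms] by simp

text \<open>
  A quasi-reflection will need a unit denominator \<open>s - \<epsilon> u\<close>. The two candidates differ by \<open>2 u\<close>, which is a
  unit because \<open>p\<close> is odd.
\<close>

lemma exists_sign_unit:
  assumes s: "s \<in> \<pp> 0" and u: "w u = 1"
  shows "\<exists>\<epsilon>\<in>{1, - 1}. w (s - \<epsilon> * u) = 1"
proof (rule ccontr)
  assume "\<not> ?thesis"
  then have "s - u \<in> \<pp> 1" "s + u \<in> \<pp> 1"
    using s unit_integral[OF u] abs_eq_1_iff[of "s - u"] abs_eq_1_iff[of "s + u"]
    by (auto simp: \<pp>_diff \<pp>_add)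
  then have "(s + u) - (s - u) \<in> \<pp> 1"
    using \<pp>_diff[of "s + u" 1 "s - u"] by blast
  moreover have "(s + u) - (s - u) = 2 * u"
    by simp
  ultimately have "2 * u \<in> \<pp> 1"
    by metis
  moreover have "w (2 * u) = 1"
    by (simp add: K.mult abs_2 u)
  ultimately show False
    using abs_eq_1_iff by blast
qed

text \<open>
  The map \<open>v \<mapsto> v - y h(v, y) / c\<close> preserves the form as soon as \<open>c + \<sigma> c = h(y, y)\<close>. For \<open>y = x - e\<close>
  and \<open>c = h(x, y)\<close> it carries \<open>x\<close> to \<open>e\<close>, and the condition on \<open>c\<close> says \<open>h(x, x) = h(e, e)\<close>.
\<close>

lemma exists_quasi_reflection:
  assumes x: "x \<in> ivecs m" and e: "e \<in> ivecs m"
    and xe: "herm m e e - herm m x x \<in> \<pp> k"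
    and unit: "w (herm m x x - herm m x e) = 1"
  shows "\<exists>\<phi>. isometry k m \<phi> \<and> \<phi> x = e"
proof -
  define y where "y = (\<lambda>i. x i - e i)"
  define c where "c = herm m x y"
  define \<phi> where "\<phi> = (\<lambda>v i. v i - y i * (herm m v y / c))"
  have c: "c = herm m x x - herm m x e"
    by (simp add: c_def y_def herm_diff_right)
  have wc: "w c = 1" and w\<sigma>c: "w (\<sigma> c) = 1"
    using unit by (simp_all add: c)
  then have c0: "c \<noteq> 0" and \<sigma>c0: "\<sigma> c \<noteq> 0"
    using K.abs_0 by (metis zero_neq_one)+
  have y: "y \<in> ivecs m"
    using x e by (auto simp: ivecs_def y_def \<pp>_diff)
  have hyy: "herm m y y - (c + \<sigma> c) \<in> \<pp> k"
  proof -
    have "herm m y y - (c + \<sigma> c) = herm m e e - herm m x x"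
      unfolding c by (simp add: y_def herm_diff_left herm_diff_right gal.hom_minus \<sigma>_herm)
    then show ?thesis
      using xe by simp
  qed
  have quot: "z / c \<in> \<pp> j \<longleftrightarrow> z \<in> \<pp> j" "z / \<sigma> c \<in> \<pp> j \<longleftrightarrow> z \<in> \<pp> j" for z j
    by (simp_all add: in_\<pp>_iff K.abs_divide wc)
  have "isometry k m \<phi>"
    unfolding isometry_def
  proof (intro conjI ballI impI)
    fix u assume u: "u \<in> ivecs m"
    have "herm m u y / c \<in> \<pp> 0"
      using herm_integral[OF u y] by (simp add: quot)
    then show "\<phi> u \<in> ivecs m"
      using u y unfolding ivecs_def \<phi>_def by (auto simp: \<pp>_diff \<pp>_mult_left simp del: times_divide_eq_right)
  next
    fix u v assume u: "u \<in> ivecs m" and v: "v \<in> ivecs m"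
    define a b where "a = herm m u y / c" and "b = herm m v y / c"
    have \<sigma>b: "\<sigma> b = herm m y v / \<sigma> c"
      by (simp add: b_def \<sigma>_divide \<sigma>_herm)
    have "herm m (\<phi> u) (\<phi> v) - herm m u v =
        a * \<sigma> b * herm m y y - a * herm m y v - \<sigma> b * herm m u y"
      unfolding \<phi>_def a_def[symmetric] b_def[symmetric]
        herm_diff_left herm_diff_right herm_scale_left herm_scale_right
      by (simp add: algebra_simps)
    also have "herm m y v = \<sigma> c * \<sigma> b"
      using \<sigma>c0 by (simp add: \<sigma>b)
    also have "herm m u y = c * a"
      using c0 by (simp add: a_def)
    finally have "herm m (\<phi> u) (\<phi> v) - herm m u v = a * \<sigma> b * (herm m y y - (c + \<sigma> c))"
      by (simp add: algebra_simps)
    moreover have "a \<in> \<pp> 0" "\<sigma> b \<in> \<pp> 0"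
      using u v y by (auto simp: a_def b_def quot herm_integral)
    ultimately show "herm m (\<phi> u) (\<phi> v) - herm m u v \<in> \<pp> k"
      using hyy by (simp add: \<pp>_mult_left)
  next
    fix u v assume u: "u \<in> ivecs m" and v: "v \<in> ivecs m" and uv: "vcong k (\<phi> u) (\<phi> v)"
    define d where "d = (\<lambda>i. u i - v i)"
    define s where "s = herm m d y / c"
    have d: "d \<in> ivecs m"
      using u v by (auto simp: ivecs_def d_def \<pp>_diff)
    have s0: "s \<in> \<pp> 0"
      using d y by (simp add: s_def quot herm_integral)
    have ds: "d i - y i * s \<in> \<pp> k" for i
    proof -
      have "\<phi> u i - \<phi> v i = d i - y i * s"
        unfolding \<phi>_def s_def d_def herm_diff_left by (simp add: diff_divide_distrib algebra_simps)
      then show ?thesis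
        using uv by (metis vcong_def)
    qed
    have "herm m (\<lambda>i. d i - y i * s) y \<in> \<pp> k"
      unfolding herm_def using ds y by (intro \<pp>_sum \<pp>_mult_right) (auto simp: ivecs_integral)
    then have "herm m d y - s * herm m y y \<in> \<pp> k"
      by (simp add: herm_diff_left herm_scale_left)
    moreover have "herm m d y = c * s"
      using c0 by (simp add: s_def)
    ultimately have "c * s - s * herm m y y \<in> \<pp> k"
      by simp
    then have "(c * s - s * herm m y y) + s * (herm m y y - (c + \<sigma> c)) \<in> \<pp> k"
      using s0 hyy by (intro \<pp>_add \<pp>_mult_left)
    also have "(c * s - s * herm m y y) + s * (herm m y y - (c + \<sigma> c)) = - (\<sigma> c * s)"
      by (simp add: algebra_simps)
    finally have "s \<in> \<pp> k"
      using w\<sigma>c \<pp>_unit_mult_iff by simp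
    then have "d i \<in> \<pp> k" for i
      using ds[of i] y \<pp>_add[OF ds[of i], of "y i * s"] by (simp add: \<pp>_mult_left ivecs_integral)
    then show "vcong k u v"
      by (simp add: vcong_def d_def)
  qed
  moreover have "\<phi> x = e"
    using c0 unfolding \<phi>_def c_def[symmetric] by (simp add: y_def)
  ultimately show ?thesis by blast
qed

lemma isometry_transpose:
  assumes "i < m" "j < m"
  shows "isometry k m (\<lambda>v. v \<circ> Transposition.transpose i j)"
proof -
  let ?t = "Transposition.transpose i j"
  have perm: "?t permutes {..<m}"
    using assms by (intro permutes_swap_id) auto
  have "v \<circ> ?t \<in> ivecs m" if "v \<in> ivecs m" for v
    using that assms by (auto simp: ivecs_def Transposition.transpose_def)
  moreover have "herm m (u \<circ> ?t) (v \<circ> ?t) = herm m u v" for u v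
    unfolding herm_def using sum.permute[OF perm, of "\<lambda>i. u i * \<sigma> (v i)"] by (simp add: comp_def)
  moreover have "vcong k u v" if "vcong k (u \<circ> ?t) (v \<circ> ?t)" for u v
    unfolding vcong_def
  proof
    fix n
    show "u n - v n \<in> \<pp> k"
      using that[unfolded vcong_def, rule_format, of "?t n"] by simp
  qed
  ultimately show ?thesis
    by (simp add: isometry_def)
qed

text \<open>
  The average over lists of \<open>n\<close> vectors, taken one vector at a time; the lists are the columns of an
  \<open>m \<times> n\<close> matrix.
\<close>

fun lmean :: "nat \<Rightarrow> nat \<Rightarrow> nat \<Rightarrow> ((nat \<Rightarrow> 'k) list \<Rightarrow> real) \<Rightarrow> real" where
  "lmean k m 0 f = f []"
| "lmean k m (Suc n) f = mean (vecs k m) (\<lambda>x. lmean k m n (\<lambda>xs. f (x # xs)))"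

lemma lmean_cong:
  "(\<And>xs. length xs = n \<Longrightarrow> set xs \<subseteq> vecs k m \<Longrightarrow> f xs = g xs) \<Longrightarrow> lmean k m n f = lmean k m n g"
proof (induction n arbitrary: f g)
  case (Suc n)
  show ?case
    by (simp, intro mean_cong Suc.IH Suc.prems) auto
qed simp

lemma lmean_cmult: "lmean k m n (\<lambda>xs. c * f xs) = c * lmean k m n f"
  by (induction n arbitrary: f) (simp_all add: mean_cmult)

lemma sum_lists_Suc:
  assumes "finite A"
  shows "(\<Sum>xs | length xs = Suc n \<and> set xs \<subseteq> A. f xs) =
    (\<Sum>x\<in>A. \<Sum>xs | length xs = n \<and> set xs \<subseteq> A. f (x # xs))"
proof -
  let ?L = "{xs. length xs = n \<and> set xs \<subseteq> A}"
  have fin: "finite ?L"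
    using finite_lists_length_eq[OF assms, of n] by (simp add: conj_commute)
  have "bij_betw (\<lambda>(x, xs). x # xs) (A \<times> ?L) {xs. length xs = Suc n \<and> set xs \<subseteq> A}"
    by (rule bij_betwI[where g = "\<lambda>xs. (hd xs, tl xs)"]) (auto simp: length_Suc_conv)
  then have "(\<Sum>xs | length xs = Suc n \<and> set xs \<subseteq> A. f xs) = (\<Sum>y\<in>A \<times> ?L. f (case y of (x, xs) \<Rightarrow> x # xs))"
    by (rule sum.reindex_bij_betw[symmetric])
  then show ?thesis
    using assms fin by (simp add: sum.cartesian_product case_prod_unfold)
qed

lemma sum_lists_eq_lmean:
  "(\<Sum>xs | length xs = n \<and> set xs \<subseteq> vecs k m. f xs) = real (p ^ 2) ^ (k * m * n) * lmean k m n f"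
proof (induction n arbitrary: f)
  case 0
  have "{xs. length xs = 0 \<and> set xs \<subseteq> vecs k m} = {[]}"
    by auto
  then show ?case
    by simp
next
  case (Suc n)
  show ?case
    unfolding sum_lists_Suc[OF finite_vecs] Suc.IH using p_gt_0
    by (simp add: mean_def card_vecs power_add mult.assoc flip: sum_distrib_left)
qed

definition lperiodic :: "nat \<Rightarrow> nat \<Rightarrow> nat \<Rightarrow> ((nat \<Rightarrow> 'k) list \<Rightarrow> real) \<Rightarrow> bool" where
  "lperiodic k m n f \<longleftrightarrow> (\<forall>xs ys. length xs = n \<longrightarrow> set xs \<subseteq> ivecs m \<longrightarrow> set ys \<subseteq> ivecs m \<longrightarrow>
    list_all2 (vcong k) xs ys \<longrightarrow> f xs = f ys)"

lemma lperiodic_Cons: "lperiodic k m (Suc n) f \<Longrightarrow> x \<in> ivecs m \<Longrightarrow> lperiodic k m n (\<lambda>xs. f (x # xs))"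
  by (simp add: lperiodic_def)

lemma periodic_lmean:
  assumes "lperiodic k m (Suc n) f" "vecs k m' \<subseteq> ivecs m"
  shows "periodic k m (\<lambda>x. lmean k m' n (\<lambda>xs. f (x # xs)))"
proof (rule periodicI, rule lmean_cong)
  fix x y xs
  assume "x \<in> ivecs m" "y \<in> ivecs m" "vcong k x y" "length xs = n" "set xs \<subseteq> vecs k m'"
  then show "f (x # xs) = f (y # xs)"
    using assms by (auto simp: lperiodic_def list.rel_refl)
qed

lemma vecs_subset_ivecs: "m' \<le> m \<Longrightarrow> vecs k m' \<subseteq> ivecs m"
  by (auto simp: vecs_def ivecs_def) (metis \<pp>_0 not_le reps_integral)

lemma lmean_change:
  assumes "isometry k m \<phi>" "lperiodic k m n f"
  shows "lmean k m n (\<lambda>xs. f (map \<phi> xs)) = lmean k m n f"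
  using assms(2)
proof (induction n arbitrary: f)
  case (Suc n)
  have "lmean k m (Suc n) (\<lambda>xs. f (map \<phi> xs)) = mean (vecs k m) (\<lambda>x. lmean k m n (\<lambda>xs. f (\<phi> x # xs)))"
    using Suc.IH[OF lperiodic_Cons[OF Suc.prems]] isometry_ivecs[OF assms(1) vecs_ivecs]
    by (simp cong: mean_cong)
  also have "\<dots> = mean (vecs k m) (\<lambda>x. lmean k m n (\<lambda>xs. f (x # xs)))"
    using assms(1) periodic_lmean[OF Suc.prems vecs_subset_ivecs]
    by (intro mean_vecs_change) (auto intro: isometryD)
  finally show ?case
    by simp
qed simp

lemma mean_vecs_last:
  assumes "j \<le> k" "periodic k (Suc m) f"
  shows "mean (vecs k (Suc m)) (\<lambda>x. of_bool (x m \<in> \<pp> j) * f x) =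
    mean (reps k) (\<lambda>c. mean (vecs k m) (\<lambda>x. f (x(m := of_nat p ^ j * c)))) / (real p ^ 2) ^ j"
proof -
  have "mean (vecs k (Suc m)) (\<lambda>x. of_bool (x m \<in> \<pp> j) * f x) =
      mean (reps k) (\<lambda>c. of_bool (c \<in> \<pp> j) * mean (vecs k m) (\<lambda>x. f (x(m := c))))"
    by (simp add: mean_vecs_Suc mean_cmult)
  also have "\<dots> = mean (reps k) (\<lambda>c. mean (vecs k m) (\<lambda>x. f (x(m := of_nat p ^ j * c)))) / (real p ^ 2) ^ j"
  proof (rule mean_reps_scale[OF assms(1)])
    fix c d assume "c \<in> \<pp> 0" "d \<in> \<pp> 0" "c - d \<in> \<pp> k"
    then show "mean (vecs k m) (\<lambda>x. f (x(m := c))) = mean (vecs k m) (\<lambda>x. f (x(m := d)))"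
      by (intro mean_cong periodicD[OF assms(2)] ivecs_upd vcong_upd) (auto simp: vecs_ivecs)
  qed
  finally show ?thesis .
qed

lemma lmean_last:
  assumes "lperiodic k (Suc m) n f"
  shows "lmean k (Suc m) n (\<lambda>xs. of_bool (\<forall>x\<in>set xs. x m \<in> \<pp> k) * f xs) =
    lmean k m n f / (real p ^ 2) ^ (k * n)"
  using assms
proof (induction n arbitrary: f)
  case (Suc n)
  let ?G = "\<lambda>x. lmean k m n (\<lambda>xs. f (x # xs))"
  have per: "periodic k (Suc m) ?G"
    by (rule periodic_lmean[OF Suc.prems vecs_subset_ivecs]) simp
  have "lmean k (Suc m) (Suc n) (\<lambda>xs. of_bool (\<forall>x\<in>set xs. x m \<in> \<pp> k) * f xs) =
      mean (vecs k (Suc m)) (\<lambda>x. of_bool (x m \<in> \<pp> k) * (?G x / (real p ^ 2) ^ (k * n)))"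
    unfolding lmean.simps
  proof (rule mean_cong)
    fix x assume "x \<in> vecs k (Suc m)"
    then have "lperiodic k (Suc m) n (\<lambda>xs. f (x # xs))"
      using lperiodic_Cons[OF Suc.prems] vecs_ivecs by blast
    from Suc.IH[OF this]
    show "lmean k (Suc m) n (\<lambda>xs. of_bool (\<forall>y\<in>set (x # xs). y m \<in> \<pp> k) * f (x # xs)) =
        of_bool (x m \<in> \<pp> k) * (?G x / (real p ^ 2) ^ (k * n))"
      by (simp add: of_bool_conj mult.assoc lmean_cmult)
  qed
  also have "\<dots> = mean (vecs k (Suc m)) (\<lambda>x. of_bool (x m \<in> \<pp> k) * ?G x) / (real p ^ 2) ^ (k * n)"
    using mean_cmult[of _ "1 / (real p ^ 2) ^ (k * n)"] by simp
  also have "mean (vecs k (Suc m)) (\<lambda>x. of_bool (x m \<in> \<pp> k) * ?G x) =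
      mean (reps k) (\<lambda>c. mean (vecs k m) (\<lambda>x. ?G (x(m := of_nat p ^ k * c)))) / (real p ^ 2) ^ k"
    by (rule mean_vecs_last[OF order_refl per])
  also have "mean (reps k) (\<lambda>c. mean (vecs k m) (\<lambda>x. ?G (x(m := of_nat p ^ k * c)))) =
      mean (reps k) (\<lambda>c. mean (vecs k m) ?G)"
  proof (intro mean_cong periodicD[OF per] ivecs_upd)
    fix c x assume c: "c \<in> reps k" and x: "x \<in> vecs k m"
    show "x \<in> ivecs (Suc m)"
      using x vecs_subset_ivecs[of m "Suc m" k] by auto
    show "of_nat p ^ k * c \<in> \<pp> 0"
      using c by (simp add: \<pp>_mult_left reps_integral)
    have "of_nat p ^ k * c \<in> \<pp> k"
      using c by (intro \<pp>_mult_right p_power_\<pp> reps_integral)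
    then show "vcong k (x(m := of_nat p ^ k * c)) x"
      using x by (auto simp: vcong_def vecs_def)
  qed (rule vecs_ivecs)
  finally show ?case
    by (simp add: mean_const power_add mult_ac)
qed simp

text \<open>
  Entries on one side of the diagonal suffice for a hermitian Gram matrix, and the recursive form
  isolates the first column.
\<close>

fun gram :: "nat \<Rightarrow> nat \<Rightarrow> 'k list \<Rightarrow> (nat \<Rightarrow> 'k) list \<Rightarrow> bool" where
  "gram k m [] [] = True"
| "gram k m (t # ts) (x # xs) \<longleftrightarrow>
    herm m x x - t \<in> \<pp> k \<and> (\<forall>y\<in>set xs. herm m y x \<in> \<pp> k) \<and> gram k m ts xs"
| "gram k m _ _ = False"

text \<open>
  The proportion of \<open>m \<times> n\<close> matrices modulo \<open>p^k\<close>, where \<open>n\<close> is the length of \<open>ts\<close>, that represent the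
  diagonal matrix of \<open>ts\<close>. For large \<open>k\<close> it is \<open>p\<close> to the power \<open>- k n^2\<close> times the representation density.
\<close>

definition dens :: "nat \<Rightarrow> nat \<Rightarrow> 'k list \<Rightarrow> real" where
  "dens k m ts = lmean k m (length ts) (\<lambda>xs. of_bool (gram k m ts xs))"

lemma gram_cong:
  assumes "list_all2 (vcong k) xs ys" "set xs \<subseteq> ivecs m" "set ys \<subseteq> ivecs m"
  shows "gram k m ts xs = gram k m ts ys"
  using assms
proof (induction arbitrary: ts rule: list_all2_induct)
  case (Cons x xs y ys)
  show ?case
  proof (cases ts)
    case (Cons t ts')
    have "(\<forall>z\<in>set xs. herm m z x \<in> \<pp> k) = (\<forall>z\<in>set ys. herm m z y \<in> \<pp> k)"
    proof -
      have "herm m (xs ! i) x \<in> \<pp> k \<longleftrightarrow> herm m (ys ! i) y \<in> \<pp> k" if "i < length xs" for i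
        using that Cons.hyps Cons.prems herm_in_\<pp>_cong[of "xs ! i" m "ys ! i" x y k 0]
        by (auto simp: list_all2_conv_all_nth subset_iff)
      then show ?thesis
        using list_all2_lengthD[OF Cons.hyps(2)] by (simp add: all_set_conv_all_nth)
    qed
    then show ?thesis
      using Cons.IH[of ts'] Cons.prems Cons.hyps \<open>ts = t # ts'\<close> herm_in_\<pp>_cong[of x m y x y k t]
      by auto
  qed simp
qed simp

lemma gram_isometry:
  assumes "isometry k m \<phi>" "set xs \<subseteq> ivecs m"
  shows "gram k m ts (map \<phi> xs) = gram k m ts xs"
  using assms(2)
proof (induction xs arbitrary: ts)
  case Nil
  then show ?case by (cases ts) auto
next
  case (Cons x xs)
  have "herm m (\<phi> y) (\<phi> x) \<in> \<pp> k \<longleftrightarrow> herm m y x \<in> \<pp> k" if "y \<in> set xs" for y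
    using isometryD(2)[OF assms(1), of y x] Cons.prems that \<pp>_cong by auto
  moreover have "herm m (\<phi> x) (\<phi> x) - t \<in> \<pp> k \<longleftrightarrow> herm m x x - t \<in> \<pp> k" for t
    using isometryD(2)[OF assms(1), of x x] Cons.prems
      \<pp>_cong[of "herm m (\<phi> x) (\<phi> x) - t" "herm m x x - t" k] by auto
  ultimately show ?case
    using Cons by (cases ts) auto
qed

lemma gram_Suc: "set xs \<subseteq> vecs k m \<Longrightarrow> gram k (Suc m) ts xs = gram k m ts xs"
proof (induction xs arbitrary: ts)
  case Nil
  then show ?case by (cases ts) auto
next
  case (Cons x xs)
  have "herm (Suc m) y x = herm m y x" if "y \<in> vecs k m" for y
    using that by (simp add: herm_def vecs_def)
  then have "herm (Suc m) y x = herm m y x" if "y \<in> set (x # xs)" for y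
    using that Cons.prems by blast
  then show ?case
    using Cons by (cases ts) auto
qed

text \<open>
  A vector of norm \<open>1\<close> can be moved to \<open>\<plusminus> 1\<close> times the last basis vector; the vectors orthogonal
  to it are then those whose last coordinate vanishes.
\<close>

lemma lmean_orthogonal_unit:
  assumes k: "k > 0" and x: "x \<in> ivecs (Suc m)" and hx: "herm (Suc m) x x - 1 \<in> \<pp> k"
  shows "lmean k (Suc m) (length ts)
      (\<lambda>xs. of_bool ((\<forall>y\<in>set xs. herm (Suc m) y x \<in> \<pp> k) \<and> gram k (Suc m) ts xs)) =
    dens k m ts / (real p ^ 2) ^ (k * length ts)"
proof -
  let ?h = "herm (Suc m)"
  define e :: "'k \<Rightarrow> nat \<Rightarrow> 'k" where "e \<epsilon> = (\<lambda>_. 0)(m := \<epsilon>)" for \<epsilon>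
  have e: "e \<epsilon> \<in> ivecs (Suc m)" if "\<epsilon> \<in> {1, - 1}" for \<epsilon>
    using that by (auto simp: e_def ivecs_def)
  have he: "?h y (e \<epsilon>) = y m * \<epsilon>" if "\<epsilon> \<in> {1, - 1}" for y \<epsilon>
    using that by (auto simp: herm_def e_def gal.hom_uminus)
  have hx1: "w (?h x x) = 1"
    using unit_cong[of "?h x x" 1] \<pp>_mono[of 1 k] k hx by auto
  obtain \<epsilon> where \<epsilon>: "\<epsilon> \<in> {1, - 1}" "w (x m - \<epsilon> * ?h x x) = 1"
    using exists_sign_unit[OF ivecs_integral[OF x] hx1] by blast
  have "w (?h x x - ?h x (e \<epsilon>)) = 1"
    using \<epsilon> he[OF \<epsilon>(1), of x] K.abs_diff_commute[of "x m" "?h x x"] by (auto simp: add.commute)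
  note \<epsilon> = \<epsilon>(1) this
  have "?h (e \<epsilon>) (e \<epsilon>) = 1"
    using he[OF \<epsilon>(1)] \<epsilon>(1) by (auto simp: e_def)
  then have "?h (e \<epsilon>) (e \<epsilon>) - ?h x x \<in> \<pp> k"
    using hx \<pp>_diff_commute by metis
  then obtain \<phi> where \<phi>: "isometry k (Suc m) \<phi>" "\<phi> x = e \<epsilon>"
    using exists_quasi_reflection[OF x e[OF \<epsilon>(1)]] \<epsilon>(2) by blast
  have hm: "?h y (e \<epsilon>) \<in> \<pp> j \<longleftrightarrow> y m \<in> \<pp> j" for y j
    using he[OF \<epsilon>(1)] \<epsilon>(1) by auto
  let ?f = "\<lambda>xs. of_bool (\<forall>y\<in>set xs. y m \<in> \<pp> k) * of_bool (gram k (Suc m) ts xs) :: real"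
  have gper: "lperiodic k (Suc m) n (\<lambda>xs. of_bool (gram k (Suc m) ts xs))" for n
    unfolding lperiodic_def by (intro allI impI arg_cong[of _ _ of_bool] gram_cong)
  have fper: "lperiodic k (Suc m) n ?f" for n
    unfolding lperiodic_def
  proof (intro allI impI)
    fix xs ys assume *: "list_all2 (vcong k) xs ys" "set xs \<subseteq> ivecs (Suc m)" "set ys \<subseteq> ivecs (Suc m)"
    have "(\<forall>y\<in>set xs. y m \<in> \<pp> k) = (\<forall>y\<in>set ys. y m \<in> \<pp> k)"
      using *(1)
    proof (induction rule: list_all2_induct)
      case (Cons x xs y ys)
      then show ?case
        using \<pp>_cong[of "x m" "y m" k] by (auto simp: vcong_def)
    qed simp
    then show "?f xs = ?f ys"
      using gram_cong[OF *] by simp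
  qed
  have "lmean k (Suc m) (length ts)
      (\<lambda>xs. of_bool ((\<forall>y\<in>set xs. ?h y x \<in> \<pp> k) \<and> gram k (Suc m) ts xs)) =
    lmean k (Suc m) (length ts) (\<lambda>xs. ?f (map \<phi> xs))"
  proof (rule lmean_cong)
    fix xs assume "set xs \<subseteq> vecs k (Suc m)"
    then have xs: "set xs \<subseteq> ivecs (Suc m)"
      using vecs_ivecs by blast
    have "?h y x \<in> \<pp> k \<longleftrightarrow> \<phi> y m \<in> \<pp> k" if "y \<in> set xs" for y
      using isometryD(2)[OF \<phi>(1), of y x] xs that x hm \<phi>(2) \<pp>_cong by (metis subsetD)
    then show "of_bool ((\<forall>y\<in>set xs. ?h y x \<in> \<pp> k) \<and> gram k (Suc m) ts xs) = ?f (map \<phi> xs)"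
      by (simp add: gram_isometry[OF \<phi>(1) xs] of_bool_conj)
  qed
  also have "\<dots> = lmean k (Suc m) (length ts) ?f"
    by (rule lmean_change[OF \<phi>(1) fper])
  also have "\<dots> = lmean k m (length ts) (\<lambda>xs. of_bool (gram k (Suc m) ts xs)) / (real p ^ 2) ^ (k * length ts)"
    by (rule lmean_last[OF gper])
  also have "lmean k m (length ts) (\<lambda>xs. of_bool (gram k (Suc m) ts xs)) = dens k m ts"
    unfolding dens_def by (rule lmean_cong) (simp add: gram_Suc)
  finally show ?thesis .
qed

lemma sum_\<chi>_1: "k > 0 \<Longrightarrow> (\<Sum>l\<le>k. c ^ l * \<chi> l 1) = 1 - c"
proof (induction k)
  case (Suc k)
  have "\<chi> (Suc k) 1 = - of_bool (k = 0)"
    using \<chi>_unit[of 1 "Suc k"] by simp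
  then show ?case
    using Suc by (cases "k = 0") (auto simp: \<chi>_def)
qed simp

text \<open>
  The first column has norm \<open>1\<close> with probability \<open>(1 - \<xi>^(m + 1)) / p^k\<close>, and whatever it is, the remaining
  columns then lie in its orthogonal complement, a unit lattice of rank \<open>m\<close>.
\<close>

lemma dens_unit:
  assumes "k > 0"
  shows "dens k (Suc m) (1 # ts) =
    (1 - \<xi> ^ Suc m) / real p ^ k * (dens k m ts / (real p ^ 2) ^ (k * length ts))"
proof -
  let ?C = "dens k m ts / (real p ^ 2) ^ (k * length ts)"
  have "dens k (Suc m) (1 # ts) =
      mean (vecs k (Suc m)) (\<lambda>x. of_bool (1 - herm (Suc m) x x \<in> \<pp> k) * ?C)"
    unfolding dens_def length_Cons lmean.simps
  proof (rule mean_cong)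
    fix x assume x: "x \<in> vecs k (Suc m)"
    show "lmean k (Suc m) (length ts) (\<lambda>xs. of_bool (gram k (Suc m) (1 # ts) (x # xs))) =
      of_bool (1 - herm (Suc m) x x \<in> \<pp> k) *
        (lmean k m (length ts) (\<lambda>xs. of_bool (gram k m ts xs)) / (real p ^ 2) ^ (k * length ts))"
    proof (cases "herm (Suc m) x x - 1 \<in> \<pp> k")
      case True
      then show ?thesis
        using lmean_orthogonal_unit[OF assms vecs_ivecs[OF x] True, of ts] \<pp>_diff_commute
        by (simp add: dens_def)
    next
      case False
      then show ?thesis
        using \<pp>_diff_commute[of 1 "herm (Suc m) x x" k] lmean_cmult[of k "Suc m" "length ts" 0 "\<lambda>_. 0"]
        by simp
    qed
  qed
  also have "\<dots> = ?C * mean (vecs k (Suc m)) (\<lambda>x. of_bool (1 - herm (Suc m) x x \<in> \<pp> k))"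
    by (simp only: mean_cmult[symmetric] mult.commute)
  also have "mean (vecs k (Suc m)) (\<lambda>x. of_bool (1 - herm (Suc m) x x \<in> \<pp> k)) =
      (1 - \<xi> ^ Suc m) / real p ^ k"
    by (simp only: mean_herm_eq[OF fixed_integer_1 order_refl] sum_\<chi>_1[OF assms])
  finally show ?thesis
    by (simp only: mult.commute)
qed

end

section \<open>Vectors orthogonal to a primitive vector\<close>

context odd_unramified_quadratic
begin

lemma \<chi>_p_power:
  assumes "x \<in> \<pp> 0" "j > 0"
  shows "\<chi> (a + j) (of_nat p ^ a * x) = real p ^ a * \<chi> j x"
proof (induction a)
  case (Suc a)
  have "\<chi> (Suc (a + j)) (of_nat p * (of_nat p ^ a * x)) = real p * \<chi> (a + j) (of_nat p ^ a * x)"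
    using assms by (subst \<chi>_p_mult) (auto simp: \<pp>_mult_left)
  then show ?case
    by (simp add: Suc mult.assoc)
qed simp

lemma mean_\<chi>_scaled_norm:
  assumes "a \<le> b" "l \<le> k"
  shows "mean (reps k) (\<lambda>c. \<chi> l (of_nat p ^ b - of_nat p ^ a * (c * \<sigma> c))) =
    \<xi> ^ (l - a) * \<chi> l (of_nat p ^ b)"
proof (cases "l \<le> a")
  case True
  have "\<chi> l (of_nat p ^ b - of_nat p ^ a * (c * \<sigma> c)) = \<chi> l (of_nat p ^ b)" if "c \<in> reps k" for c
  proof (rule \<chi>_cong)
    have "of_nat p ^ a * (c * \<sigma> c) \<in> \<pp> l"
      using that \<pp>_mono[OF True p_power_\<pp>] by (simp add: \<pp>_mult_right \<pp>_mult_left reps_integral)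
    then show "of_nat p ^ b - of_nat p ^ a * (c * \<sigma> c) - of_nat p ^ b \<in> \<pp> l"
      by simp
  qed
  then show ?thesis
    using True by (simp add: mean_const cong: mean_cong)
next
  case False
  define j where "j = l - a"
  have l: "l = a + j" "j > 0"
    using False by (auto simp: j_def)
  have pb: "of_nat p ^ b = (of_nat p ^ a * of_nat p ^ (b - a) :: 'k)"
    using assms(1) by (simp flip: power_add)
  have "\<chi> l (of_nat p ^ b - of_nat p ^ a * (c * \<sigma> c)) =
      real p ^ a * \<chi> j (of_nat p ^ (b - a) - c * \<sigma> c)" if "c \<in> reps k" for c
  proof -
    have "of_nat p ^ (b - a) - c * \<sigma> c \<in> \<pp> 0"
      using that by (simp add: \<pp>_diff \<pp>_mult_left reps_integral)
    then show ?thesis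
      using \<chi>_p_power[of _ j a] l by (simp add: pb right_diff_distrib[symmetric])
  qed
  then have "mean (reps k) (\<lambda>c. \<chi> l (of_nat p ^ b - of_nat p ^ a * (c * \<sigma> c))) =
      real p ^ a * mean (reps k) (\<lambda>c. \<chi> j (of_nat p ^ (b - a) - c * \<sigma> c))"
    unfolding mean_cmult[symmetric] by (intro mean_cong)
  also have "\<dots> = \<xi> ^ j * (real p ^ a * \<chi> j (of_nat p ^ (b - a)))"
    using assms(2) l by (simp add: mean_\<chi>_norm)
  also have "real p ^ a * \<chi> j (of_nat p ^ (b - a)) = \<chi> l (of_nat p ^ b)"
    unfolding pb l(1) using l(2) by (intro \<chi>_p_power[symmetric]) simp_all
  finally show ?thesis
    by (simp add: j_def)
qed

lemma abs_norm_parity: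
  assumes "t \<in> \<pp> 0" "odd (a + b)"
  shows "w (of_nat p ^ a * (t * \<sigma> t)) \<noteq> (1 / real p) ^ b"
proof (cases "t = 0")
  case True
  then show ?thesis
    using p_gt_0 by simp
next
  case False
  obtain s u where t: "t = of_nat p ^ s * u" "w u = 1"
    using unit_decomposition[OF assms(1) False] .
  have "w (of_nat p ^ a * (t * \<sigma> t)) = (1 / real p) ^ (a + 2 * s)"
    unfolding K.mult abs_\<sigma> by (simp add: t K.mult K.abs_p_power power_add mult_2)
  also have "\<dots> \<noteq> (1 / real p) ^ b"
  proof
    assume "(1 / real p) ^ (a + 2 * s) = (1 / real p) ^ b"
    then have "a + 2 * s = b"
      using p_gt_1 power_inject_exp'[of "1 / real p"] by simp
    then show False
      using assms(2) by auto
  qed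
  finally show ?thesis .
qed

text \<open>
  The vectors \<open>(t, d - t \<gamma>)\<close> of a plane will be those almost orthogonal to a vector of norm \<open>p^a\<close>; up to
  \<open>d\<close> and a unit norm their norms are \<open>p^a N t\<close>. Since \<open>a + b\<close> is odd,
  \<open>p^b - p^a N t\<close> is never divisible by \<open>p^(b + 1)\<close>. Hence all terms with \<open>l > b + 1\<close> vanish, and the
  perturbation \<open>d\<close> has no effect on the others.
\<close>

lemma mean_\<chi>_binary:
  assumes \<gamma>: "\<gamma> \<in> \<pp> 0" and \<beta>: "w \<beta> = 1" and d: "d \<in> \<pp> (Suc b)"
    and \<kappa>: "(1 + \<gamma> * \<sigma> \<gamma>) * (\<beta> * \<sigma> \<beta>) - of_nat p ^ a \<in> \<pp> (Suc b)"
    and ab: "a \<le> b" "odd (a + b)" and k: "Suc b \<le> k"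
  shows "mean (reps k) (\<lambda>t. \<Sum>l\<le>k. c ^ l * \<chi> l (of_nat p ^ b - t * \<sigma> t - (d - t * \<gamma>) * \<sigma> (d - t * \<gamma>))) =
    (\<Sum>l\<le>Suc b. c ^ l * (\<xi> ^ (l - a) * \<chi> l (of_nat p ^ b)))"
proof -
  define \<kappa>' where "\<kappa>' = 1 + \<gamma> * \<sigma> \<gamma>"
  define B where "B = \<beta> * \<sigma> \<beta>"
  let ?u = "\<lambda>t. of_nat p ^ b - t * \<sigma> t - (d - t * \<gamma>) * \<sigma> (d - t * \<gamma>)"
  have wB: "w B = 1"
    by (simp add: B_def K.mult \<beta>)
  have \<kappa>0: "\<kappa>' \<in> \<pp> 0"
    using \<gamma> by (simp add: \<kappa>'_def \<pp>_add \<pp>_mult_left)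
  have u: "?u t - (of_nat p ^ b - \<kappa>' * (t * \<sigma> t)) \<in> \<pp> (Suc b)" if "t \<in> \<pp> 0" for t
  proof -
    have "?u t - (of_nat p ^ b - \<kappa>' * (t * \<sigma> t)) = \<sigma> (t * \<gamma>) * d + (t * \<gamma> - d) * \<sigma> d"
      by (simp add: \<kappa>'_def gal.hom_minus gal.hom_mult algebra_simps)
    moreover have "t * \<gamma> - d \<in> \<pp> 0"
      using that \<gamma> \<pp>_integral[OF d] by (simp add: \<pp>_diff \<pp>_mult_left)
    ultimately show ?thesis
      using d that \<gamma> by (simp add: \<pp>_add \<pp>_mult_left)
  qed
  have Bu: "B * (of_nat p ^ b - \<kappa>' * s) - (B * of_nat p ^ b - of_nat p ^ a * s) \<in> \<pp> (Suc b)"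
    if "s \<in> \<pp> 0" for s
  proof -
    have "B * (of_nat p ^ b - \<kappa>' * s) - (B * of_nat p ^ b - of_nat p ^ a * s) =
        - ((\<kappa>' * B - of_nat p ^ a) * s)"
      by (simp add: algebra_simps)
    also have "\<dots> \<in> \<pp> (Suc b)"
      using \<kappa> that by (simp add: \<kappa>'_def B_def \<pp>_mult_right)
    finally show ?thesis .
  qed
  have u_notin: "?u t \<notin> \<pp> (Suc b)" if "t \<in> \<pp> 0" for t
  proof
    assume "?u t \<in> \<pp> (Suc b)"
    then have "B * (of_nat p ^ b - \<kappa>' * (t * \<sigma> t)) \<in> \<pp> (Suc b)"
      using \<pp>_cong[OF u[OF that]] wB by (simp add: \<pp>_unit_mult_iff)
    then have *: "B * of_nat p ^ b - of_nat p ^ a * (t * \<sigma> t) \<in> \<pp> (Suc b)"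
      using \<pp>_cong[OF Bu, of "t * \<sigma> t"] that by (simp add: \<pp>_mult_left)
    have wb: "w (B * of_nat p ^ b) = (1 / real p) ^ b"
      by (simp add: K.mult wB K.abs_p_power)
    have "(1 / real p) ^ Suc b < (1 / real p) ^ b"
      using p_gt_1 by (intro power_strict_decreasing) auto
    then have "w (- (B * of_nat p ^ b - of_nat p ^ a * (t * \<sigma> t))) < w (B * of_nat p ^ b)"
      using * unfolding in_\<pp>_iff wb K.abs_minus by linarith
    from K.abs_add_eq[OF this] have "w (of_nat p ^ a * (t * \<sigma> t)) = (1 / real p) ^ b"
      by (simp add: wb)
    then show False
      using abs_norm_parity[OF that ab(2)] by blast
  qed
  have "mean (reps k) (\<lambda>t. \<Sum>l\<le>k. c ^ l * \<chi> l (?u t)) = mean (reps k) (\<lambda>t. \<Sum>l\<le>Suc b. c ^ l * \<chi> l (?u t))"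
  proof (rule mean_cong)
    fix t assume "t \<in> reps k"
    then have t: "?u t \<notin> \<pp> (Suc b)"
      using u_notin reps_integral by blast
    have "\<chi> l (?u t) = 0" if "l > Suc b" for l
    proof -
      have "Suc b \<le> l" "Suc b \<le> l - 1"
        using that by auto
      then have "?u t \<notin> \<pp> l" "?u t \<notin> \<pp> (l - 1)"
        using t \<pp>_mono by blast+
      then show ?thesis
        using that by (simp add: \<chi>_def)
    qed
    then show "(\<Sum>l\<le>k. c ^ l * \<chi> l (?u t)) = (\<Sum>l\<le>Suc b. c ^ l * \<chi> l (?u t))"
      using k by (intro sum.mono_neutral_right) auto
  qed
  also have "\<dots> = (\<Sum>l\<le>Suc b. c ^ l * mean (reps k) (\<lambda>t. \<chi> l (?u t)))"
    by (simp only: mean_sum mean_cmult)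
  also have "\<dots> = (\<Sum>l\<le>Suc b. c ^ l * (\<xi> ^ (l - a) * \<chi> l (of_nat p ^ b)))"
  proof (intro sum.cong refl arg_cong2[of _ _ _ _ "(*)"])
    fix l assume "l \<in> {..Suc b}"
    then have l: "l \<le> Suc b" by simp
    have "mean (reps k) (\<lambda>t. \<chi> l (?u t)) = mean (reps k) (\<lambda>t. \<chi> l (of_nat p ^ b - \<kappa>' * (t * \<sigma> t)))"
      using \<pp>_mono[OF l u] by (intro mean_cong \<chi>_cong) (auto intro: reps_integral)
    also have "\<dots> = mean (reps k) (\<lambda>t. \<chi> l (of_nat p ^ b - \<kappa>' * ((\<beta> * t) * \<sigma> (\<beta> * t))))"
    proof (rule mean_reps_change[symmetric,
          where \<phi> = "(*) \<beta>" and g = "\<lambda>t. \<chi> l (of_nat p ^ b - \<kappa>' * (t * \<sigma> t))"])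
      show "x - y \<in> \<pp> k" if "\<beta> * x - \<beta> * y \<in> \<pp> k" for x y
        using that \<beta> by (simp add: \<pp>_unit_mult_iff flip: right_diff_distrib)
      show "\<chi> l (of_nat p ^ b - \<kappa>' * (x * \<sigma> x)) = \<chi> l (of_nat p ^ b - \<kappa>' * (y * \<sigma> y))"
        if xy: "x \<in> \<pp> 0" "y \<in> \<pp> 0" "x - y \<in> \<pp> k" for x y
      proof (rule \<chi>_cong)
        have "y * \<sigma> y - x * \<sigma> x \<in> \<pp> l"
          using norm_diff_in_\<pp>[OF xy] \<pp>_mono[of l k] l k \<pp>_diff_commute by (metis order_trans)
        then have "\<kappa>' * (y * \<sigma> y - x * \<sigma> x) \<in> \<pp> l"
          by (rule \<pp>_mult_left[OF \<kappa>0])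
        then show "of_nat p ^ b - \<kappa>' * (x * \<sigma> x) - (of_nat p ^ b - \<kappa>' * (y * \<sigma> y)) \<in> \<pp> l"
          by (simp add: right_diff_distrib)
      qed
    qed (simp add: \<beta> \<pp>_unit_mult_iff)
    also have "\<dots> = mean (reps k) (\<lambda>t. \<chi> l (of_nat p ^ b - of_nat p ^ a * (t * \<sigma> t)))"
    proof (intro mean_cong \<chi>_cong)
      fix t assume "t \<in> reps k"
      then have t: "t * \<sigma> t \<in> \<pp> 0"
        by (simp add: \<pp>_mult_left reps_integral)
      have "of_nat p ^ b - \<kappa>' * ((\<beta> * t) * \<sigma> (\<beta> * t)) - (of_nat p ^ b - of_nat p ^ a * (t * \<sigma> t)) =
          - ((\<kappa>' * B - of_nat p ^ a) * (t * \<sigma> t))"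
        by (simp add: B_def gal.hom_mult algebra_simps)
      also have "\<dots> \<in> \<pp> l"
        using \<pp>_mono[OF l \<kappa>] t by (simp add: \<kappa>'_def B_def \<pp>_mult_right)
      finally show "of_nat p ^ b - \<kappa>' * ((\<beta> * t) * \<sigma> (\<beta> * t)) - (of_nat p ^ b - of_nat p ^ a * (t * \<sigma> t)) \<in> \<pp> l" .
    qed
    also have "\<dots> = \<xi> ^ (l - a) * \<chi> l (of_nat p ^ b)"
      using ab(1) l k by (intro mean_\<chi>_scaled_norm) auto
    finally show "mean (reps k) (\<lambda>t. \<chi> l (?u t)) = \<xi> ^ (l - a) * \<chi> l (of_nat p ^ b)" .
  qed
  finally show ?thesis .
qed

text \<open>
  A primitive vector is moved into the span of the last two basis vectors, where modulo \<open>p^k\<close>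
  every fixed integer has the form \<open>N \<alpha> + N \<beta>\<close> with \<open>N \<beta> = \<plusminus> 1\<close> and \<open>\<alpha>\<close> a unit.
\<close>

lemma exists_isometry_to_plane:
  assumes x: "x \<in> ivecs (Suc (Suc r))" and j: "j < Suc (Suc r)" "w (x j) = 1" and k: "k > 0"
  obtains \<phi> \<alpha> \<beta> where "isometry k (Suc (Suc r)) \<phi>" "\<alpha> \<in> \<pp> 0" "w \<beta> = 1"
    "\<phi> x = (\<lambda>_. 0)(r := \<alpha>, Suc r := \<beta>)" "\<alpha> * \<sigma> \<alpha> + \<beta> * \<sigma> \<beta> - herm (Suc (Suc r)) x x \<in> \<pp> k"
proof -
  let ?m = "Suc (Suc r)"
  let ?h = "herm ?m"
  define \<pi> where "\<pi> = (\<lambda>v :: nat \<Rightarrow> 'k. v \<circ> Transposition.transpose j (Suc r))"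
  define t where "t = ?h x x"
  have \<pi>: "isometry n ?m \<pi>" for n
    unfolding \<pi>_def using j(1) by (intro isometry_transpose) auto
  have \<pi>x: "\<pi> x \<in> ivecs ?m"
    using isometry_ivecs[OF \<pi> x] .
  have \<pi>xr: "\<pi> x (Suc r) = x j"
    by (simp add: \<pi>_def)
  have t: "fixed_integer t" "t \<in> \<pp> 0"
    using fixed_integer_herm[OF x] by (auto simp: t_def fixed_integer_def)
  obtain \<nu> where \<nu>: "\<nu> \<in> {1, - 1}" "w (t - \<nu> * 1) = 1"
    using exists_sign_unit[OF t(2) K.abs_1] by blast
  have f\<nu>: "fixed_integer \<nu>" "w \<nu> = 1"
    using \<nu>(1) by (auto simp: fixed_integer_minus)
  obtain \<beta> where \<beta>: "w \<beta> = 1" "\<beta> * \<sigma> \<beta> - \<nu> \<in> \<pp> k"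
    using norm_surjective[OF f\<nu>] by blast
  obtain \<alpha> where \<alpha>: "w \<alpha> = 1" "\<alpha> * \<sigma> \<alpha> - (t - \<nu>) \<in> \<pp> k"
    using norm_surjective[of "t - \<nu>" k] fixed_integer_diff[OF t(1) f\<nu>(1)] \<nu>(2) by auto
  have \<alpha>0: "\<alpha> \<in> \<pp> 0" and \<beta>0: "\<beta> \<in> \<pp> 0"
    using \<alpha> \<beta> unit_integral by auto
  define e :: "'k \<Rightarrow> nat \<Rightarrow> 'k" where "e \<epsilon> = (\<lambda>_. 0)(r := \<alpha>, Suc r := \<epsilon> * \<beta>)" for \<epsilon>
  have \<epsilon>1: "\<epsilon> * \<sigma> \<epsilon> = 1" "w \<epsilon> = 1" "\<sigma> \<epsilon> = \<epsilon>" if "\<epsilon> \<in> {1, - 1}" for \<epsilon>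
    using that by (auto simp: gal.hom_uminus)
  have e: "e \<epsilon> \<in> ivecs ?m" if "\<epsilon> \<in> {1, - 1}" for \<epsilon>
    using that \<alpha>0 \<beta>0 by (auto simp: e_def ivecs_def)
  have he: "?h y (e \<epsilon>) = y r * \<sigma> \<alpha> + \<epsilon> * (y (Suc r) * \<sigma> \<beta>)" if "\<epsilon> \<in> {1, - 1}" for y \<epsilon>
    using \<epsilon>1[OF that] by (simp add: herm_def e_def gal.hom_mult mult_ac)
  have hee: "?h (e \<epsilon>) (e \<epsilon>) = \<alpha> * \<sigma> \<alpha> + \<beta> * \<sigma> \<beta>" if "\<epsilon> \<in> {1, - 1}" for \<epsilon>
    using he[OF that, of "e \<epsilon>"] \<epsilon>1[OF that] that by (auto simp: e_def)
  have "?h (\<pi> x) (\<pi> x) - \<pi> x r * \<sigma> \<alpha> \<in> \<pp> 0"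
    using \<pi>x \<alpha>0 by (simp add: \<pp>_diff \<pp>_mult_left herm_integral ivecs_integral)
  moreover have "w (\<pi> x (Suc r) * \<sigma> \<beta>) = 1"
    by (simp add: K.mult \<pi>xr j(2) \<beta>(1))
  ultimately obtain \<epsilon> where \<epsilon>: "\<epsilon> \<in> {1, - 1}"
    "w (?h (\<pi> x) (\<pi> x) - \<pi> x r * \<sigma> \<alpha> - \<epsilon> * (\<pi> x (Suc r) * \<sigma> \<beta>)) = 1"
    using exists_sign_unit by blast
  have "\<alpha> * \<sigma> \<alpha> + \<beta> * \<sigma> \<beta> - t = (\<alpha> * \<sigma> \<alpha> - (t - \<nu>)) + (\<beta> * \<sigma> \<beta> - \<nu>)"
    by simp
  then have norm: "\<alpha> * \<sigma> \<alpha> + \<beta> * \<sigma> \<beta> - t \<in> \<pp> k"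
    using \<pp>_add[OF \<alpha>(2) \<beta>(2)] by (simp only:)
  have "t - ?h (\<pi> x) (\<pi> x) \<in> \<pp> k"
    using isometryD(2)[OF \<pi> x x] \<pp>_diff_commute by (auto simp: t_def)
  then have "?h (e \<epsilon>) (e \<epsilon>) - ?h (\<pi> x) (\<pi> x) \<in> \<pp> k"
    using norm \<pp>_trans hee[OF \<epsilon>(1)] by metis
  moreover have "w (?h (\<pi> x) (\<pi> x) - ?h (\<pi> x) (e \<epsilon>)) = 1"
    using \<epsilon>(2) he[OF \<epsilon>(1)] by (simp add: diff_diff_eq)
  ultimately obtain \<phi> where \<phi>: "isometry k ?m \<phi>" "\<phi> (\<pi> x) = e \<epsilon>"
    using exists_quasi_reflection[OF \<pi>x e[OF \<epsilon>(1)]] by blast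
  show thesis
  proof (rule that)
    show "isometry k ?m (\<phi> \<circ> \<pi>)"
      by (rule isometry_comp[OF \<phi>(1) \<pi>])
    show "(\<phi> \<circ> \<pi>) x = (\<lambda>_. 0)(r := \<alpha>, Suc r := \<epsilon> * \<beta>)"
      using \<phi>(2) by (simp add: e_def)
    show "w (\<epsilon> * \<beta>) = 1"
      using \<epsilon>1[OF \<epsilon>(1)] \<beta>(1) by (simp add: K.mult)
    have "(\<epsilon> * \<beta>) * \<sigma> (\<epsilon> * \<beta>) = (\<epsilon> * \<sigma> \<epsilon>) * (\<beta> * \<sigma> \<beta>)"
      by (simp add: gal.hom_mult mult_ac)
    then show "\<alpha> * \<sigma> \<alpha> + (\<epsilon> * \<beta>) * \<sigma> (\<epsilon> * \<beta>) - ?h x x \<in> \<pp> k"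
      using norm by (simp only: \<epsilon>1(1)[OF \<epsilon>(1)] t_def mult_1)
  qed (rule \<alpha>0)
qed

text \<open>
  After moving \<open>x\<close> to \<open>(\<alpha>, \<beta>)\<close> in the last plane, orthogonality determines the last coordinate of \<open>y\<close>
  modulo \<open>p^(k - i)\<close>. The first \<open>r\<close> coordinates contribute the powers of \<open>\<xi>^r\<close>, and the remaining one ranges
  over the orthogonal complement of \<open>x\<close> in the plane, a line of norm \<open>p^a\<close>.
\<close>

lemma mean_orthogonal_primitive:
  assumes x: "x \<in> ivecs (Suc (Suc r))" and j: "j < Suc (Suc r)" "w (x j) = 1"
    and hx: "herm (Suc (Suc r)) x x - of_nat p ^ a \<in> \<pp> (Suc b)"
    and ab: "a \<le> b" "odd (a + b)" and ik: "i + Suc b \<le> k"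
  shows "mean (vecs k (Suc (Suc r))) (\<lambda>y. of_bool (herm (Suc (Suc r)) y x \<in> \<pp> (k - i)) *
      of_bool (of_nat p ^ b - herm (Suc (Suc r)) y y \<in> \<pp> k)) =
    (\<Sum>l\<le>Suc b. (\<xi> ^ r) ^ l * (\<xi> ^ (l - a) * \<chi> l (of_nat p ^ b))) / (real p ^ k * (real p ^ 2) ^ (k - i))"
proof -
  let ?m = "Suc (Suc r)"
  let ?h = "herm ?m"
  have k: "k > 0" "k - i \<le> k" "Suc b \<le> k" "Suc b \<le> k - i"
    using ik by auto
  obtain \<phi> \<alpha> \<beta> where \<phi>: "isometry k ?m \<phi>" and \<alpha>: "\<alpha> \<in> \<pp> 0" and \<beta>: "w \<beta> = 1"
    and \<phi>x: "\<phi> x = (\<lambda>_. 0)(r := \<alpha>, Suc r := \<beta>)"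
    and norm: "\<alpha> * \<sigma> \<alpha> + \<beta> * \<sigma> \<beta> - ?h x x \<in> \<pp> k"
    using exists_isometry_to_plane[OF x j k(1)] .
  define e where "e = \<phi> x"
  define \<gamma> where "\<gamma> = \<sigma> (\<alpha> / \<beta>)"
  define \<psi> where "\<psi> = (\<lambda>y :: nat \<Rightarrow> 'k. y(Suc r := y (Suc r) - y r * \<gamma>))"
  define f where "f y = (of_bool (?h y e \<in> \<pp> (k - i)) * of_bool (of_nat p ^ b - ?h y y \<in> \<pp> k) :: real)" for y
  define g where "g y = (of_bool (of_nat p ^ b - ?h (\<psi> y) (\<psi> y) \<in> \<pp> k) :: real)" for y
  have e: "e \<in> ivecs ?m"
    unfolding e_def by (rule isometry_ivecs[OF \<phi> x])
  have \<sigma>\<beta>0: "\<sigma> \<beta> \<noteq> 0"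
    using \<beta> abs_\<sigma>[of \<beta>] by (metis K.abs_0 zero_neq_one)
  have \<gamma>: "\<gamma> \<in> \<pp> 0"
    using \<alpha> \<beta> by (simp add: \<gamma>_def in_\<pp>_iff K.abs_divide)
  have he: "?h y e = \<sigma> \<beta> * (y (Suc r) + y r * \<gamma>)" for y
    unfolding e_def \<phi>x using \<sigma>\<beta>0 by (simp add: herm_def \<gamma>_def \<sigma>_divide field_simps)
  have fper: "periodic k ?m f"
  proof (rule periodicI)
    fix y z assume yz: "y \<in> ivecs ?m" "z \<in> ivecs ?m" "vcong k y z"
    have 1: "?h y e - ?h z e \<in> \<pp> (k - i)"
      using herm_cong[OF yz(1,2) e e yz(3) vcong_refl] k(2) by (rule \<pp>_mono[rotated])
    have 2: "(of_nat p ^ b - ?h y y) - (of_nat p ^ b - ?h z z) \<in> \<pp> k"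
      using herm_cong[OF yz(1,2) yz(1,2) yz(3,3)] \<pp>_diff_commute by simp
    show "f y = f z"
      unfolding f_def \<pp>_cong[OF 1] \<pp>_cong[OF 2] ..
  qed
  have \<psi>: "\<psi> y \<in> ivecs ?m" if "y \<in> ivecs ?m" for y
    using that \<gamma> ivecs_integral[OF that] by (auto simp: \<psi>_def ivecs_def \<pp>_diff \<pp>_mult_right)
  have \<psi>_cong: "vcong k (\<psi> y) (\<psi> z)" if "vcong k y z" for y z
  proof -
    have "y (Suc r) - y r * \<gamma> - (z (Suc r) - z r * \<gamma>) = (y (Suc r) - z (Suc r)) - (y r - z r) * \<gamma>"
      by (simp add: algebra_simps)
    also have "\<dots> \<in> \<pp> k"
      using that \<gamma> unfolding vcong_def by (intro \<pp>_diff[OF _ \<pp>_mult_right]) auto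
    finally have "y (Suc r) - y r * \<gamma> - (z (Suc r) - z r * \<gamma>) \<in> \<pp> k" .
    then show ?thesis
      using that by (simp add: vcong_def \<psi>_def)
  qed
  have \<psi>_inj: "vcong k y z" if "vcong k (\<psi> y) (\<psi> z)" for y z
    unfolding vcong_def
  proof
    fix n
    have yr: "y r - z r \<in> \<pp> k"
      using that unfolding vcong_def \<psi>_def by (metis fun_upd_apply n_not_Suc_n)
    have yr': "(y (Suc r) - y r * \<gamma>) - (z (Suc r) - z r * \<gamma>) \<in> \<pp> k"
      using that unfolding vcong_def \<psi>_def by (metis fun_upd_same)
    have "((y (Suc r) - y r * \<gamma>) - (z (Suc r) - z r * \<gamma>)) + (y r - z r) * \<gamma> \<in> \<pp> k"
      using yr yr' \<gamma> by (intro \<pp>_add \<pp>_mult_right)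
    then have "y (Suc r) - z (Suc r) \<in> \<pp> k"
      by (simp add: algebra_simps)
    moreover have "y n - z n \<in> \<pp> k" if "n \<noteq> Suc r"
      using \<open>vcong k (\<psi> y) (\<psi> z)\<close> that unfolding vcong_def \<psi>_def by (metis fun_upd_apply)
    ultimately show "y n - z n \<in> \<pp> k"
      by blast
  qed
  have gper: "periodic k ?m g"
  proof (rule periodicI)
    fix y z assume yz: "y \<in> ivecs ?m" "z \<in> ivecs ?m" "vcong k y z"
    have 1: "(of_nat p ^ b - ?h (\<psi> y) (\<psi> y)) - (of_nat p ^ b - ?h (\<psi> z) (\<psi> z)) \<in> \<pp> k"
      using herm_cong[of "\<psi> y" ?m "\<psi> z" "\<psi> y" "\<psi> z" k] yz \<psi> \<psi>_cong \<pp>_diff_commute by simp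
    show "g y = g z"
      unfolding g_def \<pp>_cong[OF 1] ..
  qed
  \<comment> \<open>\<open>\<phi>\<close> replaces \<open>x\<close> by \<open>e\<close>; the shear \<open>\<psi>\<close> makes orthogonality to \<open>e\<close> a condition on one coordinate\<close>
  have "mean (vecs k ?m) (\<lambda>y. of_bool (?h y x \<in> \<pp> (k - i)) * of_bool (of_nat p ^ b - ?h y y \<in> \<pp> k)) =
      mean (vecs k ?m) (\<lambda>y. f (\<phi> y))"
  proof (rule mean_cong)
    fix y assume "y \<in> vecs k ?m"
    then have y: "y \<in> ivecs ?m"
      by (rule vecs_ivecs)
    have 1: "?h (\<phi> y) e - ?h y x \<in> \<pp> (k - i)"
      unfolding e_def using isometryD(2)[OF \<phi> y x] k(2) by (rule \<pp>_mono[rotated])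
    have 2: "(of_nat p ^ b - ?h y y) - (of_nat p ^ b - ?h (\<phi> y) (\<phi> y)) \<in> \<pp> k"
      using isometryD(2)[OF \<phi> y y] by simp
    show "of_bool (?h y x \<in> \<pp> (k - i)) * of_bool (of_nat p ^ b - ?h y y \<in> \<pp> k) = f (\<phi> y)"
      unfolding f_def \<pp>_cong[OF 1] \<pp>_cong[OF 2] ..
  qed
  also have "\<dots> = mean (vecs k ?m) f"
    using \<phi> fper by (intro mean_vecs_change) (auto intro: isometryD isometry_ivecs)
  also have "\<dots> = mean (vecs k ?m) (\<lambda>y. f (\<psi> y))"
    using \<psi> \<psi>_inj fper by (intro mean_vecs_change[symmetric])
  also have "\<dots> = mean (vecs k ?m) (\<lambda>y. of_bool (y (Suc r) \<in> \<pp> (k - i)) * g y)"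
  proof (rule mean_cong)
    fix y
    have "?h (\<psi> y) e = \<sigma> \<beta> * y (Suc r)"
      by (simp add: he \<psi>_def)
    then have "?h (\<psi> y) e \<in> \<pp> (k - i) \<longleftrightarrow> y (Suc r) \<in> \<pp> (k - i)"
      using \<beta> by (simp add: \<pp>_unit_mult_iff)
    then show "f (\<psi> y) = of_bool (y (Suc r) \<in> \<pp> (k - i)) * g y"
      by (simp add: f_def g_def)
  qed
  also have "\<dots> = mean (reps k) (\<lambda>c. mean (vecs k (Suc r)) (\<lambda>y. g (y(Suc r := of_nat p ^ (k - i) * c))))
      / (real p ^ 2) ^ (k - i)"
    by (rule mean_vecs_last[OF k(2) gper])
  also have "mean (reps k) (\<lambda>c. mean (vecs k (Suc r)) (\<lambda>y. g (y(Suc r := of_nat p ^ (k - i) * c)))) =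
      mean (reps k) (\<lambda>_. (\<Sum>l\<le>Suc b. (\<xi> ^ r) ^ l * (\<xi> ^ (l - a) * \<chi> l (of_nat p ^ b))) / real p ^ k)"
  proof (rule mean_cong)
    fix c assume "c \<in> reps k"
    then have c: "c \<in> \<pp> 0"
      by (rule reps_integral)
    define d where "d = of_nat p ^ (k - i) * c"
    have d: "d \<in> \<pp> (Suc b)" "d \<in> \<pp> 0"
      using \<pp>_mono[OF k(4), of d] \<pp>_mult_right[OF p_power_\<pp> c, of "k - i"] \<pp>_integral
      by (auto simp: d_def)
    let ?u = "\<lambda>t. of_nat p ^ b - t * \<sigma> t - (d - t * \<gamma>) * \<sigma> (d - t * \<gamma>)"
    have g_eq: "g (z(r := t, Suc r := d)) = of_bool (?u t - herm r z z \<in> \<pp> k)" for z t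
    proof -
      have "\<psi> (z(r := t, Suc r := d)) = z(r := t, Suc r := d - t * \<gamma>)"
        by (auto simp: \<psi>_def)
      then show ?thesis
        by (simp add: g_def herm_Suc_upd algebra_simps)
    qed
    have fu: "fixed_integer (?u t)" if "t \<in> \<pp> 0" for t
      using that \<gamma> d by (intro fixed_integer_diff fixed_integer_norm) (auto simp: \<pp>_diff \<pp>_mult_left)
    have "mean (vecs k (Suc r)) (\<lambda>y. g (y(Suc r := d))) =
        mean (reps k) (\<lambda>t. mean (vecs k r) (\<lambda>z. of_bool (?u t - herm r z z \<in> \<pp> k)))"
      unfolding mean_vecs_Suc g_eq ..
    also have "\<dots> = mean (reps k) (\<lambda>t. 1 / real p ^ k * (\<Sum>l\<le>k. (\<xi> ^ r) ^ l * \<chi> l (?u t)))"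
      using mean_herm_eq[OF fu order_refl, of _ k r] by (intro mean_cong) (simp add: reps_integral)
    also have "\<dots> = 1 / real p ^ k * (\<Sum>l\<le>Suc b. (\<xi> ^ r) ^ l * (\<xi> ^ (l - a) * \<chi> l (of_nat p ^ b)))"
    proof -
      have "(1 + \<gamma> * \<sigma> \<gamma>) * (\<beta> * \<sigma> \<beta>) = \<alpha> * \<sigma> \<alpha> + \<beta> * \<sigma> \<beta>"
        using \<sigma>\<beta>0 by (simp add: \<gamma>_def \<sigma>_divide field_simps)
      moreover have "\<alpha> * \<sigma> \<alpha> + \<beta> * \<sigma> \<beta> - of_nat p ^ a \<in> \<pp> (Suc b)"
        using \<pp>_mono[OF k(3) norm] hx by (rule \<pp>_trans)
      ultimately have "(1 + \<gamma> * \<sigma> \<gamma>) * (\<beta> * \<sigma> \<beta>) - of_nat p ^ a \<in> \<pp> (Suc b)"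
        by simp
      then show ?thesis
        unfolding mean_cmult using mean_\<chi>_binary[OF \<gamma> \<beta> d(1) _ ab k(3)] by simp
    qed
    finally show "mean (vecs k (Suc r)) (\<lambda>y. g (y(Suc r := of_nat p ^ (k - i) * c))) =
        (\<Sum>l\<le>Suc b. (\<xi> ^ r) ^ l * (\<xi> ^ (l - a) * \<chi> l (of_nat p ^ b))) / real p ^ k"
      by (simp add: d_def)
  qed
  finally show ?thesis
    by (simp add: mean_const)
qed

end

section \<open>Two columns\<close>

context odd_unramified_quadratic
begin

text \<open>
  The factor \<open>p^(-2\<lceil>j/2\<rceil>)\<close>. With it the coefficients \<open>\<xi>^(l - a) \<chi> l p^b\<close> become differences of consecutive terms,
  which exhibits the factor \<open>1 - X\<close> of the density polynomial.
\<close>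

definition ceil_weight :: "nat \<Rightarrow> real" where
  "ceil_weight j = 1 / real p ^ (2 * ((j + 1) div 2))"

lemma power_p_in_\<pp>_iff: "of_nat p ^ e \<in> \<pp> j \<longleftrightarrow> j \<le> e"
  using p_gt_1 power_dvd_imp_le[of p j e] le_imp_power_dvd[of j e p]
  by (auto simp: \<pp>_of_nat_iff simp flip: of_nat_power)

lemma \<chi>_power_p: "\<chi> l (of_nat p ^ e) =
    of_bool (l \<le> e) * real p ^ l - of_bool (1 \<le> l \<and> l \<le> Suc e) * real p ^ (l - 1)"
  by (cases l) (auto simp: \<chi>_def power_p_in_\<pp>_iff)

lemma sum_telescope_factor:
  fixes c :: real
  shows "(\<Sum>l\<le>Suc n. c ^ l * (of_bool (l \<le> n) * f l - of_bool (1 \<le> l) * f (l - 1))) =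
    (1 - c) * (\<Sum>l\<le>n. c ^ l * f l)"
proof -
  have "(\<Sum>l\<le>Suc n. c ^ l * (of_bool (l \<le> n) * f l - of_bool (1 \<le> l) * f (l - 1))) =
      (\<Sum>l\<le>Suc n. c ^ l * (of_bool (l \<le> n) * f l)) - (\<Sum>l\<le>Suc n. c ^ l * (of_bool (1 \<le> l) * f (l - 1)))"
    by (simp only: right_diff_distrib sum_subtractf)
  also have "(\<Sum>l\<le>Suc n. c ^ l * (of_bool (l \<le> n) * f l)) = (\<Sum>l\<le>n. c ^ l * f l)"
    by simp
  also have "(\<Sum>l\<le>Suc n. c ^ l * (of_bool (1 \<le> l) * f (l - 1))) = c * (\<Sum>l\<le>n. c ^ l * f l)"
    by (subst sum.atMost_Suc_shift) (simp add: sum_distrib_left mult_ac)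
  finally show ?thesis
    by (simp add: algebra_simps)
qed

lemma sum_\<chi>_power_p:
  assumes "Suc e \<le> n"
  shows "(\<Sum>l\<le>n. c ^ l * \<chi> l (of_nat p ^ e)) = (1 - c) * (\<Sum>l\<le>e. (real p * c) ^ l)"
proof -
  have "(\<Sum>l\<le>n. c ^ l * \<chi> l (of_nat p ^ e)) = (\<Sum>l\<le>Suc e. c ^ l * \<chi> l (of_nat p ^ e))"
    using assms by (intro sum.mono_neutral_right) (auto simp: \<chi>_power_p)
  also have "\<dots> = (\<Sum>l\<le>Suc e. c ^ l * (of_bool (l \<le> e) * real p ^ l - of_bool (1 \<le> l) * real p ^ (l - 1)))"
    by (intro sum.cong) (auto simp: \<chi>_power_p)
  finally show ?thesis
    unfolding sum_telescope_factor by (simp add: power_mult_distrib mult.commute)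
qed

lemma \<xi>_power_even: "even j \<Longrightarrow> \<xi> ^ j = 1 / real p ^ j"
  by (simp add: \<xi>_def power_divide)

lemma \<xi>_power_odd: "odd j \<Longrightarrow> \<xi> ^ j = - (1 / real p ^ j)"
  by (simp add: \<xi>_def power_divide)

lemma sum_\<chi>_power_p_twisted:
  assumes "a \<le> b" "odd (a + b)"
  shows "(\<Sum>l\<le>Suc b. c ^ l * (\<xi> ^ (l - a) * \<chi> l (of_nat p ^ b))) =
    (1 - c) * (\<Sum>l\<le>b. (real p * c) ^ l * ceil_weight (l - a))"
proof -
  have "\<xi> ^ (l - a) * \<chi> l (of_nat p ^ b) = of_bool (l \<le> b) * (real p ^ l * ceil_weight (l - a)) -
      of_bool (1 \<le> l) * (real p ^ (l - 1) * ceil_weight (l - 1 - a))" if l: "l \<le> Suc b" for l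
  proof (cases "l \<le> a")
    case True
    then show ?thesis
      using assms(1) by (auto simp: \<chi>_power_p ceil_weight_def)
  next
    case False
    define j where "j = l - Suc a"
    have j: "l = Suc (a + j)"
      using False by (simp add: j_def)
    have la: "l - a = Suc j" "l - 1 - a = j"
      using j by auto
    show ?thesis
    proof (cases "even j")
      case True
      then have \<xi>j: "\<xi> ^ Suc j = - (1 / real p ^ Suc j)"
        by (intro \<xi>_power_odd) simp
      from True have Ej: "ceil_weight (Suc j) = 1 / real p ^ (j + 2)" "ceil_weight j = 1 / real p ^ j"
        by (auto simp: ceil_weight_def elim!: evenE)
      have "l \<le> b \<or> l = Suc b"
        using l by auto
      then show ?thesis
      proof
        assume "l \<le> b"
        then show ?thesis
          unfolding la \<xi>j Ej \<chi>_power_p using j p_gt_0 by (simp add: power_add field_simps)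
      next
        assume "l = Suc b"
        then have "a + b = 2 * a + j"
          using j by simp
        then show ?thesis
          using assms(2) True by simp
      qed
    next
      case False
      then obtain h where h: "j = 2 * h + 1"
        by (elim oddE)
      have Ej: "ceil_weight (Suc j) = 1 / real p ^ Suc j" "ceil_weight j = 1 / real p ^ Suc j"
        by (simp_all add: ceil_weight_def h)
      have \<xi>j: "\<xi> ^ Suc j = 1 / real p ^ Suc j"
        using False by (intro \<xi>_power_even) simp
      show ?thesis
        unfolding la \<xi>j Ej \<chi>_power_p using j l p_gt_0 by (auto simp: power_add field_simps)
    qed
  qed
  then have "(\<Sum>l\<le>Suc b. c ^ l * (\<xi> ^ (l - a) * \<chi> l (of_nat p ^ b))) =
      (\<Sum>l\<le>Suc b. c ^ l * (of_bool (l \<le> b) * (real p ^ l * ceil_weight (l - a)) -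
        of_bool (1 \<le> l) * (real p ^ (l - 1) * ceil_weight (l - 1 - a))))"
    by (intro sum.cong refl) simp
  also have "\<dots> = (1 - c) * (\<Sum>l\<le>b. c ^ l * (real p ^ l * ceil_weight (l - a)))"
    by (rule sum_telescope_factor[where f = "\<lambda>l. real p ^ l * ceil_weight (l - a)"])
  finally show ?thesis
    by (simp add: power_mult_distrib mult_ac)
qed

lemma herm_scale_p: "herm m y (\<lambda>n. of_nat p ^ i * x n) = of_nat p ^ i * herm m y x"
  by (simp add: herm_def gal.hom_mult gal.hom_power gal.hom_of_nat sum_distrib_left mult_ac)

lemma herm_self_scale_p:
  "herm m (\<lambda>n. of_nat p ^ i * x n) (\<lambda>n. of_nat p ^ i * x n) = of_nat p ^ (2 * i) * herm m x x"
  by (simp add: herm_def norm_scale sum_distrib_left)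

definition divisible :: "nat \<Rightarrow> (nat \<Rightarrow> 'k) \<Rightarrow> bool" where
  "divisible i x \<longleftrightarrow> (\<forall>n. x n \<in> \<pp> i)"

lemma divisible_herm_bound:
  assumes "divisible i x" "of_nat p ^ a - herm m x x \<in> \<pp> (Suc a)"
  shows "2 * i \<le> a"
proof (rule ccontr)
  assume "\<not> 2 * i \<le> a"
  have "herm m x x \<in> \<pp> (i + i)"
    unfolding herm_def using assms(1) by (intro \<pp>_sum \<pp>_mult) (auto simp: divisible_def)
  then have "herm m x x \<in> \<pp> (Suc a)"
    using \<open>\<not> 2 * i \<le> a\<close> by (intro \<pp>_mono[of "Suc a" "i + i"]) auto
  then have "of_nat p ^ a \<in> \<pp> (Suc a)"
    using assms(2) \<pp>_cong by blast
  then show False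
    by (simp add: power_p_in_\<pp>_iff)
qed

text \<open>
  Dividing \<open>x\<close> by \<open>p^i\<close> reduces to vectors of norm \<open>p^(a - 2i)\<close>, counted modulo \<open>p^(k - 2i)\<close>.
\<close>

lemma mean_divisible_herm_eq:
  assumes k: "a + 1 \<le> k"
  shows "real p ^ k * mean (vecs k (r + 2)) (\<lambda>x. of_bool (divisible i x) *
      of_bool (of_nat p ^ a - herm (r + 2) x x \<in> \<pp> k)) =
    of_bool (2 * i \<le> a) * ((\<xi> ^ r) ^ (2 * i) / real p ^ (2 * i) * (1 - \<xi> ^ r / (real p)\<^sup>2) *
      (\<Sum>l\<le>a - 2 * i. (\<xi> ^ r / real p) ^ l))"
proof (cases "2 * i \<le> a")
  case False
  have "of_bool (divisible i x) * of_bool (of_nat p ^ a - herm (r + 2) x x \<in> \<pp> k) = (0 :: real)" for x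
    using divisible_herm_bound[of i x a "r + 2"] \<pp>_mono[of "Suc a" k] k False by auto
  then show ?thesis
    using False by (simp only: mean_0) simp
next
  case True
  let ?m = "r + 2"
  let ?f = "\<lambda>x. of_bool (of_nat p ^ a - herm ?m x x \<in> \<pp> k) :: real"
  have per: "periodic k ?m ?f"
  proof (rule periodicI)
    fix x y assume xy: "x \<in> ivecs ?m" "y \<in> ivecs ?m" "vcong k x y"
    have 1: "(of_nat p ^ a - herm ?m x x) - (of_nat p ^ a - herm ?m y y) \<in> \<pp> k"
      using herm_cong[OF xy(1,2) xy(1,2) xy(3,3)] \<pp>_diff_commute by simp
    show "?f x = ?f y"
      unfolding \<pp>_cong[OF 1] ..
  qed
  have ik: "i \<le> k" "2 * i \<le> k"
    using True k by auto
  have "mean (vecs k ?m) (\<lambda>x. of_bool (divisible i x) * ?f x) =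
      mean (vecs k ?m) (\<lambda>x. ?f (\<lambda>n. of_nat p ^ i * x n)) / (real p ^ 2) ^ (i * ?m)"
    unfolding divisible_def by (rule mean_vecs_scale[OF ik(1) per])
  also have "mean (vecs k ?m) (\<lambda>x. ?f (\<lambda>n. of_nat p ^ i * x n)) =
      mean (vecs k ?m) (\<lambda>x. of_bool (of_nat p ^ (a - 2 * i) - herm ?m x x \<in> \<pp> (k - 2 * i)))"
  proof (rule mean_cong)
    fix x
    have "of_nat p ^ a = (of_nat p ^ (2 * i) * of_nat p ^ (a - 2 * i) :: 'k)"
      using True by (simp flip: power_add)
    then have "of_nat p ^ a - herm ?m (\<lambda>n. of_nat p ^ i * x n) (\<lambda>n. of_nat p ^ i * x n) =
        of_nat p ^ (2 * i) * (of_nat p ^ (a - 2 * i) - herm ?m x x)"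
      unfolding herm_self_scale_p by (simp add: right_diff_distrib)
    then show "?f (\<lambda>n. of_nat p ^ i * x n) =
        of_bool (of_nat p ^ (a - 2 * i) - herm ?m x x \<in> \<pp> (k - 2 * i))"
      using \<pp>_scale_iff'[OF ik(2)] by (simp only:)
  qed
  also have "\<dots> = (\<Sum>l\<le>k - 2 * i. (\<xi> ^ ?m) ^ l * \<chi> l (of_nat p ^ (a - 2 * i))) / real p ^ (k - 2 * i)"
    by (rule mean_herm_eq) auto
  also have "(\<Sum>l\<le>k - 2 * i. (\<xi> ^ ?m) ^ l * \<chi> l (of_nat p ^ (a - 2 * i))) =
      (1 - \<xi> ^ ?m) * (\<Sum>l\<le>a - 2 * i. (real p * \<xi> ^ ?m) ^ l)"
    using True k by (intro sum_\<chi>_power_p) auto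
  also have "\<xi> ^ ?m = \<xi> ^ r / (real p)\<^sup>2"
    using \<xi>_power_even[of 2] by (simp only: power_add) simp
  also have "real p * (\<xi> ^ r / (real p)\<^sup>2) = \<xi> ^ r / real p"
    using p_gt_0 by (simp add: power2_eq_square)
  finally have M: "mean (vecs k ?m) (\<lambda>x. of_bool (divisible i x) * ?f x) =
      (1 - \<xi> ^ r / (real p)\<^sup>2) * (\<Sum>l\<le>a - 2 * i. (\<xi> ^ r / real p) ^ l) / real p ^ (k - 2 * i)
        / (real p ^ 2) ^ (i * ?m)" .
  have pk: "real p ^ k = real p ^ (k - 2 * i) * real p ^ (2 * i)"
    using ik(2) by (simp flip: power_add)
  have q: "(real p ^ 2) ^ (i * ?m) = real p ^ (2 * i) * (real p ^ (2 * i) * real p ^ (2 * i * r))"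
    unfolding power_mult[symmetric] power_add[symmetric] by (intro arg_cong[of _ _ "(^) (real p)"]) simp
  have \<xi>r: "(\<xi> ^ r) ^ (2 * i) = 1 / real p ^ (2 * i * r)"
    unfolding power_mult[symmetric] by (subst \<xi>_power_even) (simp_all add: mult_ac)
  have cancel: "(u * y) * (D / u / (y * (y * z))) = 1 / z / y * D" if "u \<noteq> 0" "y \<noteq> 0" for u y z D :: real
    using that by simp
  show ?thesis
    unfolding M pk q \<xi>r using True cancel[of "real p ^ (k - 2 * i)" "real p ^ (2 * i)"] p_gt_0
    by (simp add: mult.assoc)
qed

lemma geometric_two_step:
  fixes Z :: real
  shows "(\<Sum>l\<le>n. Z ^ l) - of_bool (2 \<le> n) * (Z\<^sup>2 * (\<Sum>l\<le>n - 2. Z ^ l)) = 1 + of_bool (0 < n) * Z"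
proof -
  consider "n = 0" | "n = 1" | j where "n = Suc (Suc j)"
    by (metis One_nat_def not0_implies_Suc)
  then show ?thesis
  proof cases
    case (3 j)
    have "(\<Sum>l\<le>Suc (Suc j). Z ^ l) = 1 + (Z + Z\<^sup>2 * (\<Sum>l\<le>j. Z ^ l))"
      by (simp only: sum.atMost_Suc_shift) (simp add: sum_distrib_left power2_eq_square mult_ac)
    then show ?thesis
      using 3 by simp
  qed auto
qed

text \<open>
  Sorting the first column \<open>x\<close> by the exact power \<open>p^i\<close> dividing it. For \<open>x = p^i x\<^sub>0\<close> the second
  column is counted by \<open>mean_orthogonal_primitive\<close>, applied to \<open>x\<^sub>0\<close> of norm \<open>p^(a - 2i)\<close>.
\<close>

lemma dens_pair:
  fixes r :: nat and X :: real
  assumes ab: "a < b" "odd (a + b)" and k: "a + b + 2 \<le> k"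
  defines "X \<equiv> \<xi> ^ r"
  shows "real p ^ (4 * k) * dens k (r + 2) [of_nat p ^ a, of_nat p ^ b] =
    (1 - X) * (1 - X / (real p)\<^sup>2) * (\<Sum>i\<le>a div 2. X ^ (2 * i) * (1 + of_bool (2 * i < a) * (X / real p)) *
      (\<Sum>l\<le>b. (real p * X) ^ l * ceil_weight (l - (a - 2 * i))))"
proof -
  let ?m = "r + 2"
  let ?h = "herm ?m"
  have m: "?m = Suc (Suc r)" by simp
  define Y where "Y x = mean (vecs k ?m) (\<lambda>y. of_bool (?h y x \<in> \<pp> k) *
    of_bool (of_nat p ^ b - ?h y y \<in> \<pp> k))" for x
  define C where "C i = (1 - X) * (\<Sum>l\<le>b. (real p * X) ^ l * ceil_weight (l - (a - 2 * i)))" for i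
  define N where "N x = (of_bool (of_nat p ^ a - ?h x x \<in> \<pp> k) :: real)" for x
  define B where "B i = mean (vecs k ?m) (\<lambda>x. of_bool (divisible i x) * N x)" for i
  have Y: "Y x = (\<Sum>i\<le>a div 2. (of_bool (divisible i x) - of_bool (divisible (Suc i) x)) *
      (C i / (real p ^ k * (real p ^ 2) ^ (k - i))))"
    if x: "x \<in> vecs k ?m" and hx: "of_nat p ^ a - ?h x x \<in> \<pp> k" for x
  proof -
    have "of_nat p ^ a - ?h x x \<in> \<pp> (Suc a)"
      using k by (intro \<pp>_mono[OF _ hx]) simp
    note bound = divisible_herm_bound[OF _ this]
    have "\<not> divisible (Suc a) x"
      using bound[of "Suc a"] by auto
    moreover have "divisible 0 x"
      using ivecs_integral[OF vecs_ivecs[OF x]] by (simp add: divisible_def)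
    ultimately obtain i0 where i0: "divisible i0 x" "\<not> divisible (Suc i0) x"
      using nat_induct[of "\<lambda>i. divisible i x" "Suc a"] by blast
    have i0a: "2 * i0 \<le> a"
      by (rule bound[OF i0(1)])
    have mono: "divisible i x" if "i \<le> j" "divisible j x" for i j
      using that \<pp>_mono unfolding divisible_def by blast
    have ind: "of_bool (divisible i x) - of_bool (divisible (Suc i) x) = (of_bool (i = i0) :: real)" for i
    proof (cases i i0 rule: linorder_cases)
      case less
      then show ?thesis
        using mono[of i i0] mono[of "Suc i" i0] i0 by simp
    next
      case equal
      then show ?thesis
        using i0 by simp
    next
      case greater
      then show ?thesis
        using mono[of "Suc i0" i] mono[of "Suc i0" "Suc i"] i0 by auto
    qed
    define x0 where "x0 n = x n / of_nat p ^ i0" for n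
    have nz: "of_nat p ^ i0 \<noteq> (0 :: 'k)"
      using p_gt_0 by simp
    have xx0: "x = (\<lambda>n. of_nat p ^ i0 * x0 n)"
      using nz by (simp add: x0_def)
    have div0: "x0 n \<in> \<pp> j \<longleftrightarrow> x n \<in> \<pp> (i0 + j)" for n j
      using fun_cong[OF xx0, of n] \<pp>_scale_iff[of i0 "x0 n" j] by simp
    have x0: "x0 \<in> ivecs (Suc (Suc r))"
      using i0(1) div0[of _ 0] ivecs_zero[OF vecs_ivecs[OF x]]
      by (auto simp: ivecs_def divisible_def x0_def)
    obtain j where j: "x j \<notin> \<pp> (Suc i0)"
      using i0(2) by (auto simp: divisible_def)
    then have j2: "j < Suc (Suc r)"
      using ivecs_zero[OF vecs_ivecs[OF x], of j] by (cases "j < Suc (Suc r)") auto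
    have wj: "w (x0 j) = 1"
      using j div0[of j 1] ivecs_integral[OF x0] abs_eq_1_iff by simp
    have hx0: "?h x0 x0 - of_nat p ^ (a - 2 * i0) \<in> \<pp> (Suc b)"
    proof -
      have "of_nat p ^ a = (of_nat p ^ (2 * i0) * of_nat p ^ (a - 2 * i0) :: 'k)"
        using i0a by (simp flip: power_add)
      then have "of_nat p ^ a - ?h x x = of_nat p ^ (2 * i0) * (of_nat p ^ (a - 2 * i0) - ?h x0 x0)"
        unfolding xx0 herm_self_scale_p by (simp add: right_diff_distrib)
      then have "of_nat p ^ (a - 2 * i0) - ?h x0 x0 \<in> \<pp> (k - 2 * i0)"
        using hx \<pp>_scale_iff'[of "2 * i0" k] i0a k by simp
      then have "of_nat p ^ (a - 2 * i0) - ?h x0 x0 \<in> \<pp> (Suc b)"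
        using i0a k by (intro \<pp>_mono[of "Suc b" "k - 2 * i0"]) auto
      then show ?thesis
        using \<pp>_diff_commute by blast
    qed
    have "?h y x \<in> \<pp> k \<longleftrightarrow> ?h y x0 \<in> \<pp> (k - i0)" for y
      unfolding xx0 herm_scale_p using i0a k by (intro \<pp>_scale_iff') auto
    then have "Y x = mean (vecs k ?m) (\<lambda>y. of_bool (?h y x0 \<in> \<pp> (k - i0)) *
        of_bool (of_nat p ^ b - ?h y y \<in> \<pp> k))"
      by (simp add: Y_def)
    also have "\<dots> = (\<Sum>l\<le>Suc b. X ^ l * (\<xi> ^ (l - (a - 2 * i0)) * \<chi> l (of_nat p ^ b))) /
        (real p ^ k * (real p ^ 2) ^ (k - i0))"
      using mean_orthogonal_primitive[OF x0 j2 wj hx0[unfolded m], of i0 k] ab k i0a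
      unfolding X_def m by simp
    also have "(\<Sum>l\<le>Suc b. X ^ l * (\<xi> ^ (l - (a - 2 * i0)) * \<chi> l (of_nat p ^ b))) = C i0"
      unfolding C_def using ab i0a by (intro sum_\<chi>_power_p_twisted) auto
    finally have "Y x = C i0 / (real p ^ k * (real p ^ 2) ^ (k - i0))" .
    moreover have "(\<Sum>i\<le>a div 2. of_bool (i = i0) * G i) = G i0" for G :: "nat \<Rightarrow> real"
    proof -
      have "(\<Sum>i\<le>a div 2. of_bool (i = i0) * G i) = (\<Sum>i\<in>{i0}. of_bool (i = i0) * G i)"
        using i0a by (intro sum.mono_neutral_right) auto
      then show ?thesis by simp
    qed
    ultimately show ?thesis
      unfolding ind by (simp only:)
  qed
  have "dens k ?m [of_nat p ^ a, of_nat p ^ b] = mean (vecs k ?m) (\<lambda>x. N x * Y x)"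
  proof -
    have "lmean k ?m (Suc 0) (\<lambda>xs. of_bool (gram k ?m [of_nat p ^ a, of_nat p ^ b] (x # xs))) = N x * Y x" for x
      unfolding lmean.simps Y_def N_def mean_cmult[symmetric]
      by (intro mean_cong) (auto simp: \<pp>_diff_commute)
    then show ?thesis
      by (simp add: dens_def)
  qed
  also have "\<dots> = mean (vecs k ?m) (\<lambda>x. \<Sum>i\<le>a div 2. C i / (real p ^ k * (real p ^ 2) ^ (k - i)) *
      (of_bool (divisible i x) * N x - of_bool (divisible (Suc i) x) * N x))"
  proof (rule mean_cong)
    fix x assume x: "x \<in> vecs k ?m"
    have "N x * Y x = (\<Sum>i\<le>a div 2. N x * ((of_bool (divisible i x) - of_bool (divisible (Suc i) x)) *
        (C i / (real p ^ k * (real p ^ 2) ^ (k - i)))))"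
      using Y[OF x] by (auto simp: N_def sum_distrib_left)
    also have "\<dots> = (\<Sum>i\<le>a div 2. C i / (real p ^ k * (real p ^ 2) ^ (k - i)) *
        (of_bool (divisible i x) * N x - of_bool (divisible (Suc i) x) * N x))"
      by (intro sum.cong refl) (simp add: algebra_simps)
    finally show "N x * Y x = \<dots>" .
  qed
  also have "\<dots> = (\<Sum>i\<le>a div 2. C i / (real p ^ k * (real p ^ 2) ^ (k - i)) * (B i - B (Suc i)))"
    by (simp only: mean_sum mean_cmult mean_diff B_def)
  finally have "real p ^ (4 * k) * dens k ?m [of_nat p ^ a, of_nat p ^ b] =
      (\<Sum>i\<le>a div 2. real p ^ (4 * k) * (C i / (real p ^ k * (real p ^ 2) ^ (k - i)) * (B i - B (Suc i))))"
    by (simp add: sum_distrib_left)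
  also have "\<dots> = (\<Sum>i\<le>a div 2. (1 - X / (real p)\<^sup>2) * (X ^ (2 * i) *
      (1 + of_bool (2 * i < a) * (X / real p))) * C i)"
  proof (rule sum.cong[OF refl])
    fix i assume "i \<in> {..a div 2}"
    then have i: "2 * i \<le> a" by auto
    define D where "D = 1 - X / (real p)\<^sup>2"
    define S where "S n = (\<Sum>l\<le>n. (X / real p) ^ l)" for n
    have Bi: "real p ^ k * B j = of_bool (2 * j \<le> a) * (X ^ (2 * j) / real p ^ (2 * j) * D * S (a - 2 * j))" for j
      using mean_divisible_herm_eq[of a k r j] k unfolding B_def N_def X_def D_def S_def by simp
    have p4: "real p ^ (4 * k) = (real p ^ k * (real p ^ 2) ^ (k - i)) * (real p ^ (2 * i) * real p ^ k)"
    proof -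
      have "4 * k = k + 2 * (k - i) + (2 * i + k)"
        using i k by simp
      then show ?thesis
        by (simp only: power_add power_mult)
    qed
    have nz: "real p ^ k * (real p ^ 2) ^ (k - i) \<noteq> 0"
      using p_gt_0 by simp
    have "real p ^ (4 * k) * (C i / (real p ^ k * (real p ^ 2) ^ (k - i)) * (B i - B (Suc i))) =
        C i * (real p ^ (2 * i) * (real p ^ k * B i - real p ^ k * B (Suc i)))"
    proof -
      have "(u * (s * t)) * (c / u * (x - y)) = c * (s * (t * x - t * y))" if "u \<noteq> 0" for u s t c x y :: real
        using that by (simp add: field_simps)
      then show ?thesis
        unfolding p4 using nz by blast
    qed
    also have "real p ^ (2 * i) * (real p ^ k * B i - real p ^ k * B (Suc i)) =
        D * (X ^ (2 * i) * (S (a - 2 * i) - of_bool (2 \<le> a - 2 * i) * ((X / real p)\<^sup>2 * S (a - 2 * i - 2))))"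
    proof -
      have "2 * Suc i \<le> a \<longleftrightarrow> 2 \<le> a - 2 * i" "a - 2 * Suc i = a - 2 * i - 2"
        using i by auto
      then show ?thesis
        unfolding Bi using i p_gt_0 by (simp add: field_simps power2_eq_square)
    qed
    also have "S (a - 2 * i) - of_bool (2 \<le> a - 2 * i) * ((X / real p)\<^sup>2 * S (a - 2 * i - 2)) =
        1 + of_bool (2 * i < a) * (X / real p)"
      unfolding S_def geometric_two_step by simp
    finally show "real p ^ (4 * k) * (C i / (real p ^ k * (real p ^ 2) ^ (k - i)) * (B i - B (Suc i))) =
        (1 - X / (real p)\<^sup>2) * (X ^ (2 * i) * (1 + of_bool (2 * i < a) * (X / real p))) * C i"
      by (simp add: D_def mult_ac)
  qed
  finally show ?thesis
    unfolding C_def by (simp add: sum_distrib_left mult_ac)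
qed

lemma dens_replicate_unit:
  assumes "k > 0"
  shows "real p ^ (k * (s + length ts)\<^sup>2) * dens k (m + s) (replicate s 1 @ ts) =
    (\<Prod>j=1..s. 1 - \<xi> ^ (m + j)) * (real p ^ (k * (length ts)\<^sup>2) * dens k m ts)"
proof (induction s)
  case (Suc s)
  let ?n = "s + length ts"
  let ?d = "dens k (m + s) (replicate s 1 @ ts)"
  have "k * (Suc s + length ts)\<^sup>2 = k * ?n\<^sup>2 + k + 2 * (k * ?n)"
    by (simp add: power2_eq_square algebra_simps)
  then have pw: "real p ^ (k * (Suc s + length ts)\<^sup>2) = real p ^ (k * ?n\<^sup>2) * real p ^ k * (real p ^ 2) ^ (k * ?n)"
    by (simp only: power_add power_mult)
  have dd: "dens k (m + Suc s) (replicate (Suc s) 1 @ ts) =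
      (1 - \<xi> ^ (m + Suc s)) / real p ^ k * (?d / (real p ^ 2) ^ (k * ?n))"
    using dens_unit[OF assms, of "m + s" "replicate s 1 @ ts"] by simp
  have "real p ^ (k * (Suc s + length ts)\<^sup>2) * dens k (m + Suc s) (replicate (Suc s) 1 @ ts) =
      (1 - \<xi> ^ (m + Suc s)) * (real p ^ (k * ?n\<^sup>2) * ?d)"
    unfolding pw dd using p_gt_0 by simp
  then show ?case
    unfolding Suc.IH by (simp add: mult_ac)
qed simp

end

section \<open>From matrices to lists of columns\<close>

definition diag_of_list :: "'b::zero list \<Rightarrow> 'b mat" where
  "diag_of_list ts = mat (length ts) (length ts) (\<lambda>(i, j). if i = j then ts ! i else 0)"

lemma dim_diag_of_list [simp]:
  "dim_row (diag_of_list ts) = length ts" "dim_col (diag_of_list ts) = length ts"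
  by (simp_all add: diag_of_list_def)

lemma one_mat_eq_diag_of_list: "1\<^sub>m n = diag_of_list (replicate n 1)"
  by (rule eq_matI) (auto simp: diag_of_list_def)

context odd_unramified_quadratic
begin

lemma integer_ring_eq: "integer_ring w = \<pp> 0"
  by (auto simp: integer_ring_def in_\<pp>_iff)

lemma ppow_ideal_eq: "ppow_ideal p w k = \<pp> k"
proof (intro equalityI subsetI)
  fix x assume "x \<in> ppow_ideal p w k"
  then show "x \<in> \<pp> k"
    using \<pp>_mult_right[OF p_power_\<pp>] by (auto simp: ppow_ideal_def integer_ring_eq)
next
  fix x assume "x \<in> \<pp> k"
  then show "x \<in> ppow_ideal p w k"
    using \<pp>_scaleE[of x k 0] by (auto simp: ppow_ideal_def integer_ring_eq)
qed

lemma residue_class_eq_iff: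
  assumes "x \<in> \<pp> 0" "y \<in> \<pp> 0"
  shows "residue_class p w k x = residue_class p w k y \<longleftrightarrow> x - y \<in> \<pp> k"
proof
  assume "residue_class p w k x = residue_class p w k y"
  moreover have "x \<in> residue_class p w k x"
    using assms by (simp add: residue_class_def integer_ring_eq ppow_ideal_eq)
  ultimately show "x - y \<in> \<pp> k"
    by (simp add: residue_class_def ppow_ideal_eq)
next
  assume xy: "x - y \<in> \<pp> k"
  have "z - x \<in> \<pp> k \<longleftrightarrow> z - y \<in> \<pp> k" for z
    using xy \<pp>_trans \<pp>_diff_commute by metis
  then show "residue_class p w k x = residue_class p w k y"
    by (simp add: residue_class_def ppow_ideal_eq)
qed

lemma herm_in_\<pp>_commute: "herm m x y \<in> \<pp> k \<longleftrightarrow> herm m y x \<in> \<pp> k"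
  using \<pp>_\<sigma>_iff[of "herm m x y" k] by (simp add: \<sigma>_herm)

lemma gram_iff:
  assumes "length xs = length ts"
  shows "gram k m ts xs \<longleftrightarrow> (\<forall>i<length ts. \<forall>j<length ts.
    herm m (xs ! i) (xs ! j) - (if i = j then ts ! i else 0) \<in> \<pp> k)"
  using assms
proof (induction ts arbitrary: xs)
  case (Cons t ts)
  then obtain x ys where xs: "xs = x # ys" "length ys = length ts"
    by (cases xs) auto
  have "(\<forall>y\<in>set ys. herm m y x \<in> \<pp> k) \<longleftrightarrow> (\<forall>i<length ts. herm m (ys ! i) x \<in> \<pp> k)"
    using xs(2) by (simp add: all_set_conv_all_nth)
  moreover have "herm m x (ys ! i) \<in> \<pp> k \<longleftrightarrow> herm m (ys ! i) x \<in> \<pp> k" for i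
    by (rule herm_in_\<pp>_commute)
  ultimately show ?case
    using Cons.IH[OF xs(2)] unfolding xs(1) by (simp add: All_less_Suc2) blast
qed simp

definition col_vec :: "'k mat \<Rightarrow> nat \<Rightarrow> nat \<Rightarrow> 'k" where
  "col_vec x j = (\<lambda>i. if i < dim_row x then x $$ (i, j) else 0)"

lemma herm_form_index:
  assumes "x \<in> carrier_mat m n" "i < n" "j < n"
  shows "herm_form \<sigma> (1\<^sub>m m) x $$ (i, j) = herm m (col_vec x i) (col_vec x j)"
  using assms by (auto simp: herm_form_def herm_def col_vec_def scalar_prod_def lessThan_atLeast0
      intro!: sum.cong)

lemma solution_iff_gram:
  assumes x: "x \<in> carrier_mat m (length ts)"
  shows "elements_mat (herm_form \<sigma> (1\<^sub>m m) x - diag_of_list ts) \<subseteq> ppow_ideal p w k \<longleftrightarrow>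
    gram k m ts (map (col_vec x) [0..<length ts])"
proof -
  let ?n = "length ts"
  let ?D = "herm_form \<sigma> (1\<^sub>m m) x - diag_of_list ts"
  have D: "?D \<in> carrier_mat ?n ?n"
    using x by (auto simp: herm_form_def)
  have "elements_mat ?D \<subseteq> ppow_ideal p w k \<longleftrightarrow> (\<forall>i<?n. \<forall>j<?n. ?D $$ (i, j) \<in> \<pp> k)"
    unfolding ppow_ideal_eq using D elements_matD[of _ ?D] elements_matI[OF D] by fastforce
  also have "\<dots> \<longleftrightarrow> gram k m ts (map (col_vec x) [0..<?n])"
  proof -
    have "?D $$ (i, j) = herm m (col_vec x i) (col_vec x j) - (if i = j then ts ! i else 0)"
      if "i < ?n" "j < ?n" for i j
      using that herm_form_index[OF x that] by (simp add: diag_of_list_def)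
    then show ?thesis
      by (simp add: gram_iff)
  qed
  finally show ?thesis .
qed

lemma card_rep_set:
  "real (card (rep_set p w \<sigma> k (1\<^sub>m m) (diag_of_list ts))) =
    real (p ^ 2) ^ (k * m * length ts) * dens k m ts"
proof -
  let ?n = "length ts"
  define L where "L = {xs. length xs = ?n \<and> set xs \<subseteq> vecs k m}"
  define G where "G = {xs \<in> L. gram k m ts xs}"
  define M :: "(nat \<Rightarrow> 'k) list \<Rightarrow> 'k mat" where "M xs = mat m ?n (\<lambda>(i, j). (xs ! j) i)" for xs
  let ?R = "map_mat (residue_class p w k)"
  define Sol where "Sol = {x \<in> carrier_mat m ?n. elements_mat x \<subseteq> integer_ring w \<and>
        elements_mat (herm_form \<sigma> (1\<^sub>m m) x - diag_of_list ts) \<subseteq> ppow_ideal p w k}"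
  have rep: "rep_set p w \<sigma> k (1\<^sub>m m) (diag_of_list ts) = ?R ` Sol"
    by (simp add: rep_set_def Sol_def)
  have M: "M xs \<in> carrier_mat m ?n" for xs
    by (simp add: M_def)
  have cols: "map (col_vec (M xs)) [0..<?n] = xs" if "xs \<in> L" for xs
  proof (rule nth_equalityI)
    show "length (map (col_vec (M xs)) [0..<?n]) = length xs"
      using that by (simp add: L_def)
    fix j assume "j < length (map (col_vec (M xs)) [0..<?n])"
    then have j: "j < ?n" by simp
    then have "xs ! j \<in> vecs k m"
      using that by (auto simp: L_def)
    then show "map (col_vec (M xs)) [0..<?n] ! j = xs ! j"
      using j by (auto simp: col_vec_def M_def vecs_def fun_eq_iff)
  qed
  have int_elems: "elements_mat x \<subseteq> integer_ring w \<longleftrightarrow> (\<forall>i<m. \<forall>j<?n. x $$ (i, j) \<in> \<pp> 0)"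
    if x: "x \<in> carrier_mat m ?n" for x
    unfolding integer_ring_eq using x elements_matD[of _ x] elements_matI[OF x] by fastforce
  have vec: "xs ! j \<in> vecs k m" if "xs \<in> L" "j < ?n" for xs j
    using that by (auto simp: L_def)
  have R_eq: "?R x = ?R y \<longleftrightarrow> (\<forall>i<m. \<forall>j<?n. x $$ (i, j) - y $$ (i, j) \<in> \<pp> k)"
    if x: "x \<in> carrier_mat m ?n" "elements_mat x \<subseteq> integer_ring w"
      and y: "y \<in> carrier_mat m ?n" "elements_mat y \<subseteq> integer_ring w" for x y
  proof -
    have "?R x = ?R y \<longleftrightarrow> (\<forall>i<m. \<forall>j<?n. residue_class p w k (x $$ (i, j)) = residue_class p w k (y $$ (i, j)))"
      using x(1) y(1) by (auto simp: mat_eq_iff)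
    then show ?thesis
      using residue_class_eq_iff x y int_elems by (metis (no_types, lifting))
  qed
  have M_int: "elements_mat (M xs) \<subseteq> integer_ring w" if "xs \<in> L" for xs
    unfolding int_elems[OF M] using vec[OF that] by (auto simp: M_def vecs_def intro: reps_integral)
  have "bij_betw (\<lambda>xs. ?R (M xs)) G (rep_set p w \<sigma> k (1\<^sub>m m) (diag_of_list ts))"
  proof (rule bij_betw_imageI)
    show "inj_on (\<lambda>xs. ?R (M xs)) G"
    proof (rule inj_onI)
      fix xs ys assume xs: "xs \<in> G" and ys: "ys \<in> G" and eq: "?R (M xs) = ?R (M ys)"
      have L: "xs \<in> L" "ys \<in> L"
        using xs ys by (auto simp: G_def)
      have "M xs $$ (i, j) = M ys $$ (i, j)" if ij: "i < m" "j < ?n" for i j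
      proof -
        have "M xs $$ (i, j) - M ys $$ (i, j) \<in> \<pp> k"
          using eq R_eq[OF M M_int[OF L(1)] M M_int[OF L(2)]] ij by blast
        then have "(xs ! j) i - (ys ! j) i \<in> \<pp> k"
          using ij by (simp add: M_def)
        moreover have "(xs ! j) i \<in> reps k" "(ys ! j) i \<in> reps k"
          using vec[OF L(1) ij(2)] vec[OF L(2) ij(2)] ij(1) by (simp_all add: vecs_def)
        ultimately have "(xs ! j) i = (ys ! j) i"
          using reps_eqI by blast
        then show ?thesis
          using ij by (simp add: M_def)
      qed
      then have "M xs = M ys"
        by (intro eq_matI) (auto simp: M_def)
      then have "map (col_vec (M xs)) [0..<?n] = map (col_vec (M ys)) [0..<?n]"
        by (rule arg_cong)
      then show "xs = ys"
        by (simp only: cols[OF L(1)] cols[OF L(2)])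
    qed
    show "(\<lambda>xs. ?R (M xs)) ` G = rep_set p w \<sigma> k (1\<^sub>m m) (diag_of_list ts)"
      unfolding rep
    proof (intro equalityI subsetI)
      fix z assume "z \<in> (\<lambda>xs. ?R (M xs)) ` G"
      then obtain xs where xs: "xs \<in> L" "gram k m ts xs" "z = ?R (M xs)"
        by (auto simp: G_def)
      have "M xs \<in> Sol"
        unfolding Sol_def using xs M M_int[OF xs(1)] solution_iff_gram[OF M[of xs]] cols[OF xs(1)] by simp
      then show "z \<in> ?R ` Sol"
        using xs by blast
    next
      fix z assume "z \<in> ?R ` Sol"
      then obtain x where x: "x \<in> Sol" "z = ?R x" by blast
      then have xc: "x \<in> carrier_mat m ?n" and xi: "elements_mat x \<subseteq> integer_ring w"
        by (auto simp: Sol_def)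
      have gx: "gram k m ts (map (col_vec x) [0..<?n])"
        using x(1) solution_iff_gram[OF xc] by (simp add: Sol_def)
      have ent: "x $$ (i, j) \<in> \<pp> 0" if "i < m" "j < ?n" for i j
        using xi int_elems[OF xc] that by blast
      define xs where "xs = map (\<lambda>j i. red k (col_vec x j i)) [0..<?n]"
      have col_int: "col_vec x j \<in> ivecs m" if "j < ?n" for j
        using ent[OF _ that] xc by (auto simp: col_vec_def ivecs_def)
      have L: "xs \<in> L"
        using col_int by (auto simp: xs_def L_def vecs_def ivecs_def)
      have "list_all2 (vcong k) xs (map (col_vec x) [0..<?n])"
        by (simp add: xs_def list_all2_conv_all_nth vcong_def red_cong)
      moreover have "set xs \<subseteq> ivecs m"
        using L vecs_ivecs by (auto simp: L_def)
      moreover have "set (map (col_vec x) [0..<?n]) \<subseteq> ivecs m"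
        using col_int by auto
      ultimately have "gram k m ts xs"
        using gram_cong gx by blast
      moreover have "?R x = ?R (M xs)"
        unfolding R_eq[OF xc xi M M_int[OF L]]
      proof (intro allI impI)
        fix i j assume ij: "i < m" "j < ?n"
        have "M xs $$ (i, j) = red k (x $$ (i, j))"
          using ij xc by (simp add: M_def xs_def col_vec_def)
        then show "x $$ (i, j) - M xs $$ (i, j) \<in> \<pp> k"
          using red_cong \<pp>_diff_commute by metis
      qed
      ultimately show "z \<in> (\<lambda>xs. ?R (M xs)) ` G"
        using L x(2) by (auto simp: G_def)
    qed
  qed
  then have "real (card (rep_set p w \<sigma> k (1\<^sub>m m) (diag_of_list ts))) = real (card G)"
    using bij_betw_same_card by metis
  also have "\<dots> = (\<Sum>xs\<in>L. of_bool (gram k m ts xs))"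
  proof -
    have "finite L"
      using finite_lists_length_eq[OF finite_vecs, of k m ?n] by (simp add: L_def conj_commute)
    then show ?thesis
      by (simp add: G_def of_bool_def sum.If_cases Int_def)
  qed
  also have "\<dots> = real (p ^ 2) ^ (k * m * ?n) * dens k m ts"
    unfolding L_def dens_def by (rule sum_lists_eq_lmean)
  finally show ?thesis .
qed

text \<open>
  There are \<open>p^(2kmn)\<close> matrices modulo \<open>p^k\<close>, and \<open>2 m n - n (2 m - n) = n^2\<close>.
\<close>

lemma rep_density_eqI:
  assumes m: "length ts \<le> m"
    and const: "\<And>k. k0 \<le> k \<Longrightarrow> real p ^ (k * (length ts)\<^sup>2) * dens k m ts = \<alpha>"
  shows "rep_density p w \<sigma> (1\<^sub>m m) (diag_of_list ts) = \<alpha>"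
proof -
  let ?n = "length ts"
  have "(1 / real p ^ k) ^ (?n * (2 * m - ?n)) *
      real (card (rep_set p w \<sigma> k (1\<^sub>m m) (diag_of_list ts))) = \<alpha>" if "k0 \<le> k" for k
  proof -
    have e: "2 * (k * m * ?n) = k * (?n * (2 * m - ?n)) + k * ?n\<^sup>2"
    proof -
      have "?n * (2 * m) = ?n * ((2 * m - ?n) + ?n)"
        using m by simp
      then have "k * (?n * (2 * m)) = k * (?n * (2 * m - ?n)) + k * ?n\<^sup>2"
        by (simp only: add_mult_distrib2 power2_eq_square)
      then show ?thesis
        by (simp add: mult_ac)
    qed
    have "real (p ^ 2) ^ (k * m * ?n) = real p ^ (2 * (k * m * ?n))"
      by (simp add: power_mult)
    also have "\<dots> = real p ^ (k * (?n * (2 * m - ?n))) * real p ^ (k * ?n\<^sup>2)"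
      unfolding e by (rule power_add)
    finally have "(1 / real p ^ k) ^ (?n * (2 * m - ?n)) * real (p ^ 2) ^ (k * m * ?n) = real p ^ (k * ?n\<^sup>2)"
      using p_gt_0 by (simp add: power_divide power_mult)
    then show ?thesis
      using const[OF that] unfolding card_rep_set by (simp only: mult.assoc[symmetric])
  qed
  then have "\<forall>\<^sub>F k in sequentially. (1 / real p ^ k) ^ (?n * (2 * m - ?n)) *
      real (card (rep_set p w \<sigma> k (1\<^sub>m m) (diag_of_list ts))) = \<alpha>"
    unfolding eventually_sequentially by blast
  then have "(\<lambda>k. (1 / real p ^ k) ^ (?n * (2 * m - ?n)) *
      real (card (rep_set p w \<sigma> k (1\<^sub>m m) (diag_of_list ts)))) \<longlonglongrightarrow> \<alpha>"
    by (rule tendsto_eventually)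
  then show ?thesis
    unfolding rep_density_def Let_def by (simp add: limI)
qed

end

section \<open>The density polynomial and its derivative\<close>

context odd_unramified_quadratic
begin

lemma rep_density_one_one:
  "rep_density p w \<sigma> (1\<^sub>m n) (1\<^sub>m n) = (\<Prod>j=1..n. 1 - \<xi> ^ j)"
proof -
  have "rep_density p w \<sigma> (1\<^sub>m n) (diag_of_list (replicate n 1)) = (\<Prod>j=1..n. 1 - \<xi> ^ j)"
  proof (rule rep_density_eqI)
    fix k :: nat assume "1 \<le> k"
    then show "real p ^ (k * (length (replicate n (1 :: 'k)))\<^sup>2) * dens k n (replicate n 1) = (\<Prod>j=1..n. 1 - \<xi> ^ j)"
      using dens_replicate_unit[of k n "[]" 0] by (simp add: dens_def)
  qed simp
  then show ?thesis
    by (simp add: one_mat_eq_diag_of_list)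
qed

lemma rep_density_pair:
  fixes r s :: nat and X :: real
  assumes ab: "a < b" "odd (a + b)"
  defines "X \<equiv> \<xi> ^ r"
  shows "rep_density p w \<sigma> (1\<^sub>m (s + 2 + r)) (diag_of_list (replicate s 1 @ [of_nat p ^ a, of_nat p ^ b])) =
    (1 - X) * ((\<Prod>j=1..s. 1 - \<xi> ^ (2 + j) * X) * (1 - X / (real p)\<^sup>2) *
      (\<Sum>i\<le>a div 2. X ^ (2 * i) * (1 + of_bool (2 * i < a) * (X / real p)) *
        (\<Sum>l\<le>b. (real p * X) ^ l * ceil_weight (l - (a - 2 * i)))))"
proof (rule rep_density_eqI)
  let ?ts = "[of_nat p ^ a, of_nat p ^ b :: 'k]"
  fix k assume k: "a + b + 2 \<le> k"
  have l: "length (replicate s (1 :: 'k) @ ?ts) = s + length ?ts" and m: "s + 2 + r = r + 2 + s"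
    by simp_all
  have "k * (length ?ts)\<^sup>2 = 4 * k"
    by (simp add: power2_eq_square)
  then have "real p ^ (k * (length ?ts)\<^sup>2) = real p ^ (4 * k)"
    by (rule arg_cong)
  moreover have "(\<Prod>j=1..s. 1 - \<xi> ^ (r + 2 + j)) = (\<Prod>j=1..s. 1 - \<xi> ^ (2 + j) * X)"
    by (intro prod.cong refl) (simp add: X_def power_add)
  ultimately show "real p ^ (k * (length (replicate s 1 @ ?ts))\<^sup>2) * dens k (s + 2 + r) (replicate s 1 @ ?ts) =
    (1 - X) * ((\<Prod>j=1..s. 1 - \<xi> ^ (2 + j) * X) * (1 - X / (real p)\<^sup>2) *
      (\<Sum>i\<le>a div 2. X ^ (2 * i) * (1 + of_bool (2 * i < a) * (X / real p)) *
        (\<Sum>l\<le>b. (real p * X) ^ l * ceil_weight (l - (a - 2 * i)))))"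
    unfolding l m using k dens_replicate_unit[of k s ?ts "r + 2"] dens_pair[OF ab k, of r]
    by (simp only: X_def) (simp add: mult_ac)
qed simp

end

lemma diag_block_mat_eq_diag_of_list:
  "diag_block_mat [1\<^sub>m s, x \<cdot>\<^sub>m 1\<^sub>m 1, y \<cdot>\<^sub>m 1\<^sub>m 1] = diag_of_list (replicate s 1 @ [x, y :: 'b :: comm_ring_1])"
  by (rule eq_matI) (auto simp: diag_of_list_def Let_def nth_append nth_Cons' four_block_mat_def less_Suc_eq)

lemma extend_by_one_one_mat: "extend_by_one (1\<^sub>m n) r = (1\<^sub>m (n + r) :: 'b :: comm_ring_1 mat)"
  by (rule eq_matI) (auto simp: extend_by_one_def Let_def four_block_mat_def)

lemma poly_map_poly_of_rat:
  "poly (map_poly of_rat F) (of_rat x :: 'b :: field_char_0) = of_rat (poly F x)"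
  by (induction F) (simp_all add: map_poly_pCons of_rat_add of_rat_mult)

context odd_unramified_quadratic
begin

definition ceil_weight_rat :: "nat \<Rightarrow> rat" where
  "ceil_weight_rat j = 1 / of_nat p ^ (2 * ((j + 1) div 2))"

lemma of_rat_ceil_weight_rat: "of_rat (ceil_weight_rat j) = ceil_weight j"
  by (simp add: ceil_weight_rat_def ceil_weight_def of_rat_divide of_rat_power)

definition \<xi>_rat :: rat where
  "\<xi>_rat = - (1 / of_nat p)"

lemma of_rat_\<xi>_rat: "of_rat \<xi>_rat = \<xi>"
  by (simp add: \<xi>_rat_def \<xi>_def of_rat_divide of_rat_minus)

text \<open>
  The density polynomial without its factor \<open>1 - X\<close>.
\<close>

definition pair_poly :: "nat \<Rightarrow> nat \<Rightarrow> nat \<Rightarrow> rat poly" where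
  "pair_poly s a b = (\<Prod>j=1..s. [:1, - (\<xi>_rat ^ (2 + j)):]) * [:1, - (1 / (of_nat p)\<^sup>2):] *
    (\<Sum>i\<le>a div 2. monom 1 (2 * i) * [:1, of_bool (2 * i < a) / of_nat p:] *
      (\<Sum>l\<le>b. monom (of_nat p ^ l * ceil_weight_rat (l - (a - 2 * i))) l))"

lemma of_rat_poly_pair_poly:
  "of_rat (poly (pair_poly s a b) x) =
    (\<Prod>j=1..s. 1 - \<xi> ^ (2 + j) * of_rat x) * (1 - of_rat x / (real p)\<^sup>2) *
      (\<Sum>i\<le>a div 2. of_rat x ^ (2 * i) * (1 + of_bool (2 * i < a) * (of_rat x / real p)) *
        (\<Sum>l\<le>b. (real p * of_rat x) ^ l * ceil_weight (l - (a - 2 * i))))"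
proof -
  have "of_rat (of_bool P) = (of_bool P :: real)" for P
    by (cases P) auto
  then show ?thesis
    unfolding pair_poly_def poly_mult poly_prod poly_sum poly_monom
    by (simp add: of_rat_mult of_rat_hom.hom_prod of_rat_hom.hom_sum of_rat_add of_rat_diff of_rat_minus
        of_rat_divide of_rat_power of_rat_\<xi>_rat of_rat_ceil_weight_rat power_mult_distrib mult_ac)
qed

lemma powi_eq_\<xi>_power: "(- real p) powi (- int r) = \<xi> ^ r"
  by (simp add: power_int_minus \<xi>_def flip: power_inverse) (simp add: inverse_eq_divide)

text \<open>
  Uniqueness holds because the infinitely many values \<open>\<xi>^r\<close> are distinct.
\<close>

lemma rep_poly_pair:
  assumes ab: "a < b" "odd (a + b)"
  shows "rep_poly p w \<sigma> (1\<^sub>m (s + 2)) (diag_of_list (replicate s 1 @ [of_nat p ^ a, of_nat p ^ b])) =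
    [:1, - 1:] * pair_poly s a b"
  unfolding rep_poly_def
proof (rule the_equality)
  let ?T = "diag_of_list (replicate s 1 @ [of_nat p ^ a, of_nat p ^ b :: 'k])"
  let ?F = "[:1, - 1:] * pair_poly s a b"
  have \<xi>r: "(- real p) powi (- int r) = of_rat (\<xi>_rat ^ r)" for r
    by (simp add: powi_eq_\<xi>_power of_rat_power of_rat_\<xi>_rat)
  have val: "rep_density p w \<sigma> (extend_by_one (1\<^sub>m (s + 2)) r) ?T = of_rat (poly ?F (\<xi>_rat ^ r))" for r
    unfolding extend_by_one_one_mat rep_density_pair[OF ab] poly_mult of_rat_mult of_rat_poly_pair_poly
    by (simp add: of_rat_power of_rat_\<xi>_rat of_rat_diff)
  then show "\<forall>r. rep_density p w \<sigma> (extend_by_one (1\<^sub>m (s + 2)) r) ?T =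
      poly (map_poly of_rat ?F) ((- real p) powi (- int r))"
    unfolding \<xi>r poly_map_poly_of_rat by blast
  fix F assume "\<forall>r. rep_density p w \<sigma> (extend_by_one (1\<^sub>m (s + 2)) r) ?T =
      poly (map_poly of_rat F) ((- real p) powi (- int r))"
  then have "of_rat (poly F (\<xi>_rat ^ r)) = (of_rat (poly ?F (\<xi>_rat ^ r)) :: real)" for r
    unfolding \<xi>r poly_map_poly_of_rat val by simp
  then have roots: "range (\<lambda>r. \<xi>_rat ^ r) \<subseteq> {x. poly (F - ?F) x = 0}"
    by (simp only: of_rat_eq_iff) auto
  have "inj (\<lambda>r. \<xi>_rat ^ r)"
  proof (rule injI)
    fix i j assume "\<xi>_rat ^ i = \<xi>_rat ^ j"
    then have "\<bar>\<xi>_rat\<bar> ^ i = \<bar>\<xi>_rat\<bar> ^ j"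
      by (simp flip: power_abs)
    moreover have "0 < \<bar>\<xi>_rat\<bar>" "\<bar>\<xi>_rat\<bar> < 1"
      using p_gt_1 by (simp_all add: \<xi>_rat_def)
    ultimately show "i = j"
      by (metis power_inject_exp' less_irrefl)
  qed
  then have "infinite (range (\<lambda>r. \<xi>_rat ^ r))"
    by (simp add: finite_image_iff)
  then have "infinite {x. poly (F - ?F) x = 0}"
    using roots finite_subset by blast
  then show "F = ?F"
    using poly_roots_finite[of "F - ?F"] by auto
qed

lemma sum_ceil_weight_odd_gap:
  "(\<Sum>l\<le>a + 2 * h + 1. real p ^ l * ceil_weight (l - a)) =
    (\<Sum>l<a. real p ^ l) + real p ^ a * (1 + 1 / real p) * (real h + 1)"
proof (induction h)
  case 0
  have "(\<Sum>l\<le>a. real p ^ l * ceil_weight (l - a)) = (\<Sum>l\<le>a. real p ^ l)"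
    by (intro sum.cong) (auto simp: ceil_weight_def)
  then show ?case
    using p_gt_0 by (simp add: lessThan_Suc_atMost[symmetric] ceil_weight_def field_simps power2_eq_square)
next
  case (Suc h)
  let ?f = "\<lambda>l. real p ^ l * ceil_weight (l - a)" and ?m = "a + 2 * h + 1"
  have "a + 2 * Suc h + 1 = Suc (Suc ?m)"
    by simp
  then have "(\<Sum>l\<le>a + 2 * Suc h + 1. ?f l) = (\<Sum>l\<le>?m. ?f l) + ?f (Suc ?m) + ?f (Suc (Suc ?m))"
    by (simp only: sum.atMost_Suc)
  also have "?f (Suc ?m) = real p ^ a"
    using p_gt_0 by (simp add: ceil_weight_def power_add field_simps)
  also have "?f (Suc (Suc ?m)) = real p ^ a / real p"
    using p_gt_0 by (simp add: ceil_weight_def power_add field_simps)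
  finally show ?case
    unfolding Suc.IH by (simp add: algebra_simps add_divide_distrib)
qed

lemma sum_ceil_weight:
  assumes "a < b" "odd (a + b)"
  shows "(\<Sum>l\<le>b. real p ^ l * ceil_weight (l - a)) =
    (\<Sum>l<a. real p ^ l) + real p ^ a * (1 + 1 / real p) * ((real b - real a + 1) / 2)"
proof -
  have "even (b - a - 1)"
    using assms by presburger
  then obtain h where h: "b - a - 1 = 2 * h"
    by (elim evenE)
  then have b: "b = a + 2 * h + 1"
    using assms(1) by simp
  show ?thesis
    unfolding b sum_ceil_weight_odd_gap by simp
qed

text \<open>
  Passing from \<open>a\<close> to \<open>a + 2\<close> prepends one term on the left, whose value \<open>sum_ceil_weight\<close> gives; all other
  terms only shift their index.
\<close>

lemma derivative_sum:
  assumes "a < b" "odd (a + b)"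
  shows "(\<Sum>i\<le>a div 2. (1 + of_bool (2 * i < a) / real p) * (\<Sum>l\<le>b. real p ^ l * ceil_weight (l - (a - 2 * i)))) =
    (1 + 1 / real p) * (1 / 2 * (\<Sum>l=0..a. real p ^ l * (real a + real b - 2 * real l + 1)))"
  using assms
proof (induction a rule: induct_nat_012)
  case 0
  then show ?case
    using sum_ceil_weight[of 0 b] by simp
next
  case 1
  then show ?case
    using sum_ceil_weight[of 1 b] p_gt_0 by (simp add: field_simps)
next
  case (ge2 a)
  let ?S = "\<lambda>a. \<Sum>l\<le>b. real p ^ l * ceil_weight (l - a)"
  let ?w = "1 + 1 / real p"
  have "(\<Sum>i\<le>Suc (Suc a) div 2. (1 + of_bool (2 * i < Suc (Suc a)) / real p) * ?S (Suc (Suc a) - 2 * i)) =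
      ?w * ?S (Suc (Suc a)) + (\<Sum>i\<le>a div 2. (1 + of_bool (2 * i < a) / real p) * ?S (a - 2 * i))"
    by (simp add: sum.atMost_Suc_shift del: sum.atMost_Suc)
  also have "\<dots> = ?w * (?S (Suc (Suc a)) + 1 / 2 * (\<Sum>l=0..a. real p ^ l * (real a + real b - 2 * real l + 1)))"
    using ge2.IH(1) ge2.prems by (simp add: distrib_left)
  also have "?S (Suc (Suc a)) = (\<Sum>l=0..a. real p ^ l) + real p * real p ^ a +
      real p ^ a * (real p * real p + real p) * ((real b - real a - 1) / 2)"
    using sum_ceil_weight[of "Suc (Suc a)" b] ge2.prems p_gt_0
    by (simp add: lessThan_Suc_atMost atMost_atLeast0 algebra_simps)
  also have "(\<Sum>l=0..a. real p ^ l) + real p * real p ^ a +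
      real p ^ a * (real p * real p + real p) * ((real b - real a - 1) / 2) +
      1 / 2 * (\<Sum>l=0..a. real p ^ l * (real a + real b - 2 * real l + 1)) =
      1 / 2 * (\<Sum>l=0..Suc (Suc a). real p ^ l * (real (Suc (Suc a)) + real b - 2 * real l + 1))"
  proof -
    have "(\<Sum>l=0..a. real p ^ l * (real (Suc (Suc a)) + real b - 2 * real l + 1)) =
        (\<Sum>l=0..a. real p ^ l * (real a + real b - 2 * real l + 1)) + 2 * (\<Sum>l=0..a. real p ^ l)"
      by (simp add: sum_distrib_left flip: sum.distrib) (simp add: algebra_simps)
    then show ?thesis
      by (simp add: field_simps)
  qed
  finally show ?case .
qed

lemma \<xi>_power_less_1: "j > 0 \<Longrightarrow> \<xi> ^ j < 1"
proof -
  assume "j > 0"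
  have "\<bar>\<xi>\<bar> < 1"
    using p_gt_1 by (simp add: \<xi>_def)
  then have "\<bar>\<xi>\<bar> ^ j < 1"
    using \<open>j > 0\<close> by (simp add: power_less_one_iff)
  then show "\<xi> ^ j < 1"
    by (metis abs_ge_self le_less_trans power_abs)
qed

lemma density_derivative_ratio:
  fixes S T :: "'k mat" and s :: nat
  assumes ab: "a < b" "odd (a + b)"
  defines "S \<equiv> 1\<^sub>m (s + 2)"
    and "T \<equiv> diag_of_list (replicate s 1 @ [of_nat p ^ a, of_nat p ^ b])"
  shows "rep_density p w \<sigma> S T = 0"
    and "rep_density_deriv p w \<sigma> S T / rep_density p w \<sigma> S S =
      1 / 2 * (\<Sum>l = 0..a. real p ^ l * (real a + real b - 2 * real l + 1))"
proof -
  show "rep_density p w \<sigma> S T = 0"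
    using rep_density_pair[OF ab, of s 0] by (simp add: S_def T_def)
  define Q where "Q = (\<Prod>j=1..s. 1 - \<xi> ^ (2 + j)) * (1 - 1 / (real p)\<^sup>2)"
  have "poly (pderiv ([:1, - 1:] * G)) 1 = - poly G 1" for G :: "rat poly"
    by (simp only: pderiv_mult poly_add poly_mult) (simp add: pderiv_pCons)
  then have "rep_density_deriv p w \<sigma> S T = of_rat (poly (pair_poly s a b) 1)"
    unfolding rep_density_deriv_def S_def T_def rep_poly_pair[OF ab] by (simp only: of_rat_minus minus_minus)
  also have "\<dots> = Q * ((1 + 1 / real p) * (1 / 2 * (\<Sum>l=0..a. real p ^ l * (real a + real b - 2 * real l + 1))))"
    unfolding of_rat_poly_pair_poly derivative_sum[OF ab, symmetric] Q_def by simp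
  also have "\<dots> = rep_density p w \<sigma> S S * (1 / 2 * (\<Sum>l=0..a. real p ^ l * (real a + real b - 2 * real l + 1)))"
  proof -
    have "(\<Prod>j=1..s + 2. 1 - \<xi> ^ j) = (1 - \<xi>) * ((1 - \<xi>\<^sup>2) * (\<Prod>j=1..s. 1 - \<xi> ^ (2 + j)))"
      by (simp add: prod.atLeast_Suc_atMost prod.shift_bounds_cl_Suc_ivl numeral_2_eq_2 del: prod.cl_ivl_Suc)
    also have "\<dots> = Q * (1 + 1 / real p)"
      by (simp add: Q_def \<xi>_def power2_eq_square mult_ac)
    finally show ?thesis
      unfolding S_def rep_density_one_one by simp
  qed
  finally have deriv: "rep_density_deriv p w \<sigma> S T = rep_density p w \<sigma> S S *
      (1 / 2 * (\<Sum>l=0..a. real p ^ l * (real a + real b - 2 * real l + 1)))" .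
  show "rep_density_deriv p w \<sigma> S T / rep_density p w \<sigma> S S =
      1 / 2 * (\<Sum>l = 0..a. real p ^ l * (real a + real b - 2 * real l + 1))"
  proof -
    have "1 - \<xi> ^ j > 0" if "j \<in> {1..s + 2}" for j
      using \<xi>_power_less_1[of j] that by simp
    then have "(\<Prod>j=1..s + 2. 1 - \<xi> ^ j) > 0"
      by (rule prod_pos)
    then have "rep_density p w \<sigma> S S \<noteq> 0"
      unfolding S_def rep_density_one_one by (rule less_imp_neq[THEN not_sym])
    then show ?thesis
      unfolding deriv by simp
  qed
qed

end

theorem proposition1p2:
  fixes p n a b :: nat
    and v :: "'q::field_char_0 \<Rightarrow> real"
    and w :: "'k::field_char_0 \<Rightarrow> real"
    and \<iota> :: "'q \<Rightarrow> 'k" and \<sigma> :: "'k \<Rightarrow> 'k"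
    and S T :: "'k mat"
  assumes ext: "unramified_quadratic_extension p v w \<iota> \<sigma>"
    and "odd p"
    and "n \<ge> 2"
    and "a < b"
    and "odd (a + b)"
    and S: "S = 1\<^sub>m n"
    and T: "T = diag_block_mat
              [1\<^sub>m (n - 2), of_nat p ^ a \<cdot>\<^sub>m 1\<^sub>m 1, of_nat p ^ b \<cdot>\<^sub>m 1\<^sub>m 1]"
  shows "rep_density p w \<sigma> S T = 0
    \<and> rep_density_deriv p w \<sigma> S T / rep_density p w \<sigma> S S
        = 1 / 2 * (\<Sum>l = 0..a. real p ^ l * (real a + real b - 2 * real l + 1))
    \<and> rep_density p w \<sigma> S S = (\<Prod>l = 1..n. 1 - (- 1) ^ l * (1 / real p ^ l))"
proof -
  interpret odd_unramified_quadratic p v w \<iota> \<sigma>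
    using ext \<open>odd p\<close> by (simp add: odd_unramified_quadratic_def odd_unramified_quadratic_axioms_def)
  have n: "n = n - 2 + 2"
    using \<open>n \<ge> 2\<close> by simp
  have S': "S = 1\<^sub>m (n - 2 + 2)"
    using S n by simp
  have "\<xi> ^ l = (- 1) ^ l * (1 / real p ^ l)" for l
    using power_mult_distrib[of "- 1" "1 / real p" l] by (simp add: \<xi>_def power_divide)
  then have "rep_density p w \<sigma> S S = (\<Prod>l = 1..n. 1 - (- 1) ^ l * (1 / real p ^ l))"
    unfolding S rep_density_one_one by simp
  then show ?thesis
    using density_derivative_ratio[OF \<open>a < b\<close> \<open>odd (a + b)\<close>, of "n - 2"]
    unfolding T diag_block_mat_eq_diag_of_list S'[symmetric] by blast
qed

end
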